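(* Let $\Omega\subset\mathbb{R}^n$ be a smooth bounded domain, let $m\in C(\overline{\Omega})$ change sign in $\Omega$, and let $C$ be a continuous and positive function on $\overline{\Omega}$. For $1<p<\infty$ let $$\lambda_{1,p}(C,m)=\min\left\{\int_\Omega |\nabla u|^p+C|u|^p \;:\; u\in W^{1,p}_0(\Omega),\ \int_\Omega m|u|^p=1\right\}.$$ Then the limit $\lambda_{1,\infty}(C,m):=\lim_{p\to\infty}\big(\lambda_{1,p}(C,m)\big)^{1/p}$ exists and $$\lambda_{1,\infty}(C,m)=\max\left\{\frac{1}{R_+},\,1\right\},\qquad\text{where } R_+:=\max_{x\in\Omega_+}d(x,\partial\Omega).$$
   Context: "$m$ changes sign in $\Omega$" means that both $\{m>0\}:=\{x\in\Omega: m(x)>0\}$ and $\{x\in\Omega: m(x)<0\}$ are nonempty. We set $\Omega_+:=\overline{\{m>0\}}$. $d(x,\partial\Omega)$ is the Euclidean distance from $x$ to $\partial\Omega$. The number $\lambda_{1,p}(C,m)$ is the principal eigenvalue of the problem $-\Delta_p u+C(x)|u|^{p-2}u=\lambda m(x)|u|^{p-2}u$ in $\Omega$, $u=0$ on $\partial\Omega$, where $\Delta_p u:=\mathrm{div}(|\nabla u|^{p-2}\nabla u)$. *)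

theory Defs
  imports "HOL-Analysis.Analysis"
begin

text \<open>
  Functions on an open set \<open>\<Omega>\<close> are total functions whose values outside \<open>\<Omega>\<close> are never used;
  elements of \<open>L\<^sup>p\<close> and of the Sobolev spaces are represented by functions, not by classes modulo
  almost everywhere equality.
\<close>

subsection \<open>Smooth functions and smooth domains\<close>

primrec C_k :: "nat \<Rightarrow> ('a::euclidean_space \<Rightarrow> real) \<Rightarrow> bool" where
  "C_k 0 f \<longleftrightarrow> continuous_on UNIV f"
| "C_k (Suc k) f \<longleftrightarrow> (\<forall>x. f differentiable (at x)) \<and>
     (\<forall>i\<in>Basis. C_k k (\<lambda>x. frechet_derivative f (at x) i))"

definition smooth :: "('a::euclidean_space \<Rightarrow> real) \<Rightarrow> bool" where
  "smooth f \<longleftrightarrow> (\<forall>k. C_k k f)"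

text \<open>
  The boundary is locally the graph of a smooth function, with the domain on one side of it. The
  ``last coordinate'' is the one in the direction of a unit vector \<open>e\<close>; the vector
  \<open>x - (x \<bullet> e) *\<^sub>R e\<close> is the projection of \<open>x\<close> to the hyperplane orthogonal to \<open>e\<close>, and only the
  values of \<open>\<gamma>\<close> on that hyperplane matter.
\<close>

definition smooth_boundary :: "'a::euclidean_space set \<Rightarrow> bool" where
  "smooth_boundary \<Omega> \<longleftrightarrow>
     (\<forall>z\<in>frontier \<Omega>. \<exists>r>0. \<exists>e \<gamma>. norm e = 1 \<and> smooth \<gamma> \<and>
        \<Omega> \<inter> ball z r = {x \<in> ball z r. \<gamma> (x - (x \<bullet> e) *\<^sub>R e) < x \<bullet> e})"

definition smooth_bounded_domain :: "'a::euclidean_space set \<Rightarrow> bool" where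
  "smooth_bounded_domain \<Omega> \<longleftrightarrow>
     open \<Omega> \<and> connected \<Omega> \<and> \<Omega> \<noteq> {} \<and> bounded \<Omega> \<and> smooth_boundary \<Omega>"

subsection \<open>Sobolev spaces\<close>

definition test_functions :: "'a::euclidean_space set \<Rightarrow> ('a \<Rightarrow> real) set" where
  "test_functions \<Omega> =
     {\<phi>. smooth \<phi> \<and> compact (closure {x. \<phi> x \<noteq> 0}) \<and> closure {x. \<phi> x \<noteq> 0} \<subseteq> \<Omega>}"

definition locally_integrable ::
  "'a::euclidean_space set \<Rightarrow> ('a \<Rightarrow> 'b::euclidean_space) \<Rightarrow> bool" where
  "locally_integrable \<Omega> f \<longleftrightarrow> (\<forall>K. compact K \<and> K \<subseteq> \<Omega> \<longrightarrow> integrable (lebesgue_on K) f)"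

definition has_weak_gradient ::
  "'a::euclidean_space set \<Rightarrow> ('a \<Rightarrow> real) \<Rightarrow> ('a \<Rightarrow> 'a) \<Rightarrow> bool" where
  "has_weak_gradient \<Omega> u g \<longleftrightarrow> locally_integrable \<Omega> u \<and> locally_integrable \<Omega> g \<and>
     (\<forall>\<phi>\<in>test_functions \<Omega>. \<forall>i\<in>Basis.
        (LINT x|lebesgue_on \<Omega>. u x * frechet_derivative \<phi> (at x) i)
          = - (LINT x|lebesgue_on \<Omega>. (g x \<bullet> i) * \<phi> x))"

text \<open>The weak gradient is determined only up to a null set; an arbitrary representative is chosen.\<close>

definition weak_gradient ::
  "'a::euclidean_space set \<Rightarrow> ('a \<Rightarrow> real) \<Rightarrow> 'a \<Rightarrow> 'a" where
  "weak_gradient \<Omega> u = (SOME g. has_weak_gradient \<Omega> u g)"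

definition Lp_space ::
  "real \<Rightarrow> 'a::euclidean_space set \<Rightarrow> ('a \<Rightarrow> 'b::euclidean_space) set" where
  "Lp_space p \<Omega> = {f. f \<in> borel_measurable (lebesgue_on \<Omega>) \<and>
     integrable (lebesgue_on \<Omega>) (\<lambda>x. norm (f x) powr p)}"

definition W1p :: "real \<Rightarrow> 'a::euclidean_space set \<Rightarrow> ('a \<Rightarrow> real) set" where
  "W1p p \<Omega> = {u \<in> Lp_space p \<Omega>. \<exists>g\<in>Lp_space p \<Omega>. has_weak_gradient \<Omega> u g}"

definition W1p_norm :: "real \<Rightarrow> 'a::euclidean_space set \<Rightarrow> ('a \<Rightarrow> real) \<Rightarrow> real" where
  "W1p_norm p \<Omega> u =
     (LINT x|lebesgue_on \<Omega>. \<bar>u x\<bar> powr p + norm (weak_gradient \<Omega> u x) powr p) powr (1 / p)"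

text \<open>The closure of the test functions in the \<open>W\<^sup>1\<^sup>,\<^sup>p\<close> norm.\<close>

definition W1p_0 :: "real \<Rightarrow> 'a::euclidean_space set \<Rightarrow> ('a \<Rightarrow> real) set" where
  "W1p_0 p \<Omega> = {u \<in> W1p p \<Omega>. \<exists>\<phi>. (\<forall>k::nat. \<phi> k \<in> test_functions \<Omega>) \<and>
     (\<lambda>k. W1p_norm p \<Omega> (\<lambda>x. u x - \<phi> k x)) \<longlonglongrightarrow> 0}"

subsection \<open>The eigenvalue and the inner radius\<close>

text \<open>
  \<open>LEAST\<close> on the reals is a genuine minimum (not an infimum): nothing is known about its value
  unless the minimum is attained. Likewise for \<open>GREATEST\<close>.
\<close>

definition lambda_1p ::
  "real \<Rightarrow> 'a::euclidean_space set \<Rightarrow> ('a \<Rightarrow> real) \<Rightarrow> ('a \<Rightarrow> real) \<Rightarrow> real" where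
  "lambda_1p p \<Omega> C m = (LEAST s. s \<in>
     {LINT x|lebesgue_on \<Omega>. norm (weak_gradient \<Omega> u x) powr p + C x * \<bar>u x\<bar> powr p | u.
        u \<in> W1p_0 p \<Omega> \<and> (LINT x|lebesgue_on \<Omega>. m x * \<bar>u x\<bar> powr p) = 1})"

definition changes_sign :: "'a set \<Rightarrow> ('a \<Rightarrow> real) \<Rightarrow> bool" where
  "changes_sign \<Omega> m \<longleftrightarrow> {x \<in> \<Omega>. m x > 0} \<noteq> {} \<and> {x \<in> \<Omega>. m x < 0} \<noteq> {}"

definition Omega_plus :: "'a::euclidean_space set \<Rightarrow> ('a \<Rightarrow> real) \<Rightarrow> 'a set" where
  "Omega_plus \<Omega> m = closure {x \<in> \<Omega>. m x > 0}"

definition R_plus :: "'a::euclidean_space set \<Rightarrow> ('a \<Rightarrow> real) \<Rightarrow> real" where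
  "R_plus \<Omega> m = (GREATEST r. r \<in> (\<lambda>x. infdist x (frontier \<Omega>)) ` Omega_plus \<Omega> m)"

end

theory Submission imports Defs "HOL-Complex_Analysis.Great_Picard" "HOL-Real_Asymp.Real_Asymp" begin

text \<open>
  The minimum that defines \<open>lambda_1p\<close> has to be identified before its root can be estimated. For
  \<open>p\<close> larger than the dimension, Morrey's inequality \<open>test_morrey\<close> makes test functions with bounded
  energy bounded and equicontinuous, so a minimising sequence of test functions has a uniformly
  convergent subsequence, and the constraint and the term with \<open>C\<close> pass to the limit. The gradients
  converge too, by convexity: the midpoint of two late members of the sequence nearly satisfies the
  constraint, hence has nearly the minimal energy, and Clarkson's inequality for \<open>p \<ge> 2\<close> turns this
  into a small \<open>L\<^sup>p\<close> distance of the two gradients. So the minimum over \<open>W\<^sup>1\<^sup>,\<^sup>p\<^sub>0\<close> exists and equals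
  the infimum over test functions (\<open>lambda_1p_eq_test_min\<close>). As the weak gradient is an arbitrary
  representative, this also needs the uniqueness of weak gradients (\<open>weak_gradient_AE\<close>).

  The infimum over test functions is then compared with the \<open>p\<close>-th powers of the two candidates;
  every factor that does not depend on \<open>p\<close> disappears in the \<open>p\<close>-th root.

  \<^item> It is at least a constant, because \<open>C\<close> is bounded below by a positive number and \<open>m\<close> is bounded.
    Hence the limit is at least 1.
  \<^item> For a fixed scale \<open>\<rho>\<close>, Morrey's inequality bounds \<open>\<bar>\<phi> x - \<phi> z\<bar>\<close> by \<open>(\<bar>x - z\<bar> + 2 n \<rho>)\<close> times the
    \<open>L\<^sup>p\<close> norm of the gradient, up to a factor that tends to 1 as \<open>p\<close> grows. With \<open>x\<close> in the set where
    \<open>m > 0\<close> and \<open>z\<close> a nearest boundary point, where \<open>\<phi>\<close> vanishes, the distance is at most \<open>R\<^sub>+\<close>. Only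
    these \<open>x\<close> contribute positively to the constraint, so the limit is at least \<open>1 / (R\<^sub>+ + 2 n \<rho>)\<close>,
    and \<open>\<rho>\<close> is arbitrary.
  \<^item> For the opposite inequality (\<open>eventually_test_min_less\<close>), the competitor is a smoothed cone of
    slope at most 1 whose height \<open>a\<close> is slightly below \<open>R\<^sub>+\<close> and whose tip lies in the set where
    \<open>m > 0\<close>. The \<open>p\<close>-th power concentrates at the tip, so for large \<open>p\<close> the part of \<open>\<Omega>\<close> where \<open>m < 0\<close>
    contributes little; the \<open>p\<close>-th root of the quotient is then close to \<open>max 1 a / a\<close>.
\<close>

section \<open>Calculus of smooth functions\<close>

text \<open>
  \<open>C_k\<close> speaks about \<open>frechet_derivative\<close>; this rule accepts a derivative in any computed form.
\<close>

lemma C_k_SucI: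
  assumes "\<And>x. (f has_derivative f' x) (at x)" and "\<And>i. i \<in> Basis \<Longrightarrow> C_k k (\<lambda>x. f' x i)"
  shows "C_k (Suc k) f"
proof -
  have "frechet_derivative f (at x) = f' x" for x
    using frechet_derivative_at[OF assms(1)] by simp
  then show ?thesis
    using assms by (auto simp: differentiable_def)
qed

lemma C_k_SucD: "C_k (Suc k) f \<Longrightarrow> C_k k f"
proof (induction k arbitrary: f)
  case 0
  then show ?case
    by (auto intro!: differentiable_imp_continuous_on simp: differentiable_on_def)
next
  case (Suc k)
  then show ?case by (metis C_k.simps(2))
qed

lemma C_k_continuous: "C_k k f \<Longrightarrow> continuous_on UNIV f"
  by (induction k) (use C_k_SucD in auto)

lemma C_k_const: "C_k k (\<lambda>x. c)"
proof (induction k arbitrary: c)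
  case (Suc k)
  show ?case by (rule C_k_SucI[where f'="\<lambda>_ _. 0"]) (auto intro: Suc)
qed auto

lemma C_k_add:
  assumes "C_k k f" "C_k k g"
  shows "C_k k (\<lambda>x. f x + g x)"
  using assms
proof (induction k arbitrary: f g)
  case (Suc k)
  show ?case
  proof (rule C_k_SucI)
    show "((\<lambda>x. f x + g x) has_derivative
        (\<lambda>i. frechet_derivative f (at x) i + frechet_derivative g (at x) i)) (at x)" for x
      using Suc.prems by (intro has_derivative_add) (auto simp: frechet_derivative_works)
  qed (use Suc in auto)
qed (auto intro: continuous_on_add)

lemma C_k_mult:
  assumes "C_k k f" "C_k k g"
  shows "C_k k (\<lambda>x. f x * g x)"
  using assms
proof (induction k arbitrary: f g)
  case (Suc k)
  show ?case
  proof (rule C_k_SucI)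
    show "((\<lambda>x. f x * g x) has_derivative
        (\<lambda>i. f x * frechet_derivative g (at x) i + frechet_derivative f (at x) i * g x)) (at x)" for x
      using Suc.prems by (intro has_derivative_mult) (auto simp: frechet_derivative_works)
    show "C_k k (\<lambda>x. f x * frechet_derivative g (at x) i + frechet_derivative f (at x) i * g x)"
      if "i \<in> Basis" for i
      using that Suc.prems Suc.prems[THEN C_k_SucD] by (intro C_k_add Suc.IH) auto
  qed
qed (auto intro: continuous_on_mult)

lemma C_k_inner: "C_k k (\<lambda>x. x \<bullet> a)"
proof (cases k)
  case (Suc l)
  show ?thesis unfolding Suc
    by (rule C_k_SucI[where f'="\<lambda>_ i. i \<bullet> a"]) (auto intro!: C_k_const derivative_eq_intros)
qed (auto intro!: continuous_intros)

lemma C_k_compose: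
  fixes g :: "real \<Rightarrow> real"
  assumes "C_k k g" "C_k k f"
  shows "C_k k (\<lambda>x. g (f x))"
  using assms
proof (induction k arbitrary: f g)
  case 0
  then show ?case by (auto intro: continuous_on_compose2)
next
  case (Suc k)
  let ?g' = "\<lambda>t. frechet_derivative g (at t) 1"
  have g: "(g has_derivative (\<lambda>h. h * ?g' t)) (at t)" for t
  proof -
    have "(g has_derivative frechet_derivative g (at t)) (at t)"
      using Suc.prems by (auto simp: frechet_derivative_works)
    moreover have "frechet_derivative g (at t) = (\<lambda>h. h * ?g' t)"
    proof
      show "frechet_derivative g (at t) h = h * ?g' t" for h
        using linear_cmul[OF has_derivative_linear[OF calculation], of h 1] by simp
    qed
    ultimately show ?thesis by (rule has_derivative_eq_rhs)
  qed
  show ?case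
  proof (rule C_k_SucI)
    show "((\<lambda>x. g (f x)) has_derivative (\<lambda>i. frechet_derivative f (at x) i * ?g' (f x))) (at x)" for x
      using Suc.prems by (intro has_derivative_compose[OF _ g]) (auto simp: frechet_derivative_works)
    show "C_k k (\<lambda>x. frechet_derivative f (at x) i * ?g' (f x))" if "i \<in> Basis" for i
      using that Suc.prems C_k_SucD by (intro C_k_mult[OF _ Suc.IH[of ?g' f]]) auto
  qed
qed

lemma has_derivative_quadratic:
  "((\<lambda>x. (norm (x - a))\<^sup>2 + c) has_derivative (\<lambda>i. 2 * ((x - a) \<bullet> i))) (at x)"
  by (auto intro!: derivative_eq_intros simp: power2_norm_eq_inner inner_commute)

text \<open>
  A derivative of a power of the quadratic function is an affine function times another power of it,
  so the induction on \<open>k\<close> has to treat all exponents at once.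
\<close>

lemma C_k_quadratic_powr:
  assumes "c > 0"
  shows "C_k k (\<lambda>x. ((norm (x - a))\<^sup>2 + c) powr s)"
proof (induction k arbitrary: s)
  case 0
  have "(norm (x - a))\<^sup>2 + c \<noteq> 0" for x
    using add_nonneg_pos[OF zero_le_power2 assms, of "norm (x - a)"] by linarith
  then have "continuous_on UNIV (\<lambda>x. ((norm (x - a))\<^sup>2 + c) powr s)"
    by (intro continuous_intros) auto
  then show ?case by simp
next
  case (Suc k)
  have pos: "(norm (x - a))\<^sup>2 + c > 0" for x
    using add_nonneg_pos[OF zero_le_power2 assms] .
  show ?case
  proof (rule C_k_SucI)
    show "((\<lambda>x. ((norm (x - a))\<^sup>2 + c) powr s) has_derivative
      (\<lambda>i. (2 * s) * ((norm (x - a))\<^sup>2 + c) powr (s - 1) * (x \<bullet> i + - (a \<bullet> i)))) (at x)" for x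
    proof -
      have "((\<lambda>t. t powr s) has_derivative (\<lambda>h. (s * ((norm (x - a))\<^sup>2 + c) powr (s - 1)) * h))
          (at ((norm (x - a))\<^sup>2 + c))"
        using has_real_derivative_powr[OF pos, of s x] by (simp add: has_field_derivative_def)
      from has_derivative_compose[OF has_derivative_quadratic this] show ?thesis
        by (rule has_derivative_eq_rhs) (simp add: fun_eq_iff inner_diff_left mult_ac)
    qed
    have "C_k k (\<lambda>x. x \<bullet> i + - (a \<bullet> i))" for i
      by (rule C_k_add[OF C_k_inner C_k_const])
    then show "C_k k (\<lambda>x. (2 * s) * ((norm (x - a))\<^sup>2 + c) powr (s - 1) * (x \<bullet> i + - (a \<bullet> i)))" for i
      by (rule C_k_mult[OF C_k_mult[OF C_k_const Suc]])
  qed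
qed

text \<open>
  The flat function \<open>exp (- e / t)\<close> together with powers of \<open>t\<close>, so that derivatives stay within the
  family. The exponent \<open>j = 0\<close> yields cutoff functions and \<open>j = 1\<close> a smooth approximation of the positive part.
\<close>

definition flat :: "real \<Rightarrow> real \<Rightarrow> real \<Rightarrow> real" where
  "flat e j t = (if t > 0 then t powr j * exp (- (e / t)) else 0)"

lemma flat_tendsto_0:
  assumes "e > 0"
  shows "(flat e j \<longlongrightarrow> 0) (at 0)"
proof -
  have "((\<lambda>t. t powr j * exp (- (e / t))) \<longlongrightarrow> 0) (at_right 0)"
    using assms by real_asymp
  then have "(flat e j \<longlongrightarrow> 0) (at_right 0)"
    by (rule Lim_transform_eventually) (auto simp: flat_def eventually_at_filter)
  moreover have "(flat e j \<longlongrightarrow> 0) (at_left 0)"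
    by (rule Lim_transform_eventually[OF tendsto_const]) (auto simp: flat_def eventually_at_filter)
  ultimately show ?thesis by (simp add: filterlim_split_at)
qed

lemma flat_has_derivative:
  assumes "e > 0"
  shows "(flat e j has_real_derivative (j * flat e (j - 1) t + e * flat e (j - 2) t)) (at t)"
proof -
  consider "t > 0" | "t < 0" | "t = 0" by linarith
  then show ?thesis
  proof cases
    case 1
    have "((\<lambda>t. exp (- (e / t))) has_real_derivative exp (- (e / t)) * (e / t\<^sup>2)) (at t)"
      using 1 by (auto intro!: derivative_eq_intros simp: power2_eq_square)
    from DERIV_mult[OF has_real_derivative_powr[OF 1, of j] this]
    have "((\<lambda>t. t powr j * exp (- (e / t))) has_real_derivative
        (j * flat e (j - 1) t + e * flat e (j - 2) t)) (at t)"
      by (rule DERIV_cong) (use 1 in \<open>simp add: flat_def powr_diff power2_eq_square mult_ac\<close>)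
    then show ?thesis
      by (rule has_field_derivative_transform_within_open[where S="{0<..}"]) (use 1 in \<open>auto simp: flat_def\<close>)
  next
    case 2
    have "((\<lambda>t. 0) has_real_derivative (j * flat e (j - 1) t + e * flat e (j - 2) t)) (at t)"
      using 2 by (auto simp: flat_def)
    then show ?thesis
      by (rule has_field_derivative_transform_within_open[where S="{..<0}"]) (use 2 in \<open>auto simp: flat_def\<close>)
  next
    case 3
    have "((\<lambda>h. (flat e j (0 + h) - flat e j 0) / h) \<longlongrightarrow> 0) (at 0)"
      by (rule Lim_transform_eventually[OF flat_tendsto_0[OF assms, of "j - 1"]])
        (auto simp: flat_def powr_diff eventually_at_filter)
    then show ?thesis using 3 by (simp add: DERIV_def flat_def)
  qed
qed

text \<open>
  The derivative of a member of the family is a combination of two other members, so again the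
  induction has to run over all exponents simultaneously.
\<close>

lemma flat_C_k: "e > 0 \<Longrightarrow> C_k k (flat e j)"
proof (induction k arbitrary: j)
  case 0
  then have "isCont (flat e j) t" for t
    by (rule DERIV_isCont[OF flat_has_derivative])
  then show ?case by (simp add: continuous_at_imp_continuous_on)
next
  case (Suc k)
  show ?case
  proof (rule C_k_SucI)
    show "(flat e j has_derivative (\<lambda>i. (j * flat e (j - 1) t + e * flat e (j - 2) t) * i)) (at t)" for t
      using flat_has_derivative[OF Suc.prems, of j t] by (rule has_field_derivative_imp_has_derivative)
    show "C_k k (\<lambda>t. (j * flat e (j - 1) t + e * flat e (j - 2) t) * i)" for i
      by (rule C_k_mult[OF C_k_add[OF C_k_mult[OF C_k_const Suc.IH] C_k_mult[OF C_k_const Suc.IH]] C_k_const])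
        (rule Suc.prems)+
  qed
qed

section \<open>Test functions and integration by parts\<close>

definition grad :: "('a::euclidean_space \<Rightarrow> real) \<Rightarrow> 'a \<Rightarrow> 'a" where
  "grad f x = (\<Sum>i\<in>Basis. frechet_derivative f (at x) i *\<^sub>R i)"

lemma grad_inner_Basis: "i \<in> Basis \<Longrightarrow> grad f x \<bullet> i = frechet_derivative f (at x) i"
  by (simp add: grad_def inner_sum_left inner_Basis if_distrib cong: if_cong)

lemma smooth_has_derivative:
  assumes "smooth f"
  shows "(f has_derivative (\<lambda>h. grad f x \<bullet> h)) (at x)"
proof -
  let ?D = "frechet_derivative f (at x)"
  have "C_k (Suc 0) f" using assms by (simp add: smooth_def del: C_k.simps)
  then have D: "(f has_derivative ?D) (at x)"
    by (simp add: frechet_derivative_works)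
  have lin: "linear ?D" using D by (rule has_derivative_linear)
  have "?D h = grad f x \<bullet> h" for h
  proof -
    have "?D h = ?D (\<Sum>i\<in>Basis. (h \<bullet> i) *\<^sub>R i)" by (simp add: euclidean_representation)
    also have "\<dots> = (\<Sum>i\<in>Basis. (h \<bullet> i) * ?D i)"
      by (simp add: linear_sum[OF lin] linear_cmul[OF lin])
    also have "\<dots> = grad f x \<bullet> h"
      by (simp add: grad_def inner_sum_left mult.commute inner_commute[of h])
    finally show ?thesis .
  qed
  then have "?D = (\<lambda>h. grad f x \<bullet> h)" by (rule ext)
  with D show ?thesis by (rule has_derivative_eq_rhs)
qed

lemma grad_unique:
  assumes "(f has_derivative (\<lambda>h. v \<bullet> h)) (at x)"
  shows "grad f x = v"
proof -
  have "frechet_derivative f (at x) = (\<lambda>h. v \<bullet> h)"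
    using frechet_derivative_at[OF assms] by (rule sym)
  then show ?thesis by (simp add: grad_def euclidean_representation)
qed

lemma smooth_partial: "smooth f \<Longrightarrow> i \<in> Basis \<Longrightarrow> C_k k (\<lambda>x. grad f x \<bullet> i)"
  by (simp add: grad_inner_Basis smooth_def) (metis C_k.simps(2))

lemma smooth_continuous: "smooth f \<Longrightarrow> continuous_on A f"
  unfolding smooth_def using C_k_continuous[of 0 f] continuous_on_subset by blast

lemma grad_continuous:
  assumes "smooth f" shows "continuous_on A (grad f)"
proof -
  have "continuous_on UNIV (\<lambda>x. \<Sum>i\<in>Basis. (grad f x \<bullet> i) *\<^sub>R i)"
    by (intro continuous_on_sum continuous_on_scaleR continuous_on_const C_k_continuous[of 0] smooth_partial assms)
  then have "continuous_on UNIV (grad f)" by (simp add: euclidean_representation)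
  then show ?thesis by (rule continuous_on_subset) simp
qed

lemma smooth_const: "smooth (\<lambda>x. c)"
  and smooth_add: "smooth f \<Longrightarrow> smooth g \<Longrightarrow> smooth (\<lambda>x. f x + g x)"
  and smooth_mult: "smooth f \<Longrightarrow> smooth g \<Longrightarrow> smooth (\<lambda>x. f x * g x)"
  unfolding smooth_def by (simp_all add: C_k_const C_k_add C_k_mult)

lemma grad_add: "smooth f \<Longrightarrow> smooth g \<Longrightarrow> grad (\<lambda>x. f x + g x) x = grad f x + grad g x"
  by (rule grad_unique) (auto intro!: derivative_eq_intros smooth_has_derivative simp: inner_add_left)

lemma grad_cmult: "smooth f \<Longrightarrow> grad (\<lambda>x. c * f x) x = c *\<^sub>R grad f x"
  by (rule grad_unique) (auto intro!: derivative_eq_intros smooth_has_derivative)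

lemma grad_mult: "smooth f \<Longrightarrow> smooth g \<Longrightarrow> grad (\<lambda>x. f x * g x) x = f x *\<^sub>R grad g x + g x *\<^sub>R grad f x"
  by (rule grad_unique) (auto intro!: derivative_eq_intros smooth_has_derivative simp: inner_add_left)

text \<open>
  A compact set outside of which the function vanishes is easier to propagate through sums and
  products than the closure of the set where it does not vanish.
\<close>

lemma test_functions_iff:
  "\<phi> \<in> test_functions U \<longleftrightarrow> smooth \<phi> \<and> (\<exists>K. compact K \<and> K \<subseteq> U \<and> (\<forall>x. x \<notin> K \<longrightarrow> \<phi> x = 0))"
proof
  assume "\<phi> \<in> test_functions U"
  then show "smooth \<phi> \<and> (\<exists>K. compact K \<and> K \<subseteq> U \<and> (\<forall>x. x \<notin> K \<longrightarrow> \<phi> x = 0))"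
    using closure_subset[of "{x. \<phi> x \<noteq> 0}"]
    by (auto simp: test_functions_def intro!: exI[of _ "closure {x. \<phi> x \<noteq> 0}"])
next
  assume "smooth \<phi> \<and> (\<exists>K. compact K \<and> K \<subseteq> U \<and> (\<forall>x. x \<notin> K \<longrightarrow> \<phi> x = 0))"
  then obtain K where K: "smooth \<phi>" "compact K" "K \<subseteq> U" "\<And>x. x \<notin> K \<Longrightarrow> \<phi> x = 0" by blast
  then have "closure {x. \<phi> x \<noteq> 0} \<subseteq> K"
    by (intro closure_minimal compact_imp_closed) auto
  with K show "\<phi> \<in> test_functions U"
    using compact_Int_closed[of K "closure {x. \<phi> x \<noteq> 0}"]
    by (auto simp: test_functions_def Int_absorb1)
qed

lemma test_smooth: "\<phi> \<in> test_functions U \<Longrightarrow> smooth \<phi>"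
  by (simp add: test_functions_iff)

lemma test_support:
  assumes "\<phi> \<in> test_functions U"
  obtains K where "compact K" "K \<subseteq> U" "\<And>x. x \<notin> K \<Longrightarrow> \<phi> x = 0" "\<And>x. x \<notin> K \<Longrightarrow> grad \<phi> x = 0"
proof -
  obtain K where K: "compact K" "K \<subseteq> U" "\<And>x. x \<notin> K \<Longrightarrow> \<phi> x = 0"
    using assms by (auto simp: test_functions_iff)
  have "grad \<phi> x = 0" if "x \<notin> K" for x
  proof (rule grad_unique)
    have "((\<lambda>x. 0) has_derivative (\<lambda>h. 0 \<bullet> h)) (at x)" by simp
    then show "(\<phi> has_derivative (\<lambda>h. 0 \<bullet> h)) (at x)"
      by (rule has_derivative_transform_within_open[where s="- K"])
        (use K that in \<open>auto intro: compact_imp_closed\<close>)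
  qed
  with K that show ?thesis by blast
qed

lemma test_add:
  assumes "\<phi> \<in> test_functions U" "\<psi> \<in> test_functions U"
  shows "(\<lambda>x. \<phi> x + \<psi> x) \<in> test_functions U"
proof -
  obtain K L where "compact K" "K \<subseteq> U" "\<forall>x. x \<notin> K \<longrightarrow> \<phi> x = 0" "compact L" "L \<subseteq> U" "\<forall>x. x \<notin> L \<longrightarrow> \<psi> x = 0"
    using assms by (auto simp: test_functions_iff)
  then have "compact (K \<union> L) \<and> K \<union> L \<subseteq> U \<and> (\<forall>x. x \<notin> K \<union> L \<longrightarrow> \<phi> x + \<psi> x = 0)" by auto
  then show ?thesis
    using assms unfolding test_functions_iff by (blast intro: smooth_add)
qed

lemma test_mult:
  assumes "smooth \<phi>" "\<psi> \<in> test_functions U"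
  shows "(\<lambda>x. \<phi> x * \<psi> x) \<in> test_functions U"
proof -
  obtain L where "compact L \<and> L \<subseteq> U \<and> (\<forall>x. x \<notin> L \<longrightarrow> \<phi> x * \<psi> x = 0)"
    using assms by (auto simp: test_functions_iff)
  then show ?thesis
    using assms unfolding test_functions_iff by (blast intro: smooth_mult)
qed

lemma test_cmult: "\<psi> \<in> test_functions U \<Longrightarrow> (\<lambda>x. c * \<psi> x) \<in> test_functions U"
  by (rule test_mult[OF smooth_const])

lemma integrable_compact_support:
  fixes f :: "'a::euclidean_space \<Rightarrow> 'b::{banach, second_countable_topology}"
  assumes "continuous_on UNIV f" "compact K" "\<And>x. x \<notin> K \<Longrightarrow> f x = 0"
  shows "integrable lborel f"
proof -
  have "f = (\<lambda>x. indicator K x *\<^sub>R f x)" using assms(3) by (auto simp: indicator_def)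
  with borel_integrable_compact[OF assms(2) continuous_on_subset[OF assms(1)]] show ?thesis by simp
qed

text \<open>
  Passing to the whole space makes the translation and scaling invariance of Lebesgue measure available.
\<close>

lemma lebesgue_on_supported:
  fixes f :: "'a::euclidean_space \<Rightarrow> 'b::{banach, second_countable_topology}"
  assumes "f \<in> borel_measurable borel" "U \<in> sets lebesgue" "\<And>x. x \<notin> U \<Longrightarrow> f x = 0"
  shows "integrable (lebesgue_on U) f \<longleftrightarrow> integrable lborel f"
    and "integral\<^sup>L (lebesgue_on U) f = integral\<^sup>L lborel f"
proof -
  have f: "(\<lambda>x. indicator U x *\<^sub>R f x) = f" using assms(3) by (auto simp: indicator_def)
  have m: "f \<in> borel_measurable lborel" using assms(1) by simp
  show "integrable (lebesgue_on U) f \<longleftrightarrow> integrable lborel f"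
    using assms(2) by (simp add: integrable_restrict_space f integrable_completion[OF m])
  show "integral\<^sup>L (lebesgue_on U) f = integral\<^sup>L lborel f"
    using assms(2) by (simp add: integral_restrict_space f integral_completion[OF m])
qed

lemma continuous_locally_integrable:
  assumes "continuous_on UNIV f" shows "locally_integrable U f"
  unfolding locally_integrable_def
proof (intro allI impI)
  fix K :: "'a set" assume K: "compact K \<and> K \<subseteq> U"
  then have "integrable lborel (\<lambda>x. indicator K x *\<^sub>R f x)"
    using assms by (intro borel_integrable_compact continuous_on_subset[OF assms]) auto
  moreover have "K \<in> sets lebesgue" using K by (simp add: borel_compact sets_completionI_sets)
  ultimately show "integrable (lebesgue_on K) f"
    by (simp add: integrable_restrict_space integrable_completion borel_measurable_integrable)
qed

text \<open>
  By translation invariance the difference quotients in direction \<open>i\<close> have integral 0. They converge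
  to the directional derivative, dominated by a Lipschitz constant on a bounded set.
\<close>

lemma test_integral_partial:
  fixes u :: "'a::euclidean_space \<Rightarrow> real"
  assumes "u \<in> test_functions U" "norm i = 1"
  shows "(LINT x|lborel. grad u x \<bullet> i) = 0"
proof -
  obtain K where K: "compact K" "\<And>x. x \<notin> K \<Longrightarrow> u x = 0" "\<And>x. x \<notin> K \<Longrightarrow> grad u x = 0"
    using test_support[OF assms(1)] by metis
  have sm: "smooth u" using assms test_smooth by blast
  obtain B where B: "\<And>x. x \<in> K \<Longrightarrow> norm x \<le> B"
    using compact_imp_bounded[OF K(1)] by (auto simp: bounded_iff)
  have "bounded (grad u ` K)"
    using K(1) grad_continuous[OF sm] by (intro compact_imp_bounded compact_continuous_image)
  then obtain L where L: "L > 0" "\<And>x. x \<in> K \<Longrightarrow> norm (grad u x) \<le> L"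
    by (auto simp: bounded_pos)
  then have L': "norm (grad u x) \<le> L" for x using K(3)[of x] by (cases "x \<in> K") auto
  have lip: "norm (u x - u y) \<le> L * norm (x - y)" for x y
  proof (rule differentiable_bound[OF convex_UNIV])
    show "(u has_derivative (\<lambda>h. grad u x \<bullet> h)) (at x within UNIV)" for x
      using smooth_has_derivative[OF sm] by simp
    show "onorm (\<lambda>h. grad u x \<bullet> h) \<le> L" for x
      using L(1) L' by (intro onorm_bound) (auto intro!: order_trans[OF Cauchy_Schwarz_ineq2] mult_right_mono)
  qed auto
  define q where "q n x = real (Suc n) * (u (inverse (real (Suc n)) *\<^sub>R i + x) - u x)" for n x
  have intu: "integrable lborel u"
    using integrable_compact_support[OF smooth_continuous[OF sm] K(1,2)] .
  have mu: "u \<in> borel_measurable borel"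
    using smooth_continuous[OF sm] by (rule borel_measurable_continuous_onI)
  have shift: "integrable lborel (\<lambda>x. u (c + x))" "(LINT x|lborel. u (c + x)) = (LINT x|lborel. u x)" for c
  proof -
    show "integrable lborel (\<lambda>x. u (c + x))"
      using intu mu lborel_distr_plus[of c] integrable_distr[of "(+) c" lborel borel u] by simp
    show "(LINT x|lborel. u (c + x)) = (LINT x|lborel. u x)"
      using mu lborel_distr_plus[of c] integral_distr[of "(+) c" lborel borel u] by simp
  qed
  \<comment> \<open>The steps are at most 1, so the quotients vanish outside the ball of radius \<open>B + 1\<close>.\<close>
  have "(\<lambda>n. integral\<^sup>L lborel (q n)) \<longlonglongrightarrow> (LINT x|lborel. grad u x \<bullet> i)"
  proof (rule integral_dominated_convergence[where w="\<lambda>x. indicator (cball 0 (B + 1)) x * L"])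
    show "(\<lambda>x. grad u x \<bullet> i) \<in> borel_measurable lborel"
      using grad_continuous[OF sm, of UNIV] by (auto intro!: borel_measurable_continuous_onI continuous_intros)
    show "q n \<in> borel_measurable lborel" for n
      using mu unfolding q_def by simp
    show "integrable lborel (\<lambda>x. indicator (cball 0 (B + 1)) x * L)"
      using borel_integrable_compact[of "cball 0 (B + 1)" "\<lambda>x. L"] by simp
    show "AE x in lborel. (\<lambda>n. q n x) \<longlonglongrightarrow> grad u x \<bullet> i"
    proof (rule AE_I2)
      fix x
      have "((\<lambda>t. x + t *\<^sub>R i) has_derivative (\<lambda>t. t *\<^sub>R i)) (at 0)"
        by (auto intro!: derivative_eq_intros)
      moreover have "(u has_derivative (\<lambda>h. grad u x \<bullet> h)) (at (x + 0 *\<^sub>R i))"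
        using smooth_has_derivative[OF sm, of x] by simp
      ultimately have "((\<lambda>t. u (x + t *\<^sub>R i)) has_derivative (\<lambda>t. grad u x \<bullet> (t *\<^sub>R i))) (at 0)"
        by (rule has_derivative_compose)
      then have "((\<lambda>t. u (x + t *\<^sub>R i)) has_real_derivative (grad u x \<bullet> i)) (at 0)"
        unfolding has_field_derivative_def by (rule has_derivative_eq_rhs) (simp add: fun_eq_iff mult.commute)
      then have "(\<lambda>t. (u (x + t *\<^sub>R i) - u x) / t) \<midarrow>0\<rightarrow> grad u x \<bullet> i"
        by (simp add: DERIV_def)
      moreover have "filterlim (\<lambda>n. inverse (real (Suc n))) (at 0) sequentially"
        using LIMSEQ_inverse_real_of_nat by (auto simp: filterlim_at)
      ultimately have "(\<lambda>n. (u (x + inverse (real (Suc n)) *\<^sub>R i) - u x) / inverse (real (Suc n))) \<longlonglongrightarrow> grad u x \<bullet> i"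
        by (rule filterlim_compose)
      then show "(\<lambda>n. q n x) \<longlonglongrightarrow> grad u x \<bullet> i"
        by (simp add: q_def divide_inverse mult.commute add.commute)
    qed
    show "AE x in lborel. norm (q n x) \<le> indicator (cball 0 (B + 1)) x * L" for n
    proof (rule AE_I2)
      fix x
      let ?h = "inverse (real (Suc n))"
      have h: "0 < ?h" "?h \<le> 1" by (auto simp: inverse_le_1_iff)
      show "norm (q n x) \<le> indicator (cball 0 (B + 1)) x * L"
      proof (cases "x \<in> cball 0 (B + 1)")
        case True
        have "norm (q n x) = real (Suc n) * norm (u (?h *\<^sub>R i + x) - u x)"
          unfolding q_def by (simp add: abs_mult)
        also have "\<dots> \<le> real (Suc n) * (L * norm (?h *\<^sub>R i + x - x))"
          by (intro mult_left_mono lip) simp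
        also have "\<dots> = L" using assms(2) h by (simp add: field_simps)
        finally show ?thesis using True by simp
      next
        case False
        then have "norm x > B + 1" by simp
        moreover have "norm x \<le> norm (?h *\<^sub>R i + x) + ?h"
          using norm_triangle_ineq4[of "?h *\<^sub>R i + x" "?h *\<^sub>R i"] assms(2) h by simp
        ultimately have "x \<notin> K" "?h *\<^sub>R i + x \<notin> K"
          using B h(2) by (auto simp: not_le[symmetric] dest!: B)
        then show ?thesis using K False by (simp add: q_def)
      qed
    qed
  qed
  moreover have "integral\<^sup>L lborel (q n) = 0" for n
    unfolding q_def using shift intu by simp
  ultimately show ?thesis by (simp add: LIMSEQ_const_iff)
qed

text \<open>
  Integration by parts: the preceding lemma applied to the product of the two functions.
\<close>

lemma test_has_weak_gradient:
  assumes "\<phi> \<in> test_functions U" "U \<in> sets lebesgue"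
  shows "has_weak_gradient U \<phi> (grad \<phi>)"
  unfolding has_weak_gradient_def
proof (intro conjI ballI)
  have sm: "smooth \<phi>" using assms test_smooth by blast
  show "locally_integrable U \<phi>" "locally_integrable U (grad \<phi>)"
    using smooth_continuous[OF sm] grad_continuous[OF sm] by (auto intro: continuous_locally_integrable)
  fix \<psi> i assume \<psi>: "\<psi> \<in> test_functions U" and i: "i \<in> (Basis :: 'a set)"
  have sm': "smooth \<psi>" using \<psi> test_smooth by blast
  obtain K where K: "compact K" "K \<subseteq> U" "\<And>x. x \<notin> K \<Longrightarrow> \<psi> x = 0" "\<And>x. x \<notin> K \<Longrightarrow> grad \<psi> x = 0"
    using test_support[OF \<psi>] by metis
  note c = smooth_continuous[OF sm, of UNIV] smooth_continuous[OF sm', of UNIV]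
    grad_continuous[OF sm, of UNIV] grad_continuous[OF sm', of UNIV]
  have c1: "continuous_on UNIV (\<lambda>x. \<phi> x * (grad \<psi> x \<bullet> i))" "continuous_on UNIV (\<lambda>x. (grad \<phi> x \<bullet> i) * \<psi> x)"
    using c by (auto intro!: continuous_intros)
  have i1: "integrable lborel (\<lambda>x. \<phi> x * (grad \<psi> x \<bullet> i))" "integrable lborel (\<lambda>x. (grad \<phi> x \<bullet> i) * \<psi> x)"
    using K by (auto intro!: integrable_compact_support c1)
  have "0 = (LINT x|lborel. grad (\<lambda>x. \<phi> x * \<psi> x) x \<bullet> i)"
    using test_integral_partial[OF test_mult[OF sm \<psi>]] i by simp
  also have "\<dots> = (LINT x|lborel. \<phi> x * (grad \<psi> x \<bullet> i) + (grad \<phi> x \<bullet> i) * \<psi> x)"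
    by (simp add: grad_mult[OF sm sm'] inner_add_left mult.commute)
  also have "\<dots> = (LINT x|lborel. \<phi> x * (grad \<psi> x \<bullet> i)) + (LINT x|lborel. (grad \<phi> x \<bullet> i) * \<psi> x)"
    using i1 by simp
  also have "(LINT x|lborel. \<phi> x * (grad \<psi> x \<bullet> i)) = (LINT x|lebesgue_on U. \<phi> x * (grad \<psi> x \<bullet> i))"
    using K(2-) assms(2) by (intro lebesgue_on_supported(2)[symmetric] borel_measurable_continuous_onI c1) force+
  also have "(LINT x|lborel. (grad \<phi> x \<bullet> i) * \<psi> x) = (LINT x|lebesgue_on U. (grad \<phi> x \<bullet> i) * \<psi> x)"
    using K(2-) assms(2) by (intro lebesgue_on_supported(2)[symmetric] borel_measurable_continuous_onI c1) force+
  finally show "(LINT x|lebesgue_on U. \<phi> x * frechet_derivative \<psi> (at x) i) =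
      - (LINT x|lebesgue_on U. (grad \<phi> x \<bullet> i) * \<psi> x)"
    using i by (simp add: grad_inner_Basis)
qed

section \<open>Uniqueness of the weak gradient\<close>

lemma flat_bounds: "e > 0 \<Longrightarrow> 0 \<le> flat e 0 t" "e > 0 \<Longrightarrow> flat e 0 t \<le> 1"
  by (auto simp: flat_def)

lemma flat_tendsto_indicator:
  "(\<lambda>n. flat (inverse (real (Suc n))) 0 t) \<longlonglongrightarrow> indicator {0<..} t"
proof (cases "t > 0")
  case True
  have "(\<lambda>n. exp (- (inverse (real (Suc n)) / t))) \<longlonglongrightarrow> exp (- (0 / t))"
    using True by (intro tendsto_intros LIMSEQ_inverse_real_of_nat) auto
  with True show ?thesis by (simp add: flat_def)
qed (simp add: flat_def)

text \<open>
  One factor for each face of the box; the limit as \<open>n\<close> grows is the indicator of the open box.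
\<close>

definition box_bump :: "'a::euclidean_space \<Rightarrow> 'a \<Rightarrow> nat \<Rightarrow> 'a \<Rightarrow> real" where
  "box_bump a b n x = (\<Prod>i\<in>Basis. flat (inverse (real (Suc n))) 0 (x \<bullet> i + - (a \<bullet> i)) *
     flat (inverse (real (Suc n))) 0 (-1 * (x \<bullet> i) + b \<bullet> i))"

lemma smooth_prod: "finite I \<Longrightarrow> (\<And>i. i \<in> I \<Longrightarrow> smooth (f i)) \<Longrightarrow> smooth (\<lambda>x. \<Prod>i\<in>I. f i x)"
  by (induction I rule: finite_induct) (auto intro: smooth_const smooth_mult)

lemma box_bump_smooth: "smooth (box_bump a b n)"
proof -
  have "smooth (\<lambda>x. flat (inverse (real (Suc n))) 0 (x \<bullet> i + - (a \<bullet> i)))" for i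
    unfolding smooth_def by (rule allI, rule C_k_compose[OF flat_C_k C_k_add[OF C_k_inner C_k_const]]) simp
  moreover have "smooth (\<lambda>x. flat (inverse (real (Suc n))) 0 (-1 * (x \<bullet> i) + b \<bullet> i))" for i
    unfolding smooth_def by (rule allI, rule C_k_compose[OF flat_C_k C_k_add[OF C_k_mult[OF C_k_const C_k_inner] C_k_const]]) simp
  ultimately have "smooth (\<lambda>x. \<Prod>i\<in>Basis. flat (inverse (real (Suc n))) 0 (x \<bullet> i + - (a \<bullet> i)) *
     flat (inverse (real (Suc n))) 0 (-1 * (x \<bullet> i) + b \<bullet> i))"
    by (intro smooth_prod smooth_mult) auto
  then show ?thesis by (simp add: box_bump_def[abs_def])
qed

lemma box_bump_zero: "x \<notin> box a b \<Longrightarrow> box_bump a b n x = 0"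
  by (auto simp: box_bump_def mem_box flat_def intro: prod_zero)

lemma box_bump_bounds: "0 \<le> box_bump a b n x" "box_bump a b n x \<le> 1"
  unfolding box_bump_def by (auto intro!: prod_nonneg prod_le_1 mult_le_one mult_nonneg_nonneg flat_bounds)

lemma box_bump_tendsto: "(\<lambda>n. box_bump a b n x) \<longlonglongrightarrow> indicator (box a b) x"
proof -
  let ?f = "\<lambda>i. indicator {0<..} (x \<bullet> i + - (a \<bullet> i)) * indicator {0<..} (-1 * (x \<bullet> i) + b \<bullet> i) :: real"
  have "(\<lambda>n. box_bump a b n x) \<longlonglongrightarrow> (\<Prod>i\<in>Basis. ?f i)"
    unfolding box_bump_def
    by (rule Limits.tendsto_prod, rule tendsto_mult, (rule flat_tendsto_indicator)+)
  also have "(\<Prod>i\<in>Basis. ?f i) = indicator (box a b) x"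
  proof (cases "x \<in> box a b")
    case True
    then show ?thesis by (simp add: mem_box)
  next
    case False
    then obtain i where "i \<in> Basis" "?f i = 0"
      by (auto simp: mem_box indicator_def)
    then have "(\<Prod>i\<in>Basis. ?f i) = 0" by (intro prod_zero) auto
    with False show ?thesis by simp
  qed
  finally show ?thesis .
qed

lemma box_bump_test:
  assumes "cbox a b \<subseteq> U" shows "box_bump a b n \<in> test_functions U"
proof -
  have "x \<notin> box a b" if "x \<notin> cbox a b" for x
    using that box_subset_cbox[of a b] by blast
  then have "\<forall>x. x \<notin> cbox a b \<longrightarrow> box_bump a b n x = 0"
    using box_bump_zero by metis
  then show ?thesis
    unfolding test_functions_iff using assms
    by (intro conjI box_bump_smooth exI[of _ "cbox a b"] compact_cbox)
qed

lemma locally_integrable_indicator: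
  fixes f :: "'a::euclidean_space \<Rightarrow> 'b::euclidean_space"
  assumes "locally_integrable U f" "compact K" "K \<subseteq> U"
  shows "integrable lebesgue (\<lambda>x. indicator K x *\<^sub>R f x)"
proof -
  have "K \<in> sets lebesgue" using assms(2) by (simp add: borel_compact sets_completionI_sets)
  moreover have "integrable (lebesgue_on K) f"
    using assms by (simp add: locally_integrable_def)
  ultimately show ?thesis by (simp add: integrable_restrict_space)
qed

text \<open>
  Boxes are stable under intersection and generate the Borel sets, so vanishing integrals extend from
  boxes to all Borel sets; a Lebesgue set differs from a Borel set by a null set only.
\<close>

lemma AE_zero_if_box_integrals_zero:
  fixes F :: "'a::euclidean_space \<Rightarrow> real"
  assumes F: "integrable lebesgue F" and tot: "integral\<^sup>L lebesgue F = 0"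
    and box: "\<And>a b. set_lebesgue_integral lebesgue (box a b) F = 0"
  shows "AE x in lebesgue. F x = 0"
proof (rule density_unique_real[OF F, of "\<lambda>_. 0"])
  have si: "set_integrable lebesgue A F" if "A \<in> sets borel" for A
    unfolding set_integrable_def using that by (intro integrable_mult_indicator F) (simp add: sets_completionI_sets)
  have borel: "set_lebesgue_integral lebesgue S F = 0" if "S \<in> sets borel" for S
  proof -
    let ?G = "range (\<lambda>(a, b). box a b :: 'a set)"
    have sb: "sigma_sets UNIV ?G = sets borel"
      by (subst borel_eq_box) (simp add: sets_measure_of)
    have "Int_stable ?G"
    proof (rule Int_stableI)
      fix A B assume "A \<in> ?G" "B \<in> ?G"
      then obtain a b c d where "A = box a b" "B = box c d" by auto
      then have "A \<inter> B = case_prod box (\<Sum>i\<in>Basis. max (a\<bullet>i) (c\<bullet>i) *\<^sub>R i, \<Sum>i\<in>Basis. min (b\<bullet>i) (d\<bullet>i) *\<^sub>R i)"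
        by (simp add: box_Int_box)
      then show "A \<inter> B \<in> ?G" by (rule image_eqI) simp
    qed
    moreover have "?G \<subseteq> Pow UNIV" by simp
    moreover have "S \<in> sigma_sets UNIV ?G" using that sb by simp
    ultimately show ?thesis
    proof (induction rule: sigma_sets_induct_disjoint)
      case (basic A)
      then show ?case using box by auto
    next
      case empty
      show ?case by (simp add: set_lebesgue_integral_def)
    next
      case (compl A)
      have "set_lebesgue_integral lebesgue (UNIV - A) F = (LINT x|lebesgue. F x - indicator A x *\<^sub>R F x)"
        unfolding set_lebesgue_integral_def by (intro Bochner_Integration.integral_cong) (auto simp: indicator_def)
      also have "\<dots> = 0"
        using compl tot F si[of A] unfolding sb set_integrable_def set_lebesgue_integral_def by simp
      finally show ?case .
    next
      case (union A)
      have "A i \<in> sets borel" for i using union sb by auto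
      then have "set_lebesgue_integral lebesgue (\<Union>i. A i) F = (\<Sum>i. set_lebesgue_integral lebesgue (A i) F)"
        using union(1) by (intro lebesgue_integral_countable_add si)
          (auto simp: disjoint_family_on_def sets_completionI_sets)
      then show ?case using union(3) by simp
    qed
  qed
  fix A :: "'a set" assume "A \<in> sets lebesgue"
  then obtain S N N' where A: "A = S \<union> N" "N \<subseteq> N'" "N' \<in> null_sets lborel" "S \<in> sets lborel"
    by (rule sets_completionE)
  have "AE x in lebesgue. x \<notin> N'"
    using A(3) by (intro AE_not_in null_sets_completionI)
  then have AE: "AE x in lebesgue. indicator A x *\<^sub>R F x = indicator S x *\<^sub>R F x"
    by eventually_elim (use A in \<open>auto simp: indicator_def\<close>)
  have "integrable lebesgue (\<lambda>x. indicator B x *\<^sub>R F x)" if "B \<in> sets lebesgue" for B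
    by (rule integrable_mult_indicator[OF that F])
  from this[THEN borel_measurable_integrable]
  have "set_lebesgue_integral lebesgue A F = set_lebesgue_integral lebesgue S F"
    unfolding set_lebesgue_integral_def
    using \<open>A \<in> sets lebesgue\<close> A(4) by (intro integral_cong_AE AE) (auto intro: sets_completionI_sets)
  then show "set_lebesgue_integral lebesgue A F = set_lebesgue_integral lebesgue A (\<lambda>_. 0)"
    using borel A(4) by (simp add: set_lebesgue_integral_def)
qed simp

text \<open>
  Testing with \<open>box_bump\<close> shows that the integral over every box with closure in \<open>U\<close> vanishes. Inside a
  fixed box the function is integrable, and intersections with other boxes are again boxes, so it
  vanishes there almost everywhere; countably many boxes cover \<open>U\<close>.
\<close>

lemma fundamental_lemma_calculus_of_variations:
  fixes f :: "'a::euclidean_space \<Rightarrow> real"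
  assumes U: "open U" and f: "locally_integrable U f"
    and 0: "\<And>\<phi>. \<phi> \<in> test_functions U \<Longrightarrow> (LINT x|lebesgue_on U. f x * \<phi> x) = 0"
  shows "AE x in lebesgue_on U. f x = 0"
proof -
  have Ul: "U \<in> sets lebesgue" using U by (simp add: sets_completionI_sets)
  have box0: "set_lebesgue_integral lebesgue (box a b) f = 0" if ab: "cbox a b \<subseteq> U" for a b
  proof -
    let ?F = "\<lambda>x. indicator (cbox a b) x *\<^sub>R f x"
    have F: "integrable lebesgue ?F" using locally_integrable_indicator[OF f _ ab] by simp
    have mF: "?F \<in> borel_measurable lebesgue" using F by auto
    have mb: "box_bump a b n \<in> borel_measurable lebesgue" for n
      using borel_measurable_continuous_onI[OF smooth_continuous[OF box_bump_smooth]]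
      by (intro measurable_completion) simp
    have "(\<lambda>n. LINT x|lebesgue. ?F x * box_bump a b n x) \<longlonglongrightarrow> (LINT x|lebesgue. ?F x * indicator (box a b) x)"
    proof (rule integral_dominated_convergence[where w="\<lambda>x. norm (?F x)"])
      show "(\<lambda>x. ?F x * box_bump a b n x) \<in> borel_measurable lebesgue" for n
        using mF mb by (rule borel_measurable_times)
      show "(\<lambda>x. ?F x * indicator (box a b) x) \<in> borel_measurable lebesgue"
        using mF by (intro borel_measurable_times borel_measurable_indicator) (auto simp: sets_completionI_sets)
      show "integrable lebesgue (\<lambda>x. norm (?F x))" using F by (rule integrable_norm)
      show "AE x in lebesgue. (\<lambda>n. ?F x * box_bump a b n x) \<longlonglongrightarrow> ?F x * indicator (box a b) x"
        by (intro AE_I2 tendsto_mult tendsto_const box_bump_tendsto)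
      show "AE x in lebesgue. norm (?F x * box_bump a b n x) \<le> norm (?F x)" for n
        unfolding norm_mult using box_bump_bounds[of a b n]
        by (intro AE_I2 mult_left_le) auto
    qed
    moreover have "(LINT x|lebesgue. ?F x * box_bump a b n x) = 0" for n
    proof -
      have "(LINT x|lebesgue. ?F x * box_bump a b n x) = (LINT x|lebesgue. indicator U x *\<^sub>R (f x * box_bump a b n x))"
        using ab box_subset_cbox[of a b] box_bump_zero[of _ a b n]
        by (intro Bochner_Integration.integral_cong) (auto simp: indicator_def)
      also have "\<dots> = 0"
        using 0[OF box_bump_test[OF ab]] Ul by (simp add: integral_restrict_space)
      finally show ?thesis .
    qed
    ultimately have "(LINT x|lebesgue. ?F x * indicator (box a b) x) = 0"
      by (simp add: LIMSEQ_const_iff)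
    also have "(LINT x|lebesgue. ?F x * indicator (box a b) x) = set_lebesgue_integral lebesgue (box a b) f"
      unfolding set_lebesgue_integral_def using box_subset_cbox[of a b]
      by (intro Bochner_Integration.integral_cong) (auto simp: indicator_def)
    finally show ?thesis .
  qed
  have AEbox: "AE x in lebesgue. x \<in> cbox a b \<longrightarrow> f x = 0" if ab: "cbox a b \<subseteq> U" for a b
  proof -
    let ?F = "\<lambda>x. indicator (box a b) x *\<^sub>R f x"
    have "integrable lebesgue (\<lambda>x. indicator (box a b) x *\<^sub>R (indicator (cbox a b) x *\<^sub>R f x))"
      by (rule integrable_mult_indicator[OF _ locally_integrable_indicator[OF f compact_cbox ab]])
        (simp add: sets_completionI_sets)
    also have "(\<lambda>x. indicator (box a b) x *\<^sub>R (indicator (cbox a b) x *\<^sub>R f x)) = ?F"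
      using box_subset_cbox[of a b] by (auto simp: indicator_def fun_eq_iff)
    finally have F: "integrable lebesgue ?F" .
    have "AE x in lebesgue. ?F x = 0"
    proof (rule AE_zero_if_box_integrals_zero[OF F])
      show "integral\<^sup>L lebesgue ?F = 0"
        using box0[OF ab] by (simp add: set_lebesgue_integral_def)
      fix c d
      define c' d' where "c' = (\<Sum>i\<in>Basis. max (c\<bullet>i) (a\<bullet>i) *\<^sub>R i)" and "d' = (\<Sum>i\<in>Basis. min (d\<bullet>i) (b\<bullet>i) *\<^sub>R i)"
      have "cbox c' d' = cbox c d \<inter> cbox a b" and b': "box c' d' = box c d \<inter> box a b"
        unfolding c'_def d'_def by (simp_all add: Int_interval box_Int_box)
      then have "cbox c' d' \<subseteq> U" using ab by auto
      from box0[OF this] show "set_lebesgue_integral lebesgue (box c d) ?F = 0"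
        by (simp add: set_lebesgue_integral_def b' indicator_inter_arith mult.assoc)
    qed
    moreover have "AE x in lebesgue. x \<notin> cbox a b - box a b"
      using negligible_frontier_interval[of a b] by (intro AE_not_in) (simp add: negligible_iff_null_sets)
    ultimately show ?thesis
      by eventually_elim (auto simp: indicator_def split: if_splits)
  qed
  obtain D where D: "countable D" "D \<subseteq> Pow U" "\<And>X. X \<in> D \<Longrightarrow> \<exists>a b. X = cbox a b" "\<Union>D = U"
    using open_countable_Union_open_cbox[OF U] by blast
  have "AE x in lebesgue. \<forall>X\<in>D. x \<in> X \<longrightarrow> f x = 0"
    unfolding AE_ball_countable[OF D(1)]
  proof
    fix X assume "X \<in> D"
    then obtain a b where X: "X = cbox a b" using D(3) by blast
    then have "cbox a b \<subseteq> U" using D(2) \<open>X \<in> D\<close> by auto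
    from AEbox[OF this] show "AE x in lebesgue. x \<in> X \<longrightarrow> f x = 0" unfolding X .
  qed
  then have "AE x in lebesgue. x \<in> U \<longrightarrow> f x = 0"
    by eventually_elim (use D(4) in auto)
  then show ?thesis using Ul by (simp add: AE_restrict_space_iff)
qed

lemma locally_integrable_mult_test:
  fixes f :: "'a::euclidean_space \<Rightarrow> real"
  assumes f: "locally_integrable U f" and U: "U \<in> sets lebesgue"
    and h: "continuous_on UNIV h" "compact K" "K \<subseteq> U" "\<And>x. x \<notin> K \<Longrightarrow> h x = 0"
  shows "integrable (lebesgue_on U) (\<lambda>x. f x * h x)"
proof -
  have F: "integrable lebesgue (\<lambda>x. indicator K x *\<^sub>R f x)" by (rule locally_integrable_indicator[OF f h(2,3)])
  have "bounded (h ` K)"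
    using h(1,2) by (intro compact_imp_bounded compact_continuous_image) (auto intro: continuous_on_subset)
  then obtain B where B: "B > 0" "\<And>x. x \<in> K \<Longrightarrow> norm (h x) \<le> B" by (auto simp: bounded_pos)
  have B': "norm (h x) \<le> B" for x using B h(4)[of x] by (cases "x \<in> K") auto
  have "integrable lebesgue (\<lambda>x. (indicator K x *\<^sub>R f x) * h x)"
  proof (rule Bochner_Integration.integrable_bound)
    show "integrable lebesgue (\<lambda>x. (indicator K x *\<^sub>R f x) * B)" using F by (rule integrable_mult_left)
    have "h \<in> borel_measurable lebesgue"
      using borel_measurable_continuous_onI[OF h(1)] by (intro measurable_completion) simp
    then show "(\<lambda>x. (indicator K x *\<^sub>R f x) * h x) \<in> borel_measurable lebesgue"
      using borel_measurable_integrable[OF F] by (intro borel_measurable_times)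
    show "AE x in lebesgue. norm ((indicator K x *\<^sub>R f x) * h x) \<le> norm ((indicator K x *\<^sub>R f x) * B)"
    proof (rule AE_I2)
      fix x
      show "norm ((indicator K x *\<^sub>R f x) * h x) \<le> norm ((indicator K x *\<^sub>R f x) * B)"
        unfolding norm_mult using B(1) by (intro mult_left_mono order_trans[OF B']) auto
    qed
  qed
  also have "(\<lambda>x. (indicator K x *\<^sub>R f x) * h x) = (\<lambda>x. indicator U x *\<^sub>R (f x * h x))"
    using h by (auto simp: indicator_def fun_eq_iff)
  finally show ?thesis using U by (simp add: integrable_restrict_space)
qed

lemma locally_integrable_inner:
  "locally_integrable U g \<Longrightarrow> locally_integrable U (\<lambda>x. g x \<bullet> i)"
  and locally_integrable_diff:
  "locally_integrable U g \<Longrightarrow> locally_integrable U h \<Longrightarrow> locally_integrable U (\<lambda>x. g x - h x)"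
  by (simp_all add: locally_integrable_def)

lemma weak_gradient_integrable:
  assumes "has_weak_gradient U u g" "\<phi> \<in> test_functions U" "U \<in> sets lebesgue"
  shows "integrable (lebesgue_on U) (\<lambda>x. u x * (grad \<phi> x \<bullet> i))"
    and "integrable (lebesgue_on U) (\<lambda>x. (g x \<bullet> i) * \<phi> x)"
proof -
  obtain K where K: "compact K" "K \<subseteq> U" "\<And>x. x \<notin> K \<Longrightarrow> \<phi> x = 0" "\<And>x. x \<notin> K \<Longrightarrow> grad \<phi> x = 0"
    using test_support[OF assms(2)] by metis
  note sm = test_smooth[OF assms(2)]
  have "locally_integrable U u" "locally_integrable U (\<lambda>x. g x \<bullet> i)"
    using assms(1) locally_integrable_inner by (auto simp: has_weak_gradient_def)
  then show "integrable (lebesgue_on U) (\<lambda>x. u x * (grad \<phi> x \<bullet> i))"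
    and "integrable (lebesgue_on U) (\<lambda>x. (g x \<bullet> i) * \<phi> x)"
    using K by (auto intro!: locally_integrable_mult_test[OF _ assms(3) _ K(1,2)]
        continuous_on_inner continuous_on_const smooth_continuous[OF sm] grad_continuous[OF sm])
qed

lemma weak_gradient_diff:
  assumes u: "has_weak_gradient U u g" and v: "has_weak_gradient U v h" and U: "U \<in> sets lebesgue"
  shows "has_weak_gradient U (\<lambda>x. u x - v x) (\<lambda>x. g x - h x)"
  unfolding has_weak_gradient_def
proof (intro conjI ballI)
  show "locally_integrable U (\<lambda>x. u x - v x)" "locally_integrable U (\<lambda>x. g x - h x)"
    using u v by (simp_all add: has_weak_gradient_def locally_integrable_diff)
  fix \<phi> i assume \<phi>: "\<phi> \<in> test_functions U" and i: "i \<in> (Basis :: 'a set)"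
  show "(LINT x|lebesgue_on U. (u x - v x) * frechet_derivative \<phi> (at x) i) =
      - (LINT x|lebesgue_on U. ((g x - h x) \<bullet> i) * \<phi> x)"
    using u v \<phi> i weak_gradient_integrable[OF u \<phi> U, of i] weak_gradient_integrable[OF v \<phi> U, of i]
    by (simp add: has_weak_gradient_def grad_inner_Basis left_diff_distrib inner_diff_left)
qed

lemma weak_gradient_unique:
  fixes U :: "'a::euclidean_space set"
  assumes U: "open U" and u: "has_weak_gradient U u g" "has_weak_gradient U u h"
  shows "AE x in lebesgue_on U. g x = h x"
proof -
  have Ul: "U \<in> sets lebesgue" using U by (simp add: sets_completionI_sets)
  have "AE x in lebesgue_on U. (g x - h x) \<bullet> i = 0" if i: "i \<in> Basis" for i
  proof (rule fundamental_lemma_calculus_of_variations[OF U])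
    show "locally_integrable U (\<lambda>x. (g x - h x) \<bullet> i)"
      using u by (intro locally_integrable_inner locally_integrable_diff) (auto simp: has_weak_gradient_def)
    fix \<phi> assume \<phi>: "\<phi> \<in> test_functions U"
    have "(LINT x|lebesgue_on U. (g x \<bullet> i) * \<phi> x) = (LINT x|lebesgue_on U. (h x \<bullet> i) * \<phi> x)"
      using u \<phi> i unfolding has_weak_gradient_def by fastforce
    then show "(LINT x|lebesgue_on U. ((g x - h x) \<bullet> i) * \<phi> x) = 0"
      using weak_gradient_integrable[OF u(1) \<phi> Ul, of i] weak_gradient_integrable[OF u(2) \<phi> Ul, of i]
      by (simp add: left_diff_distrib inner_diff_left)
  qed
  then have "AE x in lebesgue_on U. \<forall>i\<in>Basis. (g x - h x) \<bullet> i = 0"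
    by (simp add: AE_finite_all)
  then show ?thesis
    by eventually_elim (simp add: euclidean_eq_iff[of "g _"] inner_diff_left)
qed

text \<open>
  Under an integral, the representative chosen by \<open>weak_gradient\<close> may be replaced by any known weak gradient.
\<close>

lemma weak_gradient_AE:
  assumes "open U" "has_weak_gradient U u g"
  shows "AE x in lebesgue_on U. weak_gradient U u x = g x"
proof (rule weak_gradient_unique[OF assms(1) _ assms(2)])
  show "has_weak_gradient U u (weak_gradient U u)"
    unfolding weak_gradient_def by (rule someI[of "has_weak_gradient U u", OF assms(2)])
qed

section \<open>Morrey's inequality with an asymptotically sharp constant\<close>

lemma young_one:
  fixes a p :: real
  assumes "p > 1" "a \<ge> 0"
  shows "a \<le> a powr p / p + (1 - 1 / p)"
proof -
  define q where "q = p / (p - 1)"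
  have q: "q > 1" "1 / p + 1 / q = 1" using assms by (auto simp: q_def field_simps)
  then show ?thesis using Youngs_inequality[of p q a 1] assms by simp
qed

text \<open>
  Integrate Young's inequality for \<open>f / s\<close> and take for \<open>s\<close> the \<open>L\<^sup>p\<close> norm of \<open>f\<close>. The cube has measure
  1, so there is no constant; a constant factor here would survive the limit \<open>p \<rightarrow> \<infinity>\<close>.
\<close>

lemma Jensen_powr_unit_cube:
  fixes f :: "'a::euclidean_space \<Rightarrow> real"
  assumes p: "p > 1" and f: "continuous_on (cbox 0 One) f" "\<And>x. x \<in> cbox 0 One \<Longrightarrow> 0 \<le> f x"
  shows "integral (cbox 0 One) f \<le> integral (cbox 0 One) (\<lambda>x. f x powr p) powr (1 / p)"
proof -
  let ?I = "integral (cbox 0 One) (\<lambda>x. f x powr p)"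
  let ?J = "integral (cbox 0 One) f"
  have fp: "continuous_on (cbox 0 One) (\<lambda>x. f x powr p)"
    using f p by (intro continuous_on_powr') auto
  have I0: "0 \<le> ?I" by (rule integral_nonneg[OF integrable_continuous[OF fp]]) simp
  \<comment> \<open>Young's inequality for \<open>f x / s\<close>, integrated; \<open>s\<close> is chosen at the end.\<close>
  have key: "?J \<le> s * (?I / s powr p / p + (1 - 1 / p))" if s: "s > 0" for s
  proof -
    have "?J \<le> integral (cbox 0 One) (\<lambda>x. s / s powr p / p * f x powr p + s * (1 - 1 / p))"
    proof (rule integral_le)
      show "f integrable_on cbox 0 One" by (rule integrable_continuous[OF f(1)])
      show "(\<lambda>x. s / s powr p / p * f x powr p + s * (1 - 1 / p)) integrable_on cbox 0 One"
        by (intro integrable_continuous continuous_on_add continuous_on_mult continuous_on_const fp)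
      fix x :: 'a assume x: "x \<in> cbox 0 One"
      have "f x / s \<le> (f x / s) powr p / p + (1 - 1 / p)"
        using young_one[OF p, of "f x / s"] f(2)[OF x] s by simp
      then have "s * (f x / s) \<le> s * ((f x / s) powr p / p + (1 - 1 / p))"
        using s by (intro mult_left_mono) auto
      then show "f x \<le> s / s powr p / p * f x powr p + s * (1 - 1 / p)"
        using s f(2)[OF x] by (simp add: powr_divide algebra_simps)
    qed
    also have "\<dots> = s / s powr p / p * ?I + s * (1 - 1 / p)"
    proof -
      have "((\<lambda>x. s / s powr p / p * f x powr p + s * (1 - 1 / p)) has_integral
          s / s powr p / p * ?I + measure lborel (cbox 0 (One::'a)) *\<^sub>R (s * (1 - 1 / p))) (cbox 0 One)"
        by (intro has_integral_add has_integral_mult_right has_integral_const integrable_integral integrable_continuous fp)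
      then show ?thesis by (simp add: integral_unique)
    qed
    finally show ?thesis using s by (simp add: algebra_simps)
  qed
  show ?thesis
  proof (cases "?I = 0")
    case True
    have "?J \<le> 0"
    proof (rule field_le_epsilon)
      fix e :: real assume e: "e > 0"
      have "?J \<le> e * (1 - 1 / p)" using key[OF e] True by simp
      also have "\<dots> \<le> e * 1" using e p by (intro mult_left_mono) auto
      finally show "?J \<le> 0 + e" by simp
    qed
    then show ?thesis using True by simp
  next
    case False
    let ?s = "?I powr (1 / p)"
    have "?s > 0" "?s powr p = ?I" using False I0 p by (auto simp: powr_powr)
    with key[of ?s] False show ?thesis by (simp add: algebra_simps)
  qed
qed

lemma integral_scaled_cube_le:
  fixes F :: "'a::euclidean_space \<Rightarrow> real"
  assumes "continuous_on UNIV F" "integrable lborel F" "\<And>x. 0 \<le> F x" "c > 0"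
  shows "integral (cbox 0 One) (\<lambda>h. F (a + c *\<^sub>R h)) \<le> integral\<^sup>L lborel F / c ^ DIM('a)"
proof -
  let ?g = "\<lambda>h. F (a + c *\<^sub>R h)"
  have mF: "F \<in> borel_measurable borel" using assms(1) by (rule borel_measurable_continuous_onI)
  have cont: "continuous_on (cbox 0 One) ?g"
    by (rule continuous_on_compose2[OF assms(1)]) (auto intro!: continuous_intros)
  have dens: "lborel = density (distr lborel borel (\<lambda>x. a + c *\<^sub>R x)) (\<lambda>_. ennreal (c ^ DIM('a)))"
    using lborel_affine[of c a] assms(4) by (simp add: ennreal_power)
  have mg: "?g \<in> borel_measurable borel" using mF by measurable
  have ig: "integrable lborel ?g"
  proof -
    have "integrable (density (distr lborel borel (\<lambda>x. a + c *\<^sub>R x)) (\<lambda>_. ennreal (c ^ DIM('a)))) F"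
      using assms(2) dens by simp
    then have "integrable (distr lborel borel (\<lambda>x. a + c *\<^sub>R x)) (\<lambda>x. c ^ DIM('a) *\<^sub>R F x)"
      using assms(4) mF by (subst (asm) integrable_density) auto
    then have "integrable lborel (\<lambda>x. c ^ DIM('a) *\<^sub>R F (a + c *\<^sub>R x))"
      using mF by (subst (asm) integrable_distr_eq) auto
    then show ?thesis using assms(4) by simp
  qed
  have "integral\<^sup>L lborel F = integral\<^sup>L (density (distr lborel borel (\<lambda>x. a + c *\<^sub>R x)) (\<lambda>_. ennreal (c ^ DIM('a)))) F"
    using dens by simp
  also have "\<dots> = integral\<^sup>L (distr lborel borel (\<lambda>x. a + c *\<^sub>R x)) (\<lambda>x. c ^ DIM('a) *\<^sub>R F x)"
    using assms(4) mF by (subst integral_density) auto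
  also have "\<dots> = (LINT x|lborel. c ^ DIM('a) *\<^sub>R ?g x)"
    using mF by (subst integral_distr) auto
  finally have eq: "integral\<^sup>L lborel F = c ^ DIM('a) * integral\<^sup>L lborel ?g" by simp
  have si: "set_integrable lborel (cbox 0 One) ?g"
    unfolding set_integrable_def by (intro borel_integrable_compact cont compact_cbox)
  have "integral (cbox 0 One) ?g = (LINT x|lborel. indicator (cbox 0 One) x *\<^sub>R ?g x)"
    using set_borel_integral_eq_integral(2)[OF si] by (simp add: set_lebesgue_integral_def)
  also have "\<dots> \<le> integral\<^sup>L lborel ?g"
    using si ig assms(3) by (intro integral_mono) (auto simp: set_integrable_def indicator_def)
  also have "\<dots> = integral\<^sup>L lborel F / c ^ DIM('a)"
    using eq assms(4) by (simp add: field_simps)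
  finally show ?thesis .
qed

lemma unit_cube_norm_le:
  fixes h :: "'a::euclidean_space"
  assumes "h \<in> cbox 0 One" shows "norm h \<le> real DIM('a)"
proof -
  have "norm h \<le> (\<Sum>b\<in>Basis. \<bar>h \<bullet> b\<bar>)" by (rule norm_le_l1)
  also have "\<dots> \<le> (\<Sum>b\<in>(Basis :: 'a set). 1)"
    using assms by (intro sum_mono) (auto simp: mem_box)
  finally show ?thesis by simp
qed

lemma test_grad_powr:
  assumes "\<phi> \<in> test_functions U" "p > 0"
  shows "continuous_on UNIV (\<lambda>x. norm (grad \<phi> x) powr p)" "integrable lborel (\<lambda>x. norm (grad \<phi> x) powr p)"
proof -
  show c: "continuous_on UNIV (\<lambda>x. norm (grad \<phi> x) powr p)"
    using assms by (intro continuous_on_powr' continuous_on_norm grad_continuous test_smooth continuous_on_const) auto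
  obtain K where "compact K" "\<And>x. x \<notin> K \<Longrightarrow> grad \<phi> x = 0"
    using test_support[OF assms(1)] by metis
  then show "integrable lborel (\<lambda>x. norm (grad \<phi> x) powr p)"
    by (intro integrable_compact_support[OF c]) auto
qed

text \<open>
  For fixed \<open>p > n\<close> this grows more slowly than \<open>1 / \<rho>\<close> as \<open>\<rho>\<close> tends to 0, which gives equicontinuity;
  for fixed \<open>\<rho>\<close> it tends to 1 as \<open>p\<close> tends to infinity, which gives the sharp bound in the limit.
\<close>

definition morrey_const :: "real \<Rightarrow> real \<Rightarrow> real \<Rightarrow> real" where
  "morrey_const n p \<rho> = \<rho> powr (- n / p) / (1 - n / p)"

text \<open>
  Contract the cube with corner \<open>y\<close> and side \<open>\<rho>\<close> towards \<open>x\<close> and let \<open>G t\<close> be the average of \<open>\<phi>\<close> over the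
  copy contracted by \<open>t\<close>; then \<open>G 0 = \<phi> x\<close>. Its derivative is an average of directional derivatives
  along the rays from \<open>x\<close>. Jensen's inequality on the contracted cube, whose volume is \<open>(t * \<rho>) ^ n\<close>,
  bounds it by a multiple of \<open>t powr (- n / p)\<close>, which is integrable near 0 because \<open>p > n\<close>.
\<close>

lemma average_deviation_le:
  fixes \<phi> :: "'a::euclidean_space \<Rightarrow> real" and x y :: 'a
  defines "n \<equiv> real DIM('a)"
  assumes \<phi>: "\<phi> \<in> test_functions U" and p: "p > n" and \<rho>: "\<rho> > 0"
  shows "\<bar>integral (cbox 0 One) (\<lambda>h. \<phi> (y + \<rho> *\<^sub>R h)) - \<phi> x\<bar>
    \<le> (norm (y - x) + \<rho> * n) * morrey_const n p \<rho> * (LINT x|lborel. norm (grad \<phi> x) powr p) powr (1 / p)"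
proof -
  have n1: "n \<ge> 1" unfolding n_def using DIM_positive[where 'a='a] by linarith
  with p have p1: "p > 1" by simp
  have sm: "smooth \<phi>" using \<phi> by (rule test_smooth)
  define w where "w = y - x"
  define d where "d = norm w + \<rho> * n"
  define N where "N = (LINT x|lborel. norm (grad \<phi> x) powr p)"
  define v where "v h = w + \<rho> *\<^sub>R h" for h
  define G where "G t = integral (cbox 0 One) (\<lambda>h. \<phi> (x + t *\<^sub>R v h))" for t
  define G' where "G' t = integral (cbox 0 One) (\<lambda>h. grad \<phi> (x + t *\<^sub>R v h) \<bullet> v h)" for t
  define K where "K = d * \<rho> powr (- n / p) * N powr (1 / p)"
  define H where "H t = K * (t powr (1 - n / p) / (1 - n / p))" for t
  have np: "0 < 1 - n / p" using p n1 p1 by (simp add: field_simps)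
  have v: "norm (v h) \<le> d" if "h \<in> cbox 0 One" for h
  proof -
    have "norm (v h) \<le> norm w + norm (\<rho> *\<^sub>R h)" unfolding v_def by (rule norm_triangle_ineq)
    also have "norm (\<rho> *\<^sub>R h) \<le> \<rho> * n"
      using unit_cube_norm_le[OF that] \<rho> by (simp add: n_def)
    finally show ?thesis by (simp add: d_def)
  qed
  have d0: "d > 0" unfolding d_def using \<rho> n1 by (intro add_nonneg_pos mult_pos_pos) auto
  have N0: "N \<ge> 0" unfolding N_def by simp
  have gc: "continuous_on S (\<lambda>z. grad \<phi> (f z))" if "continuous_on S f" for f :: "'z::topological_space \<Rightarrow> 'a" and S
    by (rule continuous_on_compose2[OF grad_continuous[OF sm, of UNIV] that]) simp
  have pc: "continuous_on S (\<lambda>z. \<phi> (f z))" if "continuous_on S f" for f :: "'z::topological_space \<Rightarrow> 'a" and S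
    by (rule continuous_on_compose2[OF smooth_continuous[OF sm, of UNIV] that]) simp
  have G_deriv: "(G has_vector_derivative G' t) (at t)" for t
  proof -
    have "(G has_field_derivative G' t) (at t within UNIV)"
      unfolding G_def G'_def
    proof (rule leibniz_rule_field_derivative)
      show "((\<lambda>t. \<phi> (x + t *\<^sub>R v h)) has_field_derivative (grad \<phi> (x + t *\<^sub>R v h) \<bullet> v h)) (at t within UNIV)" for t h
      proof -
        have "((\<lambda>t. x + t *\<^sub>R v h) has_derivative (\<lambda>t. t *\<^sub>R v h)) (at t)"
          by (auto intro!: derivative_eq_intros)
        from has_derivative_compose[OF this smooth_has_derivative[OF sm]]
        show ?thesis
          unfolding has_field_derivative_def by (rule has_derivative_eq_rhs) (simp add: fun_eq_iff mult.commute)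
      qed
      show "(\<lambda>h. \<phi> (x + t *\<^sub>R v h)) integrable_on cbox 0 One" for t
        unfolding v_def by (intro integrable_continuous pc continuous_intros)
      show "continuous_on (UNIV \<times> cbox 0 One) (\<lambda>(t, h). grad \<phi> (x + t *\<^sub>R v h) \<bullet> v h)"
        unfolding v_def split_beta by (intro continuous_on_inner gc continuous_intros)
    qed auto
    then show ?thesis by (simp add: has_real_derivative_iff_has_vector_derivative)
  qed
  have G'_le: "norm (G' t) \<le> K * t powr (- n / p)" if t: "t > 0" for t
  proof -
    have cg: "continuous_on (cbox 0 One) (\<lambda>h. norm (grad \<phi> (x + t *\<^sub>R v h)))"
      unfolding v_def by (intro continuous_on_norm gc continuous_intros)
    have "norm (G' t) \<le> integral (cbox 0 One) (\<lambda>h. d * norm (grad \<phi> (x + t *\<^sub>R v h)))"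
      unfolding G'_def
    proof (rule Henstock_Kurzweil_Integration.integral_norm_bound_integral)
      show "(\<lambda>h. grad \<phi> (x + t *\<^sub>R v h) \<bullet> v h) integrable_on cbox 0 One"
        unfolding v_def by (intro integrable_continuous continuous_on_inner gc continuous_intros)
      show "(\<lambda>h. d * norm (grad \<phi> (x + t *\<^sub>R v h))) integrable_on cbox 0 One"
        by (intro integrable_continuous continuous_on_mult continuous_on_const cg)
      fix h :: 'a assume h: "h \<in> cbox 0 One"
      have "norm (grad \<phi> (x + t *\<^sub>R v h) \<bullet> v h) \<le> norm (grad \<phi> (x + t *\<^sub>R v h)) * norm (v h)"
        by (simp add: Cauchy_Schwarz_ineq2)
      also have "\<dots> \<le> norm (grad \<phi> (x + t *\<^sub>R v h)) * d"
        using v[OF h] by (rule mult_left_mono) simp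
      finally show "norm (grad \<phi> (x + t *\<^sub>R v h) \<bullet> v h) \<le> d * norm (grad \<phi> (x + t *\<^sub>R v h))"
        by (simp add: mult.commute)
    qed
    also have "\<dots> = d * integral (cbox 0 One) (\<lambda>h. norm (grad \<phi> (x + t *\<^sub>R v h)))"
      by simp
    also have "\<dots> \<le> d * (integral (cbox 0 One) (\<lambda>h. norm (grad \<phi> (x + t *\<^sub>R v h)) powr p) powr (1 / p))"
      using d0 by (intro mult_left_mono Jensen_powr_unit_cube p1 cg) auto
    also have "\<dots> \<le> d * (N / (t * \<rho>) ^ DIM('a)) powr (1 / p)"
    proof -
      have "integral (cbox 0 One) (\<lambda>h. norm (grad \<phi> (x + t *\<^sub>R v h)) powr p) \<ge> 0"
        unfolding v_def using p1
        by (intro integral_nonneg integrable_continuous continuous_on_powr' continuous_on_norm gc continuous_intros) auto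
      moreover
      have "x + t *\<^sub>R v h = (x + t *\<^sub>R w) + (t * \<rho>) *\<^sub>R h" for h
        by (simp add: v_def algebra_simps)
      then have "integral (cbox 0 One) (\<lambda>h. norm (grad \<phi> (x + t *\<^sub>R v h)) powr p) \<le> N / (t * \<rho>) ^ DIM('a)"
        using integral_scaled_cube_le[OF test_grad_powr[OF \<phi>], of p "t * \<rho>" "x + t *\<^sub>R w"] p1 t \<rho>
        by (simp add: N_def add.assoc)
      ultimately show ?thesis
        using d0 p1 by (intro mult_left_mono powr_mono2) auto
    qed
    also have "d * (N / (t * \<rho>) ^ DIM('a)) powr (1 / p) = K * t powr (- n / p)"
    proof -
      have "(N / (t * \<rho>) ^ DIM('a)) powr (1 / p) = N powr (1 / p) / ((t * \<rho>) powr n) powr (1 / p)"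
        using t \<rho> N0 by (subst powr_divide) (auto simp: n_def powr_realpow)
      also have "((t * \<rho>) powr n) powr (1 / p) = t powr (n / p) * \<rho> powr (n / p)"
        using t \<rho> by (simp add: powr_powr powr_mult)
      finally show ?thesis
        unfolding K_def by (simp add: powr_minus divide_inverse)
    qed
    finally show ?thesis .
  qed
  \<comment> \<open>\<open>H\<close> is the antiderivative of the bound for \<open>G'\<close> that vanishes at 0.\<close>
  have "norm (G 1 - G 0) \<le> H 1 - H 0"
  proof (rule differentiable_bound_general)
    show "continuous_on {0..1} G"
      by (intro continuous_at_imp_continuous_on ballI has_vector_derivative_continuous[OF G_deriv])
    show "continuous_on {0..1} H"
      unfolding H_def using np
      by (intro continuous_on_mult continuous_on_divide continuous_on_powr' continuous_on_const continuous_on_id) auto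
    fix t :: real assume t: "0 < t" "t < 1"
    show "(G has_vector_derivative G' t) (at t)" by (rule G_deriv)
    have "(H has_real_derivative K * (((1 - n / p) * t powr (1 - n / p - 1)) / (1 - n / p))) (at t)"
      unfolding H_def by (intro DERIV_cmult DERIV_cdivide has_real_derivative_powr t)
    then show "(H has_vector_derivative K * t powr (- n / p)) (at t)"
      using np p by (simp add: has_real_derivative_iff_has_vector_derivative)
    show "norm (G' t) \<le> K * t powr (- n / p)" using t by (intro G'_le)
  qed simp
  moreover have "G 0 = \<phi> x" by (simp add: G_def)
  moreover have "G 1 = integral (cbox 0 One) (\<lambda>h. \<phi> (y + \<rho> *\<^sub>R h))"
    by (simp add: G_def v_def w_def algebra_simps)
  moreover have "H 1 - H 0 = d * morrey_const n p \<rho> * N powr (1 / p)"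
    by (simp add: H_def K_def morrey_const_def)
  ultimately show ?thesis by (simp add: d_def w_def N_def)
qed

text \<open>
  Both values are compared with the average over the same small cube at \<open>z\<close>. Compared with \<open>\<bar>x - z\<bar>\<close>, only
  the size of the cube is lost, which is what makes the estimate sharp for large \<open>p\<close> and small \<open>\<rho>\<close>.
\<close>

lemma test_morrey:
  fixes \<phi> :: "'a::euclidean_space \<Rightarrow> real" and x z :: 'a
  defines "n \<equiv> real DIM('a)"
  assumes \<phi>: "\<phi> \<in> test_functions U" and p: "p > n" and \<rho>: "\<rho> > 0"
  shows "\<bar>\<phi> x - \<phi> z\<bar> \<le> (norm (x - z) + 2 * \<rho> * n) * morrey_const n p \<rho> *
     (LINT x|lborel. norm (grad \<phi> x) powr p) powr (1 / p)" (is "_ \<le> ?d * ?M * ?N")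
proof -
  let ?A = "integral (cbox 0 One) (\<lambda>h. \<phi> (z + \<rho> *\<^sub>R h))"
  have "\<bar>?A - \<phi> x\<bar> \<le> (norm (z - x) + \<rho> * n) * ?M * ?N"
    using average_deviation_le[OF \<phi>, of p \<rho> z x] p \<rho> unfolding n_def by simp
  moreover have "\<bar>?A - \<phi> z\<bar> \<le> (norm (z - z) + \<rho> * n) * ?M * ?N"
    using average_deviation_le[OF \<phi>, of p \<rho> z z] p \<rho> unfolding n_def by simp
  ultimately have "\<bar>\<phi> x - \<phi> z\<bar> \<le> (norm (z - x) + \<rho> * n) * ?M * ?N + (norm (z - z) + \<rho> * n) * ?M * ?N"
    by linarith
  also have "\<dots> = ?d * ?M * ?N"
    by (simp add: algebra_simps norm_minus_commute)
  finally show ?thesis .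
qed

section \<open>The spaces of p-integrable functions\<close>

lemma powr_add_le:
  fixes a b p :: real
  assumes "a \<ge> 0" "b \<ge> 0" "p \<ge> 0"
  shows "(a + b) powr p \<le> 2 powr p * (a powr p + b powr p)"
proof -
  have "(a + b) powr p \<le> (2 * max a b) powr p" using assms by (intro powr_mono2) auto
  also have "\<dots> = 2 powr p * max a b powr p" using assms by (simp add: powr_mult)
  also have "\<dots> \<le> 2 powr p * (a powr p + b powr p)" by (intro mult_left_mono) (auto simp: max_def)
  finally show ?thesis .
qed

text \<open>
  By homogeneity it suffices to take \<open>b = 1\<close>: near \<open>a = 1\<close> continuity gives \<open>\<epsilon>\<close>, and away from 1 the
  power of \<open>a - 1\<close> dominates everything.
\<close>

lemma powr_perturbation:
  fixes p \<epsilon> :: real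
  assumes p: "p > 0" and \<epsilon>: "\<epsilon> > 0"
  obtains K where "K > 0"
    "\<And>a b. 0 \<le> a \<Longrightarrow> 0 \<le> b \<Longrightarrow> \<bar>a powr p - b powr p\<bar> \<le> \<epsilon> * b powr p + K * \<bar>a - b\<bar> powr p"
proof -
  have "((\<lambda>t::real. t powr p) \<longlongrightarrow> 1 powr p) (at 1)"
    by (intro tendsto_powr tendsto_const tendsto_ident_at) simp
  from LIM_D[OF this \<epsilon>]
  obtain \<delta> where \<delta>: "\<delta> > 0" "\<And>t::real. t \<noteq> 1 \<Longrightarrow> \<bar>t - 1\<bar> < \<delta> \<Longrightarrow> \<bar>t powr p - 1\<bar> < \<epsilon>"
    by auto
  \<comment> \<open>If \<open>\<delta> \<le> \<bar>t - 1\<bar>\<close>, then \<open>max t 1\<close> is at most \<open>1 + 1 / \<delta>\<close> times \<open>\<bar>t - 1\<bar>\<close>.\<close>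
  define K where "K = (1 + 1 / \<delta>) powr p"
  have K1: "K \<ge> 1" unfolding K_def using \<delta>(1) p by (intro ge_one_powr_ge_zero) auto
  have unit: "\<bar>t powr p - 1\<bar> \<le> \<epsilon> + K * \<bar>t - 1\<bar> powr p" if t: "t \<ge> 0" for t
  proof (cases "\<bar>t - 1\<bar> < \<delta>")
    case True
    then have "\<bar>t powr p - 1\<bar> \<le> \<epsilon>" using \<delta>(2)[of t] \<epsilon> by (cases "t = 1") auto
    then show ?thesis using K1 by (smt (verit) mult_nonneg_nonneg powr_ge_zero)
  next
    case False
    then have d: "1 \<le> \<bar>t - 1\<bar> / \<delta>" using \<delta>(1) by simp
    have "\<bar>t powr p - 1\<bar> \<le> max t 1 powr p"
    proof (cases "t \<ge> 1")
      case True
      then have "t powr p \<ge> 1" using p by (intro ge_one_powr_ge_zero) auto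
      then show ?thesis using True by (simp add: max_def)
    next
      case False
      then have "t powr p \<le> 1" using powr_mono2[of p t 1] t p by simp
      then show ?thesis using False by (simp add: max_def)
    qed
    also have "max t 1 \<le> (1 + 1 / \<delta>) * \<bar>t - 1\<bar>"
      using d by (auto simp: algebra_simps)
    then have "max t 1 powr p \<le> ((1 + 1 / \<delta>) * \<bar>t - 1\<bar>) powr p"
      using t p by (intro powr_mono2) auto
    also have "\<dots> = K * \<bar>t - 1\<bar> powr p"
      using \<delta>(1) unfolding K_def by (simp add: powr_mult)
    finally show ?thesis using \<epsilon> by linarith
  qed
  show ?thesis
  proof (rule that)
    show "K > 0" using K1 by simp
    fix a b :: real assume ab: "0 \<le> a" "0 \<le> b"
    show "\<bar>a powr p - b powr p\<bar> \<le> \<epsilon> * b powr p + K * \<bar>a - b\<bar> powr p"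
    proof (cases "b = 0")
      case True
      then show ?thesis using K1 ab by (simp add: mult_le_cancel_right1)
    next
      case False
      then have b: "b > 0" using ab by simp
      have 1: "\<bar>a powr p - b powr p\<bar> = b powr p * \<bar>(a / b) powr p - 1\<bar>"
      proof -
        have "a powr p - b powr p = b powr p * ((a / b) powr p - 1)"
          using ab b by (simp add: powr_divide algebra_simps)
        then show ?thesis by (simp add: abs_mult)
      qed
      have 2: "b powr p * \<bar>a / b - 1\<bar> powr p = \<bar>a - b\<bar> powr p"
      proof -
        have "b powr p * \<bar>a / b - 1\<bar> powr p = (b * \<bar>a / b - 1\<bar>) powr p" using b by (simp add: powr_mult)
        also have "b * \<bar>a / b - 1\<bar> = \<bar>a - b\<bar>"
        proof -
          have "b * \<bar>a / b - 1\<bar> = \<bar>b * (a / b - 1)\<bar>" using b by (simp add: abs_mult)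
          then show ?thesis using b by (simp add: algebra_simps)
        qed
        finally show ?thesis .
      qed
      have "\<bar>a powr p - b powr p\<bar> \<le> b powr p * (\<epsilon> + K * \<bar>a / b - 1\<bar> powr p)"
        unfolding 1 using unit[of "a / b"] ab b by (intro mult_left_mono) auto
      also have "\<dots> = \<epsilon> * b powr p + K * (b powr p * \<bar>a / b - 1\<bar> powr p)"
        by (simp add: algebra_simps)
      finally show ?thesis unfolding 2 .
    qed
  qed
qed

lemma powr_midpoint_le:
  fixes A B r :: real
  assumes "A \<ge> 0" "B \<ge> 0" "r \<ge> 1"
  shows "((A + B) / 2) powr r \<le> (A powr r + B powr r) / 2"
proof -
  have half: "(x / 2) powr r \<le> x powr r / 2" if "x \<ge> 0" for x :: real
  proof -
    have "(1 / 2) powr r \<le> (1 / 2) powr (1::real)" using assms(3) by (intro powr_mono') auto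
    then have "x powr r * (1 / 2) powr r \<le> x powr r * (1 / 2)" by (intro mult_left_mono) auto
    then show ?thesis using that by (simp add: powr_divide)
  qed
  show ?thesis
  proof (cases "A = 0 \<or> B = 0")
    case True
    then show ?thesis using half[of A] half[of B] assms by auto
  next
    case False
    then have "((1 - 1 / 2) *\<^sub>R A + (1 / 2) *\<^sub>R B) powr r \<le> (1 - 1 / 2) * A powr r + (1 / 2) * B powr r"
      using assms by (intro convex_onD[OF powr_convex[OF assms(3)]]) auto
    then show ?thesis by (simp add: add_divide_distrib)
  qed
qed

lemma powr_superadditive:
  fixes s t r :: real
  assumes "s \<ge> 0" "t \<ge> 0" "r \<ge> 1"
  shows "s powr r + t powr r \<le> (s + t) powr r"
proof (cases "s + t = 0")
  case False
  then have st: "s + t > 0" using assms by simp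
  have frac: "x powr r \<le> x * (s + t) powr (r - 1)" if "0 \<le> x" "x \<le> s + t" for x
  proof (cases "x = 0")
    case False
    then have "x powr r = x * x powr (r - 1)" using that by (simp add: powr_diff)
    also have "\<dots> \<le> x * (s + t) powr (r - 1)" using that assms by (intro mult_left_mono powr_mono2) auto
    finally show ?thesis .
  qed simp
  have "s powr r + t powr r \<le> (s + t) * (s + t) powr (r - 1)"
    using frac[of s] frac[of t] assms by (simp add: algebra_simps)
  also have "\<dots> = (s + t) powr r" using st by (simp add: powr_diff)
  finally show ?thesis .
next
  case True
  then have "s = 0" "t = 0" using assms by linarith+
  then show ?thesis by simp
qed

text \<open>
  The parallelogram law for the squared norms, between the superadditivity and the convexity of
  \<open>t \<mapsto> t powr (p / 2)\<close>.
\<close>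

lemma Clarkson_inequality:
  fixes a b :: "'b::real_inner"
  assumes p: "p \<ge> 2"
  shows "norm ((1 / 2) *\<^sub>R (a + b)) powr p + norm ((1 / 2) *\<^sub>R (a - b)) powr p \<le> (norm a powr p + norm b powr p) / 2"
proof -
  let ?s = "norm ((1 / 2) *\<^sub>R (a + b))" and ?t = "norm ((1 / 2) *\<^sub>R (a - b))"
  have sq: "x powr p = (x\<^sup>2) powr (p / 2)" if "x \<ge> 0" for x :: real
  proof -
    have "x\<^sup>2 = x powr 2" using that by (cases "x = 0") (simp_all add: powr_numeral)
    then show ?thesis by (simp add: powr_powr)
  qed
  have "?s powr p + ?t powr p = (?s\<^sup>2) powr (p / 2) + (?t\<^sup>2) powr (p / 2)" by (simp add: sq)
  also have "\<dots> \<le> (?s\<^sup>2 + ?t\<^sup>2) powr (p / 2)" using p by (intro powr_superadditive) auto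
  also have "?s\<^sup>2 + ?t\<^sup>2 = ((norm a)\<^sup>2 + (norm b)\<^sup>2) / 2"
  proof -
    have "?s\<^sup>2 = (norm (a + b))\<^sup>2 / 4" "?t\<^sup>2 = (norm (a - b))\<^sup>2 / 4" by (simp_all add: power_divide)
    moreover have "(norm (a + b))\<^sup>2 + (norm (a - b))\<^sup>2 = 2 * (norm a)\<^sup>2 + 2 * (norm b)\<^sup>2"
      by (simp add: power2_norm_eq_inner inner_add_left inner_add_right inner_diff_left inner_diff_right)
    ultimately show ?thesis by argo
  qed
  also have "\<dots> powr (p / 2) \<le> (((norm a)\<^sup>2) powr (p / 2) + ((norm b)\<^sup>2) powr (p / 2)) / 2"
    using p by (intro powr_midpoint_le) auto
  also have "\<dots> = (norm a powr p + norm b powr p) / 2" by (simp add: sq)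
  finally show ?thesis .
qed

definition Lp_power :: "real \<Rightarrow> 'a::euclidean_space set \<Rightarrow> ('a \<Rightarrow> 'b::euclidean_space) \<Rightarrow> real" where
  "Lp_power p U f = (LINT x|lebesgue_on U. norm (f x) powr p)"

lemma Lp_power_nonneg: "0 \<le> Lp_power p U f"
  by (simp add: Lp_power_def)

lemma Lp_spaceD:
  assumes "f \<in> Lp_space p U"
  shows "f \<in> borel_measurable (lebesgue_on U)" "integrable (lebesgue_on U) (\<lambda>x. norm (f x) powr p)"
  using assms by (auto simp: Lp_space_def)

lemma Lp_space_cmult:
  assumes "f \<in> Lp_space p U" shows "(\<lambda>x. c *\<^sub>R f x) \<in> Lp_space p U"
  using assms unfolding Lp_space_def by (auto simp: powr_mult)

lemma Lp_space_add:
  assumes p: "p \<ge> 0" and f: "f \<in> Lp_space p U" and g: "g \<in> Lp_space p U"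
  shows "(\<lambda>x. f x + g x) \<in> Lp_space p U"
proof -
  note [measurable] = Lp_spaceD(1)[OF f] Lp_spaceD(1)[OF g]
  have "integrable (lebesgue_on U) (\<lambda>x. norm (f x + g x) powr p)"
  proof (rule Bochner_Integration.integrable_bound)
    show "integrable (lebesgue_on U) (\<lambda>x. 2 powr p * (norm (f x) powr p + norm (g x) powr p))"
      using Lp_spaceD(2)[OF f] Lp_spaceD(2)[OF g] by simp
    show "AE x in lebesgue_on U. norm (norm (f x + g x) powr p) \<le>
        norm (2 powr p * (norm (f x) powr p + norm (g x) powr p))"
    proof (rule AE_I2)
      fix x
      have "norm (f x + g x) powr p \<le> (norm (f x) + norm (g x)) powr p"
        using p by (intro powr_mono2 norm_triangle_ineq) auto
      also have "\<dots> \<le> 2 powr p * (norm (f x) powr p + norm (g x) powr p)"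
        using p by (intro powr_add_le) auto
      finally show "norm (norm (f x + g x) powr p) \<le> norm (2 powr p * (norm (f x) powr p + norm (g x) powr p))"
        by simp
    qed
  qed measurable
  then show ?thesis by (simp add: Lp_space_def)
qed

lemma Lp_space_diff:
  assumes "p \<ge> 0" "f \<in> Lp_space p U" "g \<in> Lp_space p U"
  shows "(\<lambda>x. f x - g x) \<in> Lp_space p U"
  using Lp_space_add[OF assms(1,2) Lp_space_cmult[OF assms(3), of "-1"]] by simp

lemma Lp_weighted_integrable:
  assumes f: "f \<in> Lp_space p U"
    and w: "w \<in> borel_measurable (lebesgue_on U)" "\<And>x. x \<in> U \<Longrightarrow> \<bar>w x\<bar> \<le> W"
  shows "integrable (lebesgue_on U) (\<lambda>x. w x * norm (f x) powr p)"
proof (rule Bochner_Integration.integrable_bound)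
  show "integrable (lebesgue_on U) (\<lambda>x. W * norm (f x) powr p)" using Lp_spaceD(2)[OF f] by simp
  show "(\<lambda>x. w x * norm (f x) powr p) \<in> borel_measurable (lebesgue_on U)"
    using w(1) Lp_spaceD(1)[OF f] by measurable
  show "AE x in lebesgue_on U. norm (w x * norm (f x) powr p) \<le> norm (W * norm (f x) powr p)"
  proof (rule AE_I2)
    fix x assume "x \<in> space (lebesgue_on U)"
    then have "\<bar>w x\<bar> \<le> \<bar>W\<bar>" using w(2)[of x] by simp
    then show "norm (w x * norm (f x) powr p) \<le> norm (W * norm (f x) powr p)"
      by (simp add: abs_mult mult_right_mono)
  qed
qed

text \<open>
  The pointwise comparison \<open>powr_perturbation\<close> of the \<open>p\<close>-th powers is integrated, so the weight may
  have any sign.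
\<close>

lemma Lp_weighted_tendsto:
  fixes f :: "'a::euclidean_space \<Rightarrow> 'b::euclidean_space" and F :: "nat \<Rightarrow> 'a \<Rightarrow> 'b"
  assumes p: "p > 0" and f: "f \<in> Lp_space p U" and F: "\<And>k. F k \<in> Lp_space p U"
    and lim: "(\<lambda>k. Lp_power p U (\<lambda>x. F k x - f x)) \<longlonglongrightarrow> 0"
    and w: "w \<in> borel_measurable (lebesgue_on U)" "\<And>x. x \<in> U \<Longrightarrow> \<bar>w x\<bar> \<le> W"
  shows "(\<lambda>k. LINT x|lebesgue_on U. w x * norm (F k x) powr p) \<longlonglongrightarrow> (LINT x|lebesgue_on U. w x * norm (f x) powr p)"
proof (rule LIMSEQ_I)
  fix e :: real assume e: "e > 0"
  define V where "V = \<bar>W\<bar> + 1"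
  define P where "P = Lp_power p U f"
  define \<epsilon> where "\<epsilon> = e / (2 * V * (P + 1))"
  have V: "V > 0" "\<And>x. x \<in> U \<Longrightarrow> \<bar>w x\<bar> \<le> V" using w(2) unfolding V_def by force+
  have P: "P \<ge> 0" unfolding P_def by (rule Lp_power_nonneg)
  have \<epsilon>: "\<epsilon> > 0" unfolding \<epsilon>_def using e V P by simp
  obtain K where K: "K > 0"
    "\<And>a b. 0 \<le> a \<Longrightarrow> 0 \<le> b \<Longrightarrow> \<bar>a powr p - b powr p\<bar> \<le> \<epsilon> * b powr p + K * \<bar>a - b\<bar> powr p"
    using powr_perturbation[OF p \<epsilon>] by metis
  have bound: "\<bar>(LINT x|lebesgue_on U. w x * norm (F k x) powr p) - (LINT x|lebesgue_on U. w x * norm (f x) powr p)\<bar>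
    \<le> V * (\<epsilon> * P + K * Lp_power p U (\<lambda>x. F k x - f x))" for k
  proof -
    have d: "(\<lambda>x. F k x - f x) \<in> Lp_space p U" using p F f by (intro Lp_space_diff) auto
    have "(LINT x|lebesgue_on U. w x * norm (F k x) powr p) - (LINT x|lebesgue_on U. w x * norm (f x) powr p)
      = (LINT x|lebesgue_on U. w x * norm (F k x) powr p - w x * norm (f x) powr p)"
      using Lp_weighted_integrable[OF f w] Lp_weighted_integrable[OF F w] by simp
    also have "\<bar>\<dots>\<bar> \<le> (LINT x|lebesgue_on U. V * (\<epsilon> * norm (f x) powr p + K * norm (F k x - f x) powr p))"
    proof (rule integral_abs_bound_integral)
      show "integrable (lebesgue_on U) (\<lambda>x. w x * norm (F k x) powr p - w x * norm (f x) powr p)"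
        using Lp_weighted_integrable[OF f w] Lp_weighted_integrable[OF F w] by simp
      show "integrable (lebesgue_on U) (\<lambda>x. V * (\<epsilon> * norm (f x) powr p + K * norm (F k x - f x) powr p))"
        using Lp_spaceD(2)[OF f] Lp_spaceD(2)[OF d] by simp
      fix x assume "x \<in> space (lebesgue_on U)"
      then have x: "\<bar>w x\<bar> \<le> V" using V(2) by simp
      have "\<bar>w x * norm (F k x) powr p - w x * norm (f x) powr p\<bar> = \<bar>w x\<bar> * \<bar>norm (F k x) powr p - norm (f x) powr p\<bar>"
        by (simp add: abs_mult[symmetric] right_diff_distrib)
      also have "\<dots> \<le> V * (\<epsilon> * norm (f x) powr p + K * \<bar>norm (F k x) - norm (f x)\<bar> powr p)"
        using x V(1) by (intro mult_mono K(2)) auto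
      also have "\<dots> \<le> V * (\<epsilon> * norm (f x) powr p + K * norm (F k x - f x) powr p)"
        using V(1) K(1) p by (intro mult_left_mono add_left_mono powr_mono2 norm_triangle_ineq3) auto
      finally show "\<bar>w x * norm (F k x) powr p - w x * norm (f x) powr p\<bar> \<le> \<dots>" .
    qed
    also have "\<dots> = V * (\<epsilon> * P + K * Lp_power p U (\<lambda>x. F k x - f x))"
      using Lp_spaceD(2)[OF f] Lp_spaceD(2)[OF d] by (simp add: P_def Lp_power_def)
    finally show ?thesis .
  qed
  have "V * (\<epsilon> * P) < e"
  proof -
    have "V * (\<epsilon> * P) = e / 2 * (P / (P + 1))" unfolding \<epsilon>_def using V(1) P by simp
    also have "\<dots> \<le> e / 2 * 1" using e P by (intro mult_left_mono) auto
    also have "\<dots> < e" using e by simp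
    finally show ?thesis .
  qed
  moreover have "(\<lambda>k. V * (\<epsilon> * P + K * Lp_power p U (\<lambda>x. F k x - f x))) \<longlonglongrightarrow> V * (\<epsilon> * P + K * 0)"
    by (intro tendsto_intros lim)
  ultimately have "eventually (\<lambda>k. V * (\<epsilon> * P + K * Lp_power p U (\<lambda>x. F k x - f x)) < e) sequentially"
    by (intro order_tendstoD(2)) auto
  then obtain N where "\<And>k. k \<ge> N \<Longrightarrow> V * (\<epsilon> * P + K * Lp_power p U (\<lambda>x. F k x - f x)) < e"
    by (auto simp: eventually_sequentially)
  then show "\<exists>N. \<forall>k\<ge>N. norm ((LINT x|lebesgue_on U. w x * norm (F k x) powr p) - (LINT x|lebesgue_on U. w x * norm (f x) powr p)) < e"
    using le_less_trans[OF bound] by (intro exI[of _ N] allI impI) simp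
qed

text \<open>
  A subsequence whose increments decay geometrically converges almost everywhere by Borel-Cantelli;
  Fatou's lemma shows that the pointwise limit is the limit in \<open>L\<^sup>p\<close>.
\<close>

lemma Lp_complete:
  fixes g :: "nat \<Rightarrow> 'a::euclidean_space \<Rightarrow> 'b::euclidean_space"
  assumes p: "p > 0" and g: "\<And>k. g k \<in> Lp_space p U"
    and cauchy: "\<And>e. e > 0 \<Longrightarrow> \<exists>N. \<forall>k\<ge>N. \<forall>l\<ge>N. Lp_power p U (\<lambda>x. g k x - g l x) \<le> e"
  obtains f where "f \<in> Lp_space p U" "(\<lambda>k. Lp_power p U (\<lambda>x. g k x - f x)) \<longlonglongrightarrow> 0"
proof -
  let ?M = "lebesgue_on U"
  note gm [measurable] = Lp_spaceD(1)[OF g]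
  have gd: "(\<lambda>x. g k x - g l x) \<in> Lp_space p U" for k l using p g by (intro Lp_space_diff) auto
  define h :: "nat \<Rightarrow> real" where "h j = (1 / 2) ^ j" for j
  have h: "h j > 0" for j by (simp add: h_def)
  have sh: "summable h" unfolding h_def[abs_def] by (rule summable_geometric) simp
  have "\<forall>j. \<exists>N. \<forall>k\<ge>N. \<forall>l\<ge>N. Lp_power p U (\<lambda>x. g k x - g l x) \<le> h j * h j powr p"
    by (intro allI cauchy mult_pos_pos h) (use h in \<open>simp add: less_le\<close>)
  then obtain N where N: "\<And>j k l. k \<ge> N j \<Longrightarrow> l \<ge> N j \<Longrightarrow> Lp_power p U (\<lambda>x. g k x - g l x) \<le> h j * h j powr p"
    by metis
  define r where "r j = j + (\<Sum>i\<le>j. N i)" for j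
  have rN: "r j \<ge> N j" for j
    using member_le_sum[of j "{..j}" N] by (simp add: r_def)
  have rS: "r (Suc j) \<ge> r j" for j by (simp add: r_def)
  have rj: "r j \<ge> j" for j by (simp add: r_def)
  \<comment> \<open>The exceptional sets of Borel-Cantelli; by Markov's inequality their measures are at most \<open>h j\<close>.\<close>
  define A where "A j = {x \<in> space ?M. norm (g (r (Suc j)) x - g (r j) x) powr p \<ge> h j powr p}" for j
  have Lp_j: "Lp_power p U (\<lambda>x. g (r (Suc j)) x - g (r j) x) \<le> h j * h j powr p" for j
    using rN[of j] rS[of j] by (intro N) auto
  have mA: "A j \<in> sets ?M" for j unfolding A_def by measurable
  have eA: "emeasure ?M (A j) \<le> ennreal (h j)" for j
  proof -
    have "emeasure ?M (A j) \<le> ennreal ((1 / h j powr p) * Lp_power p U (\<lambda>x. g (r (Suc j)) x - g (r j) x))"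
      unfolding A_def Lp_power_def
      using integral_Markov_inequality[OF Lp_spaceD(2)[OF gd[of "r (Suc j)" "r j"]], of "h j powr p"] h[of j] by simp
    also have "\<dots> \<le> ennreal ((1 / h j powr p) * (h j * h j powr p))"
      using h[of j] by (intro ennreal_leI mult_left_mono Lp_j) auto
    also have "(1 / h j powr p) * (h j * h j powr p) = h j" using h[of j] by simp
    finally show ?thesis .
  qed
  have "AE x in ?M. eventually (\<lambda>j. x \<in> space ?M - A j) sequentially"
  proof (rule borel_cantelli_AE1[OF mA])
    show "emeasure ?M (A j) < \<infinity>" for j using eA[of j] by (simp add: le_less_trans ennreal_less_top)
    have "norm (measure ?M (A j)) \<le> h j" for j
      using eA[of j] h[of j] by (simp add: measure_def enn2real_leI)
    then show "summable (\<lambda>j. measure ?M (A j))" by (rule summable_comparison_test'[OF sh])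
  qed
  then have conv: "AE x in ?M. convergent (\<lambda>j. g (r j) x)"
  proof eventually_elim
    fix x assume ev: "eventually (\<lambda>j. x \<in> space ?M - A j) sequentially"
    have "eventually (\<lambda>j. norm (g (r (Suc j)) x - g (r j) x) \<le> h j) sequentially"
      using ev
    proof eventually_elim
      case (elim j)
      then have "norm (g (r (Suc j)) x - g (r j) x) powr p < h j powr p" by (auto simp: A_def)
      then show ?case using powr_less_cancel2[of p] p h[of j]
        by (metis less_eq_real_def linorder_not_less norm_ge_zero powr_mono2)
    qed
    then have "summable (\<lambda>j. g (r (Suc j)) x - g (r j) x)"
      by (rule summable_comparison_test_ev[OF _ sh])
    then have "convergent (\<lambda>m. \<Sum>j<m. g (r (Suc j)) x - g (r j) x)" by (simp add: summable_iff_convergent)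
    then have "convergent (\<lambda>m. g (r m) x - g (r 0) x)" by (simp add: sum_lessThan_telescope[of "\<lambda>n. g (r n) x"])
    then have "convergent (\<lambda>m. (g (r m) x - g (r 0) x) + g (r 0) x)"
      by (intro convergent_add convergent_const)
    then show "convergent (\<lambda>j. g (r j) x)" by simp
  qed
  define f where "f x = lim (\<lambda>j. g (r j) x)" for x
  have fm [measurable]: "f \<in> borel_measurable ?M"
    unfolding f_def by measurable
  have AEf: "AE x in ?M. (\<lambda>j. g (r j) x) \<longlonglongrightarrow> f x"
    using conv by eventually_elim (simp add: f_def convergent_LIMSEQ_iff)
  have fatou: "(\<integral>\<^sup>+x. ennreal (norm (g l x - f x) powr p) \<partial>?M) \<le> ennreal e"
    if "e > 0" and Ne: "\<And>k. k \<ge> N \<Longrightarrow> Lp_power p U (\<lambda>x. g l x - g k x) \<le> e" for e l N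
  proof -
    have "(\<integral>\<^sup>+x. ennreal (norm (g l x - f x) powr p) \<partial>?M)
      \<le> (\<integral>\<^sup>+x. liminf (\<lambda>j. ennreal (norm (g l x - g (r j) x) powr p)) \<partial>?M)"
    proof (rule nn_integral_mono_AE)
      show "AE x in ?M. ennreal (norm (g l x - f x) powr p) \<le> liminf (\<lambda>j. ennreal (norm (g l x - g (r j) x) powr p))"
        using AEf
      proof eventually_elim
        fix x assume "(\<lambda>j. g (r j) x) \<longlonglongrightarrow> f x"
        then have "(\<lambda>j. ennreal (norm (g l x - g (r j) x) powr p)) \<longlonglongrightarrow> ennreal (norm (g l x - f x) powr p)"
          using p by (intro tendsto_ennrealI tendsto_powr' tendsto_norm tendsto_diff tendsto_const) auto
        from lim_imp_Liminf[OF trivial_limit_sequentially this]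
        show "ennreal (norm (g l x - f x) powr p) \<le> liminf (\<lambda>j. ennreal (norm (g l x - g (r j) x) powr p))"
          by simp
      qed
    qed
    also have "\<dots> \<le> liminf (\<lambda>j. \<integral>\<^sup>+x. ennreal (norm (g l x - g (r j) x) powr p) \<partial>?M)"
      by (rule nn_integral_liminf) measurable
    also have "\<dots> = liminf (\<lambda>j. ennreal (Lp_power p U (\<lambda>x. g l x - g (r j) x)))"
      unfolding Lp_power_def using Lp_spaceD(2)[OF gd] by (simp add: nn_integral_eq_integral)
    also have "\<dots> \<le> ennreal e"
    proof -
      have "eventually (\<lambda>j. ennreal (Lp_power p U (\<lambda>x. g l x - g (r j) x)) \<le> ennreal e) sequentially"
        using eventually_ge_at_top[of N] by eventually_elim (use rj Ne order_trans in \<open>blast intro: ennreal_leI\<close>)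
      then have "limsup (\<lambda>j. ennreal (Lp_power p U (\<lambda>x. g l x - g (r j) x))) \<le> ennreal e"
        by (rule Limsup_bounded)
      then show ?thesis by (rule order_trans[OF Liminf_le_Limsup, rotated]) simp
    qed
    finally show ?thesis .
  qed
  have small: "integrable ?M (\<lambda>x. norm (g l x - f x) powr p) \<and> Lp_power p U (\<lambda>x. g l x - f x) \<le> e"
    if "e > 0" "\<And>k. k \<ge> N \<Longrightarrow> Lp_power p U (\<lambda>x. g l x - g k x) \<le> e" for e l N
  proof
    have le: "(\<integral>\<^sup>+x. ennreal (norm (g l x - f x) powr p) \<partial>?M) \<le> ennreal e"
      using that(2) by (rule fatou[where e=e and N=N and l=l, OF that(1)])
    show int: "integrable ?M (\<lambda>x. norm (g l x - f x) powr p)"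
      using le by (intro integrableI_nonneg) (auto simp: le_less_trans ennreal_less_top)
    show "Lp_power p U (\<lambda>x. g l x - f x) \<le> e"
      using le that(1) unfolding Lp_power_def by (simp add: nn_integral_eq_integral[OF int])
  qed
  show ?thesis
  proof (rule that)
    obtain N1 where N1: "\<forall>k\<ge>N1. \<forall>l\<ge>N1. Lp_power p U (\<lambda>x. g k x - g l x) \<le> 1" using cauchy[of 1] by auto
    have "(\<lambda>x. g N1 x - f x) \<in> Lp_space p U"
      using small[of 1 N1 N1] N1 by (auto simp: Lp_space_def)
    from Lp_space_diff[OF _ g this, of N1] show "f \<in> Lp_space p U" using p by simp
    show "(\<lambda>k. Lp_power p U (\<lambda>x. g k x - f x)) \<longlonglongrightarrow> 0"
    proof (rule LIMSEQ_I)
      fix e :: real assume e: "e > 0"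
      then obtain N2 where N2: "\<forall>k\<ge>N2. \<forall>l\<ge>N2. Lp_power p U (\<lambda>x. g k x - g l x) \<le> e / 2" using cauchy[of "e / 2"] by auto
      have half: "Lp_power p U (\<lambda>x. g k x - f x) \<le> e / 2" if "k \<ge> N2" for k
        using small[of "e / 2" N2 k] N2 that e by auto
      have "norm (Lp_power p U (\<lambda>x. g k x - f x) - 0) < e" if "k \<ge> N2" for k
        using half[OF that] e Lp_power_nonneg[of p U "\<lambda>x. g k x - f x"] by simp
      then show "\<exists>N. \<forall>k\<ge>N. norm (Lp_power p U (\<lambda>x. g k x - f x) - 0) < e" by blast
    qed
  qed
qed

lemma Lp_space_integrable:
  fixes f :: "'a::euclidean_space \<Rightarrow> 'b::euclidean_space"
  assumes p: "p \<ge> 1" and f: "f \<in> Lp_space p U" and U: "U \<in> lmeasurable"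
  shows "integrable (lebesgue_on U) f"
proof (rule Bochner_Integration.integrable_bound)
  have "finite_measure (lebesgue_on U)"
    using U by (simp add: finite_measure_lebesgue_on)
  then show "integrable (lebesgue_on U) (\<lambda>x. 1 + norm (f x) powr p)"
    using Lp_spaceD(2)[OF f] by (simp add: finite_measure.integrable_const)
  show "f \<in> borel_measurable (lebesgue_on U)" by (rule Lp_spaceD(1)[OF f])
  show "AE x in lebesgue_on U. norm (f x) \<le> norm (1 + norm (f x) powr p)"
  proof (rule AE_I2)
    fix x
    have "norm (f x) \<le> 1 + norm (f x) powr p"
    proof (cases "norm (f x) \<le> 1")
      case False
      then have "norm (f x) powr 1 \<le> norm (f x) powr p" using p by (intro powr_mono) auto
      then show ?thesis using False by simp
    qed (simp add: add_increasing2)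
    then show "norm (f x) \<le> norm (1 + norm (f x) powr p)" by simp
  qed
qed

lemma integrable_locally_integrable:
  fixes f :: "'a::euclidean_space \<Rightarrow> 'b::euclidean_space"
  assumes f: "integrable (lebesgue_on U) f" and U: "U \<in> sets lebesgue"
  shows "locally_integrable U f"
  unfolding locally_integrable_def
proof (intro allI impI)
  fix K :: "'a set" assume K: "compact K \<and> K \<subseteq> U"
  have Kl: "K \<in> sets lebesgue" using K by (simp add: borel_compact sets_completionI_sets)
  have "integrable lebesgue (\<lambda>x. indicator U x *\<^sub>R f x)"
    using f U by (simp add: integrable_restrict_space)
  then have "integrable lebesgue (\<lambda>x. indicator K x *\<^sub>R (indicator U x *\<^sub>R f x))"
    by (rule integrable_mult_indicator[OF Kl])
  also have "(\<lambda>x. indicator K x *\<^sub>R (indicator U x *\<^sub>R f x)) = (\<lambda>x. indicator K x *\<^sub>R f x)"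
    using K by (auto simp: indicator_def fun_eq_iff)
  finally show "integrable (lebesgue_on K) f" using Kl by (simp add: integrable_restrict_space)
qed

section \<open>Sobolev functions as limits of test functions\<close>

lemma Lp_power_cmult: "Lp_power p U (\<lambda>x. c *\<^sub>R f x) = \<bar>c\<bar> powr p * Lp_power p U f"
  by (simp add: Lp_power_def powr_mult)

lemma Lp_power_minus_commute: "Lp_power p U (\<lambda>x. f x - g x) = Lp_power p U (\<lambda>x. g x - f x)"
  by (simp add: Lp_power_def norm_minus_commute)

lemma Lp_space_bounded:
  assumes U: "U \<in> lmeasurable" and p: "p \<ge> 0"
    and f: "f \<in> borel_measurable (lebesgue_on U)" "\<And>x. x \<in> U \<Longrightarrow> norm (f x) \<le> D"
  shows "f \<in> Lp_space p U" "Lp_power p U f \<le> measure (lebesgue_on U) U * D powr p"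
proof -
  interpret finite_measure "lebesgue_on U" using U by (rule finite_measure_lebesgue_on)
  have le: "norm (f x) powr p \<le> D powr p" if "x \<in> space (lebesgue_on U)" for x
    using that f(2)[of x] p by (intro powr_mono2) auto
  have int: "integrable (lebesgue_on U) (\<lambda>x. norm (f x) powr p)"
    using f(1) le by (intro integrable_const_bound[where B="D powr p"]) auto
  then show "f \<in> Lp_space p U" using f(1) by (simp add: Lp_space_def)
  have "Lp_power p U f \<le> (LINT x|lebesgue_on U. D powr p)"
    unfolding Lp_power_def by (intro integral_mono int integrable_const le)
  then show "Lp_power p U f \<le> measure (lebesgue_on U) U * D powr p" by simp
qed

text \<open>
  This uses \<open>t \<le> s + s powr (1 - p) * t powr p\<close> for every \<open>s > 0\<close>, integrated over a set of finite measure.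
\<close>

lemma Lp_tendsto_imp_L1:
  fixes F :: "nat \<Rightarrow> 'a::euclidean_space \<Rightarrow> 'b::euclidean_space"
  assumes U: "U \<in> lmeasurable" and p: "p \<ge> 1" and F: "\<And>k. F k \<in> Lp_space p U"
    and lim: "(\<lambda>k. Lp_power p U (F k)) \<longlonglongrightarrow> 0"
  shows "(\<lambda>k. LINT x|lebesgue_on U. norm (F k x)) \<longlonglongrightarrow> 0"
proof (rule LIMSEQ_I)
  interpret finite_measure "lebesgue_on U" using U by (rule finite_measure_lebesgue_on)
  let ?V = "measure (lebesgue_on U) U"
  fix e :: real assume e: "e > 0"
  define s where "s = e / (2 * (?V + 1))"
  have s: "s > 0" "?V * s < e"
  proof -
    show "s > 0" unfolding s_def using e by (simp add: add_nonneg_pos)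
    have "?V * s = e / 2 * (?V / (?V + 1))" unfolding s_def by simp
    also have "\<dots> \<le> e / 2 * 1" using e by (intro mult_left_mono) (auto simp: divide_le_eq add_nonneg_pos)
    finally show "?V * s < e" using e by simp
  qed
  have bound: "(LINT x|lebesgue_on U. norm (F k x)) \<le> ?V * s + s powr (1 - p) * Lp_power p U (F k)" for k
  proof -
    have "(LINT x|lebesgue_on U. norm (F k x)) \<le> (LINT x|lebesgue_on U. s + s powr (1 - p) * norm (F k x) powr p)"
    proof (rule integral_mono)
      show "integrable (lebesgue_on U) (\<lambda>x. norm (F k x))"
        using Lp_space_integrable[OF p F U] by (rule integrable_norm)
      show "integrable (lebesgue_on U) (\<lambda>x. s + s powr (1 - p) * norm (F k x) powr p)"
        using Lp_spaceD(2)[OF F] by simp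
      fix x
      show "norm (F k x) \<le> s + s powr (1 - p) * norm (F k x) powr p"
      proof (cases "norm (F k x) \<le> s")
        case True
        then show ?thesis by (simp add: add_increasing2)
      next
        case False
        then have F0: "norm (F k x) > 0" using s(1) by linarith
        have "s powr (1 - p) * norm (F k x) powr p \<ge> norm (F k x) powr (1 - p) * norm (F k x) powr p"
          using False s(1) p by (intro mult_right_mono powr_mono2') auto
        also have "norm (F k x) powr (1 - p) * norm (F k x) powr p = norm (F k x)"
          using F0 by (simp add: powr_add[symmetric])
        finally show ?thesis using s(1) by linarith
      qed
    qed
    also have "\<dots> = ?V * s + s powr (1 - p) * Lp_power p U (F k)"
      using Lp_spaceD(2)[OF F] by (simp add: Lp_power_def)
    finally show ?thesis .
  qed
  have "(\<lambda>k. ?V * s + s powr (1 - p) * Lp_power p U (F k)) \<longlonglongrightarrow> ?V * s + s powr (1 - p) * 0"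
    by (intro tendsto_intros lim)
  then have "eventually (\<lambda>k. ?V * s + s powr (1 - p) * Lp_power p U (F k) < e) sequentially"
    using s(2) by (intro order_tendstoD(2)) auto
  then obtain N where N: "\<And>k. k \<ge> N \<Longrightarrow> ?V * s + s powr (1 - p) * Lp_power p U (F k) < e"
    by (auto simp: eventually_sequentially)
  have "norm ((LINT x|lebesgue_on U. norm (F k x)) - 0) < e" if "k \<ge> N" for k
    using le_less_trans[OF bound N[OF that]] by simp
  then show "\<exists>N. \<forall>k\<ge>N. norm ((LINT x|lebesgue_on U. norm (F k x)) - 0) < e" by blast
qed

lemma Lp_tendsto_pairing:
  fixes F :: "nat \<Rightarrow> 'a::euclidean_space \<Rightarrow> 'b::euclidean_space"
  assumes U: "U \<in> lmeasurable" and p: "p \<ge> 1" and F: "\<And>k. F k \<in> Lp_space p U" and f: "f \<in> Lp_space p U"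
    and lim: "(\<lambda>k. Lp_power p U (\<lambda>x. F k x - f x)) \<longlonglongrightarrow> 0"
    and h: "h \<in> borel_measurable (lebesgue_on U)" "\<And>x. x \<in> U \<Longrightarrow> norm (h x) \<le> D"
  shows "(\<lambda>k. LINT x|lebesgue_on U. F k x \<bullet> h x) \<longlonglongrightarrow> (LINT x|lebesgue_on U. f x \<bullet> h x)"
proof -
  have d: "(\<lambda>x. F k x - f x) \<in> Lp_space p U" for k using p F f by (intro Lp_space_diff) auto
  have int: "integrable (lebesgue_on U) (\<lambda>x. g x \<bullet> h x)" if "g \<in> Lp_space p U" for g :: "'a \<Rightarrow> 'b"
  proof (rule Bochner_Integration.integrable_bound)
    show "integrable (lebesgue_on U) (\<lambda>x. D * norm (g x))"
      using Lp_space_integrable[OF p that U] by simp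
    show "(\<lambda>x. g x \<bullet> h x) \<in> borel_measurable (lebesgue_on U)"
      using Lp_spaceD(1)[OF that] h(1) by (intro borel_measurable_inner)
    show "AE x in lebesgue_on U. norm (g x \<bullet> h x) \<le> norm (D * norm (g x))"
    proof (rule AE_I2)
      fix x assume "x \<in> space (lebesgue_on U)"
      then have D: "norm (h x) \<le> \<bar>D\<bar>" using h(2)[of x] by simp
      have "norm (g x \<bullet> h x) \<le> norm (g x) * norm (h x)" by (simp add: Cauchy_Schwarz_ineq2)
      also have "\<dots> \<le> norm (g x) * \<bar>D\<bar>" using D by (intro mult_left_mono) auto
      finally show "norm (g x \<bullet> h x) \<le> norm (D * norm (g x))" by (simp add: abs_mult mult.commute)
    qed
  qed
  have bound: "norm ((LINT x|lebesgue_on U. F k x \<bullet> h x) - (LINT x|lebesgue_on U. f x \<bullet> h x))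
      \<le> D * (LINT x|lebesgue_on U. norm (F k x - f x))" for k
  proof -
    have "(LINT x|lebesgue_on U. F k x \<bullet> h x) - (LINT x|lebesgue_on U. f x \<bullet> h x)
        = (LINT x|lebesgue_on U. (F k x - f x) \<bullet> h x)"
      using int[OF F] int[OF f] by (simp add: inner_diff_left)
    also have "norm \<dots> \<le> (LINT x|lebesgue_on U. D * norm (F k x - f x))"
    proof (rule Bochner_Integration.integral_norm_bound_integral[OF int[OF d]])
      show "integrable (lebesgue_on U) (\<lambda>x. D * norm (F k x - f x))"
        using Lp_space_integrable[OF p d U] by (intro integrable_mult_right integrable_norm)
      fix x assume "x \<in> space (lebesgue_on U)"
      then have D: "norm (h x) \<le> D" using h(2)[of x] by simp
      have "norm ((F k x - f x) \<bullet> h x) \<le> norm (F k x - f x) * norm (h x)" by (simp add: Cauchy_Schwarz_ineq2)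
      also have "\<dots> \<le> norm (F k x - f x) * D" using D by (intro mult_left_mono) auto
      finally show "norm ((F k x - f x) \<bullet> h x) \<le> D * norm (F k x - f x)" by (simp add: mult.commute)
    qed
    finally show ?thesis by simp
  qed
  have "(\<lambda>k. D * (LINT x|lebesgue_on U. norm (F k x - f x))) \<longlonglongrightarrow> D * 0"
    by (rule tendsto_mult[OF tendsto_const Lp_tendsto_imp_L1[OF U p d lim]])
  then have "(\<lambda>k. (LINT x|lebesgue_on U. F k x \<bullet> h x) - (LINT x|lebesgue_on U. f x \<bullet> h x)) \<longlonglongrightarrow> 0"
    by (intro Lim_null_comparison[OF always_eventually[OF allI[OF bound]]]) simp
  then show ?thesis by (rule LIM_zero_cancel)
qed

lemma test_Lp:
  assumes \<phi>: "\<phi> \<in> test_functions U" and U: "U \<in> sets lebesgue" and p: "p > 0"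
  shows "\<phi> \<in> Lp_space p U" "grad \<phi> \<in> Lp_space p U"
    "Lp_power p U (grad \<phi>) = (LINT x|lborel. norm (grad \<phi> x) powr p)"
proof -
  obtain K where K: "compact K" "K \<subseteq> U" "\<And>x. x \<notin> K \<Longrightarrow> \<phi> x = 0" "\<And>x. x \<notin> K \<Longrightarrow> grad \<phi> x = 0"
    using test_support[OF \<phi>] by metis
  note sm = test_smooth[OF \<phi>]
  have c: "continuous_on UNIV (\<lambda>x. norm (\<phi> x) powr p)"
    using p by (intro continuous_on_powr' continuous_on_norm smooth_continuous[OF sm] continuous_on_const) auto
  have i: "integrable lborel (\<lambda>x. norm (\<phi> x) powr p)"
    using K by (intro integrable_compact_support[OF c]) auto
  have "integrable (lebesgue_on U) (\<lambda>x. norm (\<phi> x) powr p)"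
    using K(2,3) i by (subst lebesgue_on_supported(1)[OF borel_measurable_continuous_onI[OF c] U]) auto
  then show "\<phi> \<in> Lp_space p U"
    using continuous_imp_measurable_on_sets_lebesgue[OF smooth_continuous[OF sm] U] by (simp add: Lp_space_def)
  note c' = test_grad_powr(1)[OF \<phi> p]
  have z: "norm (grad \<phi> x) powr p = 0" if "x \<notin> U" for x
    using K(2,4) that by auto
  have "integrable (lebesgue_on U) (\<lambda>x. norm (grad \<phi> x) powr p)"
    using test_grad_powr(2)[OF \<phi> p] z
    by (subst lebesgue_on_supported(1)[OF borel_measurable_continuous_onI[OF c'] U]) auto
  then show "grad \<phi> \<in> Lp_space p U"
    using continuous_imp_measurable_on_sets_lebesgue[OF grad_continuous[OF sm] U] by (simp add: Lp_space_def)
  show "Lp_power p U (grad \<phi>) = (LINT x|lborel. norm (grad \<phi> x) powr p)"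
    unfolding Lp_power_def using z by (intro lebesgue_on_supported(2)[OF borel_measurable_continuous_onI[OF c'] U])
qed

lemma test_morrey_Lp:
  fixes \<phi> :: "'a::euclidean_space \<Rightarrow> real" and x z :: 'a
  defines "n \<equiv> real DIM('a)"
  assumes \<phi>: "\<phi> \<in> test_functions U" and U: "U \<in> sets lebesgue" and p: "p > n" and \<rho>: "\<rho> > 0"
  shows "\<bar>\<phi> x - \<phi> z\<bar> \<le> (norm (x - z) + 2 * \<rho> * n) * morrey_const n p \<rho> * Lp_power p U (grad \<phi>) powr (1 / p)"
proof -
  have "p > 0" using p unfolding n_def by (rule le_less_trans[rotated]) simp
  with test_morrey[OF \<phi> p[unfolded n_def] \<rho>, of x z] show ?thesis
    unfolding n_def by (simp only: test_Lp(3)[OF \<phi> U])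
qed

text \<open>
  The chosen representative is measurable because it agrees almost everywhere with \<open>g\<close> and Lebesgue
  measure is complete. The two orders of the summands are those of the energy and of \<open>W1p_norm\<close>.
\<close>

lemma weak_gradient_integral:
  fixes F :: "'a::euclidean_space \<Rightarrow> real" and g :: "'a \<Rightarrow> 'a"
  assumes U: "open U" and u: "has_weak_gradient U u g" and g: "g \<in> Lp_space p U"
    and F: "F \<in> borel_measurable (lebesgue_on U)"
  shows "(LINT x|lebesgue_on U. norm (weak_gradient U u x) powr p + F x) = (LINT x|lebesgue_on U. norm (g x) powr p + F x)"
    and "(LINT x|lebesgue_on U. F x + norm (weak_gradient U u x) powr p) = (LINT x|lebesgue_on U. F x + norm (g x) powr p)"
proof -
  let ?w = "weak_gradient U u"
  have Ul: "U \<in> sets lebesgue" using U by (simp add: sets_completionI_sets)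
  note AE = weak_gradient_AE[OF U u]
  note gm [measurable] = Lp_spaceD(1)[OF g]
  note F [measurable]
  have "(\<lambda>x. indicator U x *\<^sub>R g x) \<in> borel_measurable lebesgue"
    using gm Ul by (simp add: borel_measurable_restrict_space_iff)
  moreover have "AE x in lebesgue. indicator U x *\<^sub>R g x = indicator U x *\<^sub>R ?w x"
    using AE Ul by (simp add: AE_restrict_space_iff) (auto simp: indicator_def elim: eventually_mono)
  ultimately have "(\<lambda>x. indicator U x *\<^sub>R ?w x) \<in> borel_measurable lebesgue"
    by (rule borel_measurable_AE)
  then have [measurable]: "?w \<in> borel_measurable (lebesgue_on U)"
    using Ul by (simp add: borel_measurable_restrict_space_iff)
  show "(LINT x|lebesgue_on U. norm (?w x) powr p + F x) = (LINT x|lebesgue_on U. norm (g x) powr p + F x)"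
    by (rule integral_cong_AE) (use AE in \<open>measurable, auto elim: eventually_mono\<close>)
  show "(LINT x|lebesgue_on U. F x + norm (?w x) powr p) = (LINT x|lebesgue_on U. F x + norm (g x) powr p)"
    by (rule integral_cong_AE) (use AE in \<open>measurable, auto elim: eventually_mono\<close>)
qed

lemma W1p_norm_eq:
  assumes U: "open U" and u: "has_weak_gradient U u g" "u \<in> Lp_space p U" "g \<in> Lp_space p U"
  shows "W1p_norm p U u = (Lp_power p U u + Lp_power p U g) powr (1 / p)"
proof -
  have "(\<lambda>x. \<bar>u x\<bar> powr p) \<in> borel_measurable (lebesgue_on U)"
    using Lp_spaceD(1)[OF u(2)] by measurable
  from weak_gradient_integral(2)[OF U u(1,3) this] show ?thesis
    unfolding W1p_norm_def Lp_power_def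
    using Lp_spaceD(2)[OF u(2)] Lp_spaceD(2)[OF u(3)] by simp
qed

text \<open>
  Separates the Sobolev norm into the convergence of functions and of gradients, for one fixed weak
  gradient \<open>g\<close>.
\<close>

lemma W1p_0_approx:
  assumes U: "open U" and p: "p > 0" and u: "u \<in> W1p_0 p U"
  shows "\<exists>g \<phi>. has_weak_gradient U u g \<and> u \<in> Lp_space p U \<and> g \<in> Lp_space p U \<and>
    (\<forall>k::nat. \<phi> k \<in> test_functions U) \<and>
    (\<lambda>k. Lp_power p U (\<lambda>x. \<phi> k x - u x)) \<longlonglongrightarrow> 0 \<and>
    (\<lambda>k. Lp_power p U (\<lambda>x. grad (\<phi> k) x - g x)) \<longlonglongrightarrow> 0"
proof -
  have Ul: "U \<in> sets lebesgue" using U by (simp add: sets_completionI_sets)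
  obtain g \<phi> where g: "has_weak_gradient U u g" "u \<in> Lp_space p U" "g \<in> Lp_space p U"
    and \<phi>: "\<And>k::nat. \<phi> k \<in> test_functions U" and lim: "(\<lambda>k. W1p_norm p U (\<lambda>x. u x - \<phi> k x)) \<longlonglongrightarrow> 0"
    using u unfolding W1p_0_def W1p_def by blast
  let ?a = "\<lambda>k. Lp_power p U (\<lambda>x. u x - \<phi> k x)" and ?b = "\<lambda>k. Lp_power p U (\<lambda>x. g x - grad (\<phi> k) x)"
  note \<phi>p = test_Lp[OF \<phi> Ul p]
  have "W1p_norm p U (\<lambda>x. u x - \<phi> k x) = (?a k + ?b k) powr (1 / p)" for k
    using p by (intro W1p_norm_eq[OF U weak_gradient_diff[OF g(1) test_has_weak_gradient[OF \<phi> Ul] Ul]]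
        Lp_space_diff g \<phi>p) auto
  with lim have "(\<lambda>k. (?a k + ?b k) powr (1 / p)) \<longlonglongrightarrow> 0" by simp
  then have "(\<lambda>k. ((?a k + ?b k) powr (1 / p)) powr p) \<longlonglongrightarrow> 0 powr p"
    using p by (intro tendsto_powr' tendsto_const) auto
  then have ab: "(\<lambda>k. ?a k + ?b k) \<longlonglongrightarrow> 0"
    using p by (simp add: powr_powr Lp_power_nonneg add_nonneg_nonneg)
  have "?a \<longlonglongrightarrow> 0"
    by (rule tendsto_sandwich[OF _ _ tendsto_const ab]) (auto simp: Lp_power_nonneg)
  moreover have "?b \<longlonglongrightarrow> 0"
    by (rule tendsto_sandwich[OF _ _ tendsto_const ab]) (auto simp: Lp_power_nonneg)
  ultimately show ?thesis
    unfolding Lp_power_minus_commute[of p U u] Lp_power_minus_commute[of p U g]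
    using g \<phi> by (intro exI[of _ g] exI[of _ \<phi>] conjI allI)
qed

lemma W1p_0_I:
  assumes U: "open U" and p: "p > 0" and g: "has_weak_gradient U u g" "u \<in> Lp_space p U" "g \<in> Lp_space p U"
    and \<phi>: "\<And>k::nat. \<phi> k \<in> test_functions U"
    and lim: "(\<lambda>k. Lp_power p U (\<lambda>x. \<phi> k x - u x)) \<longlonglongrightarrow> 0"
      "(\<lambda>k. Lp_power p U (\<lambda>x. grad (\<phi> k) x - g x)) \<longlonglongrightarrow> 0"
  shows "u \<in> W1p_0 p U"
proof -
  have Ul: "U \<in> sets lebesgue" using U by (simp add: sets_completionI_sets)
  note \<phi>p = test_Lp[OF \<phi> Ul p]
  have eq: "W1p_norm p U (\<lambda>x. u x - \<phi> k x) =
      (Lp_power p U (\<lambda>x. \<phi> k x - u x) + Lp_power p U (\<lambda>x. grad (\<phi> k) x - g x)) powr (1 / p)" for k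
    unfolding Lp_power_minus_commute[of p U "\<phi> k"] Lp_power_minus_commute[of p U "grad (\<phi> k)"]
    using p by (intro W1p_norm_eq[OF U weak_gradient_diff[OF g(1) test_has_weak_gradient[OF \<phi> Ul] Ul]]
        Lp_space_diff g \<phi>p) auto
  have "(\<lambda>k. (Lp_power p U (\<lambda>x. \<phi> k x - u x) + Lp_power p U (\<lambda>x. grad (\<phi> k) x - g x)) powr (1 / p)) \<longlonglongrightarrow> (0 + 0) powr (1 / p)"
    using p by (intro tendsto_powr' tendsto_add lim tendsto_const) (auto simp: Lp_power_nonneg add_nonneg_nonneg)
  then have "(\<lambda>k. W1p_norm p U (\<lambda>x. u x - \<phi> k x)) \<longlonglongrightarrow> 0" unfolding eq by simp
  then show ?thesis unfolding W1p_0_def W1p_def using g \<phi> by blast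
qed

section \<open>The variational problem on test functions\<close>

locale eigenvalue_problem =
  fixes \<Omega> :: "'a::euclidean_space set" and m C :: "'a \<Rightarrow> real"
  assumes open_domain: "open \<Omega>" and bounded_domain: "bounded \<Omega>" and nonempty_domain: "\<Omega> \<noteq> {}"
    and m_continuous: "continuous_on (closure \<Omega>) m"
    and C_continuous: "continuous_on (closure \<Omega>) C"
    and C_pos: "\<And>x. x \<in> closure \<Omega> \<Longrightarrow> C x > 0"
begin

lemma domain_measurable: "\<Omega> \<in> lmeasurable" "\<Omega> \<in> sets lebesgue"
  using lmeasurable_open[OF bounded_domain open_domain] by (auto simp: fmeasurableD)

lemma compact_closure_domain: "compact (closure \<Omega>)"
  using bounded_domain by (simp add: compact_closure)

lemma weights_measurable:
  "m \<in> borel_measurable (lebesgue_on \<Omega>)" "C \<in> borel_measurable (lebesgue_on \<Omega>)"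
  using m_continuous C_continuous domain_measurable(2) closure_subset
  by (auto intro!: continuous_imp_measurable_on_sets_lebesgue intro: continuous_on_subset)

lemma weights_bounded:
  obtains W where "W > 0" "\<And>x. x \<in> \<Omega> \<Longrightarrow> \<bar>m x\<bar> \<le> W" "\<And>x. x \<in> \<Omega> \<Longrightarrow> \<bar>C x\<bar> \<le> W"
proof -
  have "bounded (m ` closure \<Omega>)" "bounded (C ` closure \<Omega>)"
    using m_continuous C_continuous compact_closure_domain by (auto intro!: compact_imp_bounded compact_continuous_image)
  then obtain W1 W2 where W: "W1 > 0" "\<And>x. x \<in> closure \<Omega> \<Longrightarrow> \<bar>m x\<bar> \<le> W1"
    "W2 > 0" "\<And>x. x \<in> closure \<Omega> \<Longrightarrow> \<bar>C x\<bar> \<le> W2"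
    by (auto simp: bounded_pos)
  show ?thesis
  proof (rule that[of "max W1 W2"])
    fix x assume "x \<in> \<Omega>"
    then have "x \<in> closure \<Omega>" using closure_subset by blast
    then show "\<bar>m x\<bar> \<le> max W1 W2" "\<bar>C x\<bar> \<le> max W1 W2" using W(2)[of x] W(4)[of x] by auto
  qed (use W in auto)
qed

lemma C_lower_bound:
  obtains c where "c > 0" "\<And>x. x \<in> \<Omega> \<Longrightarrow> c \<le> C x"
proof -
  have "closure \<Omega> \<noteq> {}" using nonempty_domain by simp
  from continuous_attains_inf[OF compact_closure_domain this C_continuous]
  obtain z where z: "z \<in> closure \<Omega>" "\<And>x. x \<in> closure \<Omega> \<Longrightarrow> C z \<le> C x" by blast
  show ?thesis
  proof (rule that)
    show "C z > 0" by (rule C_pos[OF z(1)])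
    show "C z \<le> C x" if "x \<in> \<Omega>" for x using z(2) that closure_subset by blast
  qed
qed

lemma C_nonneg: "x \<in> \<Omega> \<Longrightarrow> 0 \<le> C x"
  using C_pos closure_subset less_imp_le by blast

text \<open>
  The gradient is a separate argument so that the same functional serves classical gradients, weak
  gradients and their limits.
\<close>

definition energy :: "real \<Rightarrow> ('a \<Rightarrow> real) \<Rightarrow> ('a \<Rightarrow> 'a) \<Rightarrow> real" where
  "energy p u g = (LINT x|lebesgue_on \<Omega>. norm (g x) powr p + C x * \<bar>u x\<bar> powr p)"

definition mass :: "real \<Rightarrow> ('a \<Rightarrow> real) \<Rightarrow> real" where
  "mass p u = (LINT x|lebesgue_on \<Omega>. m x * \<bar>u x\<bar> powr p)"

definition test_min :: "real \<Rightarrow> real" where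
  "test_min p = Inf {energy p \<phi> (grad \<phi>) | \<phi>. \<phi> \<in> test_functions \<Omega> \<and> mass p \<phi> = 1}"

lemma weighted_integrable:
  assumes "u \<in> Lp_space p \<Omega>"
  shows "integrable (lebesgue_on \<Omega>) (\<lambda>x. m x * \<bar>u x\<bar> powr p)"
    and "integrable (lebesgue_on \<Omega>) (\<lambda>x. C x * \<bar>u x\<bar> powr p)"
proof -
  obtain W where W: "W > 0" "\<And>x. x \<in> \<Omega> \<Longrightarrow> \<bar>m x\<bar> \<le> W" "\<And>x. x \<in> \<Omega> \<Longrightarrow> \<bar>C x\<bar> \<le> W"
    using weights_bounded by metis
  show "integrable (lebesgue_on \<Omega>) (\<lambda>x. m x * \<bar>u x\<bar> powr p)"
    using Lp_weighted_integrable[OF assms weights_measurable(1) W(2)] by simp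
  show "integrable (lebesgue_on \<Omega>) (\<lambda>x. C x * \<bar>u x\<bar> powr p)"
    using Lp_weighted_integrable[OF assms weights_measurable(2) W(3)] by simp
qed

lemma energy_eq:
  assumes "u \<in> Lp_space p \<Omega>" "g \<in> Lp_space p \<Omega>"
  shows "energy p u g = Lp_power p \<Omega> g + (LINT x|lebesgue_on \<Omega>. C x * \<bar>u x\<bar> powr p)"
  unfolding energy_def Lp_power_def using Lp_spaceD(2)[OF assms(2)] weighted_integrable(2)[OF assms(1)] by simp

lemma C_integral_nonneg: "0 \<le> (LINT x|lebesgue_on \<Omega>. C x * \<bar>u x\<bar> powr p)"
  by (intro integral_nonneg_AE AE_I2) (simp add: C_nonneg)

lemma energy_nonneg: "0 \<le> energy p u g"
  unfolding energy_def by (intro integral_nonneg_AE AE_I2) (simp add: C_nonneg)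

lemma Lp_power_le_energy:
  "u \<in> Lp_space p \<Omega> \<Longrightarrow> g \<in> Lp_space p \<Omega> \<Longrightarrow> Lp_power p \<Omega> g \<le> energy p u g"
  using C_integral_nonneg by (simp add: energy_eq)

lemma test_in_Lp:
  assumes "\<phi> \<in> test_functions \<Omega>" "p > 0"
  shows "\<phi> \<in> Lp_space p \<Omega>" "grad \<phi> \<in> Lp_space p \<Omega>"
  using test_Lp[OF assms(1) domain_measurable(2) assms(2)] by auto

lemma mass_tendsto:
  assumes "p > 0" "u \<in> Lp_space p \<Omega>" "\<And>k. v k \<in> Lp_space p \<Omega>"
    and "(\<lambda>k::nat. Lp_power p \<Omega> (\<lambda>x. v k x - u x)) \<longlonglongrightarrow> 0"
  shows "(\<lambda>k. mass p (v k)) \<longlonglongrightarrow> mass p u"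
proof -
  obtain W where W: "W > 0" "\<And>x. x \<in> \<Omega> \<Longrightarrow> \<bar>m x\<bar> \<le> W"
    using weights_bounded by metis
  show ?thesis
    using Lp_weighted_tendsto[OF assms weights_measurable(1) W(2)] by (simp add: mass_def)
qed

lemma energy_tendsto:
  assumes p: "p > 0" and u: "u \<in> Lp_space p \<Omega>" "\<And>k. v k \<in> Lp_space p \<Omega>"
    and ul: "(\<lambda>k::nat. Lp_power p \<Omega> (\<lambda>x. v k x - u x)) \<longlonglongrightarrow> 0"
    and g: "g \<in> Lp_space p \<Omega>" "\<And>k. h k \<in> Lp_space p \<Omega>"
    and gl: "(\<lambda>k::nat. Lp_power p \<Omega> (\<lambda>x. h k x - g x)) \<longlonglongrightarrow> 0"
  shows "(\<lambda>k. energy p (v k) (h k)) \<longlonglongrightarrow> energy p u g"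
proof -
  obtain W where W: "W > 0" "\<And>x. x \<in> \<Omega> \<Longrightarrow> \<bar>C x\<bar> \<le> W"
    using weights_bounded by metis
  have "(\<lambda>k. LINT x|lebesgue_on \<Omega>. C x * \<bar>v k x\<bar> powr p) \<longlonglongrightarrow> (LINT x|lebesgue_on \<Omega>. C x * \<bar>u x\<bar> powr p)"
    using Lp_weighted_tendsto[OF p u ul weights_measurable(2) W(2)] by simp
  moreover have "(\<lambda>k. Lp_power p \<Omega> (h k)) \<longlonglongrightarrow> Lp_power p \<Omega> g"
    using Lp_weighted_tendsto[OF p g gl, of "\<lambda>_. 1" 1] by (simp add: Lp_power_def)
  ultimately show ?thesis using u g by (simp add: energy_eq tendsto_add)
qed

lemma mass_cmult: "mass p (\<lambda>x. c * u x) = \<bar>c\<bar> powr p * mass p u"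
proof -
  have "mass p (\<lambda>x. c * u x) = (LINT x|lebesgue_on \<Omega>. \<bar>c\<bar> powr p * (m x * \<bar>u x\<bar> powr p))"
    unfolding mass_def by (intro Bochner_Integration.integral_cong) (auto simp: abs_mult powr_mult)
  then show ?thesis by (simp add: mass_def)
qed

text \<open>
  The quotient of energy and mass is thus invariant under scaling; this is how the constraint is
  normalised below.
\<close>

lemma energy_cmult: "energy p (\<lambda>x. c * u x) (\<lambda>x. c *\<^sub>R g x) = \<bar>c\<bar> powr p * energy p u g"
proof -
  have "energy p (\<lambda>x. c * u x) (\<lambda>x. c *\<^sub>R g x) =
      (LINT x|lebesgue_on \<Omega>. \<bar>c\<bar> powr p * (norm (g x) powr p + C x * \<bar>u x\<bar> powr p))"
    unfolding energy_def by (simp add: abs_mult powr_mult distrib_left mult.left_commute)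
  then show ?thesis by (simp add: energy_def)
qed

lemma test_normalise:
  assumes p: "p > 0" and \<phi>: "\<phi> \<in> test_functions \<Omega>" and pos: "mass p \<phi> > 0"
  obtains \<psi> where "\<psi> \<in> test_functions \<Omega>" "mass p \<psi> = 1" "energy p \<psi> (grad \<psi>) = energy p \<phi> (grad \<phi>) / mass p \<phi>"
proof -
  let ?c = "(1 / mass p \<phi>) powr (1 / p)"
  have c: "\<bar>?c\<bar> powr p = 1 / mass p \<phi>" using p pos by (simp add: powr_powr)
  have gr: "grad (\<lambda>x. ?c * \<phi> x) = (\<lambda>x. ?c *\<^sub>R grad \<phi> x)"
    by (rule ext) (rule grad_cmult[OF test_smooth[OF \<phi>]])
  show ?thesis
  proof (rule that)
    show "(\<lambda>x. ?c * \<phi> x) \<in> test_functions \<Omega>" by (rule test_cmult[OF \<phi>])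
    show "mass p (\<lambda>x. ?c * \<phi> x) = 1" unfolding mass_cmult c using pos by simp
    show "energy p (\<lambda>x. ?c * \<phi> x) (grad (\<lambda>x. ?c * \<phi> x)) = energy p \<phi> (grad \<phi>) / mass p \<phi>"
      unfolding gr energy_cmult c by simp
  qed
qed

lemma bdd_below_test: "bdd_below {energy p \<phi> (grad \<phi>) | \<phi>. \<phi> \<in> test_functions \<Omega> \<and> mass p \<phi> = 1}"
  using energy_nonneg by (intro bdd_belowI[of _ 0]) auto

text \<open>
  Test functions compete after normalisation of their mass.
\<close>

lemma test_min_le:
  assumes p: "p > 0" and \<phi>: "\<phi> \<in> test_functions \<Omega>" and pos: "mass p \<phi> > 0"
  shows "test_min p \<le> energy p \<phi> (grad \<phi>) / mass p \<phi>"
proof -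
  obtain \<psi> where "\<psi> \<in> test_functions \<Omega>" "mass p \<psi> = 1" "energy p \<psi> (grad \<psi>) = energy p \<phi> (grad \<phi>) / mass p \<phi>"
    using test_normalise[OF assms] .
  then have "energy p \<phi> (grad \<phi>) / mass p \<phi> \<in> {energy p \<phi> (grad \<phi>) | \<phi>. \<phi> \<in> test_functions \<Omega> \<and> mass p \<phi> = 1}"
    by (metis (mono_tags, lifting) mem_Collect_eq)
  then show ?thesis unfolding test_min_def by (rule cInf_lower[OF _ bdd_below_test])
qed

lemma test_min_greatest:
  assumes p: "p > 0" and ex: "\<exists>\<phi>\<in>test_functions \<Omega>. mass p \<phi> > 0"
    and b: "\<And>\<phi>. \<phi> \<in> test_functions \<Omega> \<Longrightarrow> mass p \<phi> = 1 \<Longrightarrow> b \<le> energy p \<phi> (grad \<phi>)"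
  shows "b \<le> test_min p"
  unfolding test_min_def
proof (rule cInf_greatest)
  obtain \<phi> where "\<phi> \<in> test_functions \<Omega>" "mass p \<phi> > 0" using ex by blast
  from test_normalise[OF p this] obtain \<psi> where "\<psi> \<in> test_functions \<Omega>" "mass p \<psi> = 1" .
  then show "{energy p \<phi> (grad \<phi>) | \<phi>. \<phi> \<in> test_functions \<Omega> \<and> mass p \<phi> = 1} \<noteq> {}" by auto
qed (use b in auto)

text \<open>
  In this homogeneous form the inequality survives limits in which the constraint holds only
  approximately.
\<close>

lemma test_min_mass_le:
  assumes p: "p > 0" and ex: "\<exists>\<phi>\<in>test_functions \<Omega>. mass p \<phi> > 0" and \<phi>: "\<phi> \<in> test_functions \<Omega>"
  shows "test_min p * mass p \<phi> \<le> energy p \<phi> (grad \<phi>)"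
proof (cases "mass p \<phi> > 0")
  case True
  then show ?thesis using test_min_le[OF p \<phi>] by (simp add: pos_le_divide_eq)
next
  case False
  have "0 \<le> test_min p" by (rule test_min_greatest[OF p ex energy_nonneg])
  with False have "test_min p * mass p \<phi> \<le> 0" by (simp add: mult_nonneg_nonpos)
  then show ?thesis using energy_nonneg[of p \<phi> "grad \<phi>"] by linarith
qed

text \<open>
  Energy and mass are continuous along the test functions that approximate \<open>u\<close>.
\<close>

lemma test_min_le_W1p_0:
  assumes p: "p > 0" and ex: "\<exists>\<phi>\<in>test_functions \<Omega>. mass p \<phi> > 0"
    and u: "u \<in> W1p_0 p \<Omega>" and 1: "mass p u = 1"
  shows "test_min p \<le> energy p u (weak_gradient \<Omega> u)"
proof -
  obtain g \<phi> where g: "has_weak_gradient \<Omega> u g" "u \<in> Lp_space p \<Omega>" "g \<in> Lp_space p \<Omega>"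
    and \<phi>': "\<forall>k::nat. \<phi> k \<in> test_functions \<Omega>"
    and lim: "(\<lambda>k. Lp_power p \<Omega> (\<lambda>x. \<phi> k x - u x)) \<longlonglongrightarrow> 0"
      "(\<lambda>k. Lp_power p \<Omega> (\<lambda>x. grad (\<phi> k) x - g x)) \<longlonglongrightarrow> 0"
    using W1p_0_approx[OF open_domain p u] by (elim exE conjE) (rule that; assumption)
  note \<phi> = \<phi>'[rule_format]
  have "test_min p * mass p u \<le> energy p u g"
  proof (rule LIMSEQ_le)
    show "(\<lambda>k. energy p (\<phi> k) (grad (\<phi> k))) \<longlonglongrightarrow> energy p u g"
      by (rule energy_tendsto[OF p g(2) _ lim(1) g(3) _ lim(2)]) (use test_in_Lp[OF \<phi> p] in auto)
    have "(\<lambda>k. mass p (\<phi> k)) \<longlonglongrightarrow> mass p u"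
      by (rule mass_tendsto[OF p g(2) _ lim(1)]) (use test_in_Lp[OF \<phi> p] in auto)
    then show "(\<lambda>k. test_min p * mass p (\<phi> k)) \<longlonglongrightarrow> test_min p * mass p u"
      by (rule tendsto_mult[OF tendsto_const])
    show "\<exists>N. \<forall>k\<ge>N. test_min p * mass p (\<phi> k) \<le> energy p (\<phi> k) (grad (\<phi> k))"
      using test_min_mass_le[OF p ex \<phi>] by blast
  qed
  moreover have "energy p u (weak_gradient \<Omega> u) = energy p u g"
    unfolding energy_def
    by (rule weak_gradient_integral(1)[OF open_domain g(1,3) borel_measurable_integrable[OF weighted_integrable(2)[OF g(2)]]])
  ultimately show ?thesis using 1 by simp
qed

text \<open>
  Clarkson's inequality for the gradients and convexity for the term with \<open>C\<close>; the gain on the left is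
  what forces minimising sequences to converge.
\<close>

lemma Clarkson_energy:
  assumes p: "p \<ge> 2" and \<phi>: "\<phi> \<in> test_functions \<Omega>" and \<psi>: "\<psi> \<in> test_functions \<Omega>"
  defines "\<theta> \<equiv> \<lambda>x. (1 / 2) * (\<phi> x + \<psi> x)"
  shows "energy p \<theta> (grad \<theta>) + Lp_power p \<Omega> (\<lambda>x. (1 / 2) *\<^sub>R (grad \<phi> x - grad \<psi> x))
    \<le> (energy p \<phi> (grad \<phi>) + energy p \<psi> (grad \<psi>)) / 2"
proof -
  have p0: "p > 0" using p by simp
  have \<theta>: "\<theta> \<in> test_functions \<Omega>" unfolding \<theta>_def by (intro test_cmult test_add \<phi> \<psi>)
  have gr: "grad \<theta> x = (1 / 2) *\<^sub>R (grad \<phi> x + grad \<psi> x)" for x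
    unfolding \<theta>_def using grad_cmult[OF smooth_add] grad_add test_smooth[OF \<phi>] test_smooth[OF \<psi>] by metis
  have d: "(\<lambda>x. (1 / 2) *\<^sub>R (grad \<phi> x - grad \<psi> x)) \<in> Lp_space p \<Omega>"
    using p0 by (intro Lp_space_cmult Lp_space_diff test_in_Lp \<phi> \<psi>) auto
  note L = test_in_Lp[OF \<phi> p0] test_in_Lp[OF \<psi> p0] test_in_Lp[OF \<theta> p0]
  note I = L[THEN Lp_spaceD(2)] d[THEN Lp_spaceD(2)]
  have "Lp_power p \<Omega> (grad \<theta>) + Lp_power p \<Omega> (\<lambda>x. (1 / 2) *\<^sub>R (grad \<phi> x - grad \<psi> x))
      = (LINT x|lebesgue_on \<Omega>. norm (grad \<theta> x) powr p + norm ((1 / 2) *\<^sub>R (grad \<phi> x - grad \<psi> x)) powr p)"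
    unfolding Lp_power_def by (rule Bochner_Integration.integral_add[symmetric, OF I(6,7)])
  also have "\<dots> \<le> (LINT x|lebesgue_on \<Omega>. (norm (grad \<phi> x) powr p + norm (grad \<psi> x) powr p) / 2)"
  proof (rule integral_mono)
    show "integrable (lebesgue_on \<Omega>) (\<lambda>x. norm (grad \<theta> x) powr p + norm ((1 / 2) *\<^sub>R (grad \<phi> x - grad \<psi> x)) powr p)"
      by (rule Bochner_Integration.integrable_add[OF I(6,7)])
    show "integrable (lebesgue_on \<Omega>) (\<lambda>x. (norm (grad \<phi> x) powr p + norm (grad \<psi> x) powr p) / 2)"
      using I(2,4) by simp
    show "norm (grad \<theta> x) powr p + norm ((1 / 2) *\<^sub>R (grad \<phi> x - grad \<psi> x)) powr p
        \<le> (norm (grad \<phi> x) powr p + norm (grad \<psi> x) powr p) / 2" for x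
      unfolding gr by (rule Clarkson_inequality[OF p])
  qed
  also have "\<dots> = (Lp_power p \<Omega> (grad \<phi>) + Lp_power p \<Omega> (grad \<psi>)) / 2"
    unfolding Lp_power_def using I(2,4) by simp
  finally have 1: "Lp_power p \<Omega> (grad \<theta>) + Lp_power p \<Omega> (\<lambda>x. (1 / 2) *\<^sub>R (grad \<phi> x - grad \<psi> x))
    \<le> (Lp_power p \<Omega> (grad \<phi>) + Lp_power p \<Omega> (grad \<psi>)) / 2" .
  note J = weighted_integrable(2)[OF L(1)] weighted_integrable(2)[OF L(3)] weighted_integrable(2)[OF L(5)]
  have "(LINT x|lebesgue_on \<Omega>. C x * \<bar>\<theta> x\<bar> powr p) \<le> (LINT x|lebesgue_on \<Omega>. (C x * \<bar>\<phi> x\<bar> powr p + C x * \<bar>\<psi> x\<bar> powr p) / 2)"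
  proof (rule integral_mono[OF J(3)])
    show "integrable (lebesgue_on \<Omega>) (\<lambda>x. (C x * \<bar>\<phi> x\<bar> powr p + C x * \<bar>\<psi> x\<bar> powr p) / 2)"
      using J(1,2) by simp
    fix x assume "x \<in> space (lebesgue_on \<Omega>)"
    then have C: "0 \<le> C x" by (simp add: C_nonneg)
    have "\<bar>\<theta> x\<bar> powr p \<le> ((\<bar>\<phi> x\<bar> + \<bar>\<psi> x\<bar>) / 2) powr p"
      unfolding \<theta>_def using p by (intro powr_mono2) (auto simp: abs_mult)
    also have "\<dots> \<le> (\<bar>\<phi> x\<bar> powr p + \<bar>\<psi> x\<bar> powr p) / 2"
      using p by (intro powr_midpoint_le) auto
    finally have "C x * \<bar>\<theta> x\<bar> powr p \<le> C x * ((\<bar>\<phi> x\<bar> powr p + \<bar>\<psi> x\<bar> powr p) / 2)"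
      using C by (rule mult_left_mono)
    then show "C x * \<bar>\<theta> x\<bar> powr p \<le> (C x * \<bar>\<phi> x\<bar> powr p + C x * \<bar>\<psi> x\<bar> powr p) / 2"
      by (simp add: distrib_left)
  qed
  also have "\<dots> = ((LINT x|lebesgue_on \<Omega>. C x * \<bar>\<phi> x\<bar> powr p) + (LINT x|lebesgue_on \<Omega>. C x * \<bar>\<psi> x\<bar> powr p)) / 2"
    using J(1,2) by simp
  finally show ?thesis using 1 by (simp add: energy_eq L)
qed

end

section \<open>Existence of a minimiser\<close>

lemma morrey_const_pos: "p > n \<Longrightarrow> n > 0 \<Longrightarrow> \<rho> > 0 \<Longrightarrow> morrey_const n p \<rho> > 0"
  by (simp add: morrey_const_def)

text \<open>
  Taking \<open>\<rho>\<close> as large as the distance of two points turns Morrey's inequality into a modulus of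
  continuity.
\<close>

lemma morrey_modulus_tendsto_0:
  assumes "p > n" "n > 0"
  shows "((\<lambda>\<rho>. (\<rho> + 2 * \<rho> * n) * morrey_const n p \<rho> * L) \<longlongrightarrow> 0) (at_right 0)"
proof (rule Lim_transform_eventually)
  have "((\<lambda>\<rho>::real. \<rho> powr (1 - n / p)) \<longlongrightarrow> 0 powr (1 - n / p)) (at_right 0)"
    using assms by (intro tendsto_powr' tendsto_ident_at tendsto_const) (auto simp: eventually_at_filter)
  then have "((\<lambda>\<rho>. (1 + 2 * n) / (1 - n / p) * L * \<rho> powr (1 - n / p)) \<longlongrightarrow> (1 + 2 * n) / (1 - n / p) * L * 0) (at_right 0)"
    using assms by (intro tendsto_mult tendsto_const) simp
  then show "((\<lambda>\<rho>. (1 + 2 * n) / (1 - n / p) * L * \<rho> powr (1 - n / p)) \<longlongrightarrow> 0) (at_right 0)" by simp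
  have "(1 + 2 * n) / (1 - n / p) * L * \<rho> powr (1 - n / p) = (\<rho> + 2 * \<rho> * n) * morrey_const n p \<rho> * L"
    if "\<rho> > 0" for \<rho>
  proof -
    have "\<rho> powr (1 - n / p) = \<rho> * \<rho> powr (- n / p)"
      using that powr_add[of \<rho> 1 "- n / p"] by simp
    then show ?thesis by (simp add: morrey_const_def algebra_simps)
  qed
  then show "\<forall>\<^sub>F \<rho> in at_right 0. (1 + 2 * n) / (1 - n / p) * L * \<rho> powr (1 - n / p) = (\<rho> + 2 * \<rho> * n) * morrey_const n p \<rho> * L"
    by (simp add: eventually_at_filter)
qed

lemma uniform_imp_Lp_tendsto:
  fixes F :: "nat \<Rightarrow> 'a::euclidean_space \<Rightarrow> 'b::euclidean_space"
  assumes U: "U \<in> lmeasurable" and p: "p > 0"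
    and m: "\<And>k. F k \<in> borel_measurable (lebesgue_on U)" "f \<in> borel_measurable (lebesgue_on U)"
    and u: "\<And>e. e > 0 \<Longrightarrow> \<exists>N. \<forall>k\<ge>N. \<forall>x\<in>U. norm (F k x - f x) \<le> e"
  shows "(\<lambda>k. Lp_power p U (\<lambda>x. F k x - f x)) \<longlonglongrightarrow> 0"
proof (rule LIMSEQ_I)
  fix e :: real assume e: "e > 0"
  let ?V = "measure (lebesgue_on U) U"
  define \<eta> where "\<eta> = (e / (?V + 1)) powr (1 / p)"
  have V: "?V + 1 > 0" by (simp add: add_nonneg_pos)
  have \<eta>: "\<eta> > 0" "\<eta> powr p = e / (?V + 1)" unfolding \<eta>_def using e V p by (auto simp: powr_powr)
  obtain N where N: "\<And>k x. k \<ge> N \<Longrightarrow> x \<in> U \<Longrightarrow> norm (F k x - f x) \<le> \<eta>" using u[OF \<eta>(1)] by blast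
  have "norm (Lp_power p U (\<lambda>x. F k x - f x) - 0) < e" if "k \<ge> N" for k
  proof -
    have "Lp_power p U (\<lambda>x. F k x - f x) \<le> ?V * \<eta> powr p"
      using p by (intro Lp_space_bounded(2)[OF U] borel_measurable_diff m N[OF that]) auto
    also have "\<dots> < e" unfolding \<eta>(2) using e V by (simp add: field_simps)
    finally show ?thesis by (simp add: Lp_power_nonneg)
  qed
  then show "\<exists>N. \<forall>k\<ge>N. norm (Lp_power p U (\<lambda>x. F k x - f x) - 0) < e" by blast
qed

lemma test_bounded:
  assumes "\<theta> \<in> test_functions U"
  obtains D where "\<And>x. norm (\<theta> x) \<le> D" "\<And>x. norm (grad \<theta> x) \<le> D"
proof -
  obtain K where K: "compact K" "\<And>x. x \<notin> K \<Longrightarrow> \<theta> x = 0" "\<And>x. x \<notin> K \<Longrightarrow> grad \<theta> x = 0"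
    using test_support[OF assms] by metis
  have "bounded (\<theta> ` K)" "bounded (grad \<theta> ` K)"
    using K(1) test_smooth[OF assms]
    by (auto intro!: compact_imp_bounded compact_continuous_image smooth_continuous grad_continuous)
  then obtain a b where ab: "a > 0" "\<And>x. x \<in> K \<Longrightarrow> norm (\<theta> x) \<le> a" "b > 0" "\<And>x. x \<in> K \<Longrightarrow> norm (grad \<theta> x) \<le> b"
    by (auto simp: bounded_pos)
  show ?thesis
  proof (rule that[of "a + b"])
    fix x
    show "norm (\<theta> x) \<le> a + b" using ab(1,3) ab(2)[of x] K(2)[of x] by (cases "x \<in> K") auto
    show "norm (grad \<theta> x) \<le> a + b" using ab(1,3) ab(4)[of x] K(3)[of x] by (cases "x \<in> K") auto
  qed
qed

text \<open>
  Both sides of the integration by parts formula are continuous under \<open>L\<^sup>p\<close> convergence, as the test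
  function and its gradient are bounded.
\<close>

lemma weak_gradient_limit:
  fixes \<psi> :: "nat \<Rightarrow> 'a::euclidean_space \<Rightarrow> real"
  assumes U: "U \<in> lmeasurable" and p: "p \<ge> 1" and \<psi>: "\<And>k. \<psi> k \<in> test_functions U"
    and u: "u \<in> Lp_space p U" and g: "g \<in> Lp_space p U"
    and ul: "(\<lambda>k. Lp_power p U (\<lambda>x. \<psi> k x - u x)) \<longlonglongrightarrow> 0"
    and gl: "(\<lambda>k. Lp_power p U (\<lambda>x. grad (\<psi> k) x - g x)) \<longlonglongrightarrow> 0"
  shows "has_weak_gradient U u g"
  unfolding has_weak_gradient_def
proof (intro conjI ballI)
  have Ul: "U \<in> sets lebesgue" using U by (rule fmeasurableD)
  show "locally_integrable U u" "locally_integrable U g"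
    using Lp_space_integrable[OF p u U] Lp_space_integrable[OF p g U] Ul
    by (auto intro: integrable_locally_integrable)
  fix \<theta> i assume \<theta>: "\<theta> \<in> test_functions U" and i: "i \<in> (Basis :: 'a set)"
  have sm: "smooth \<theta>" by (rule test_smooth[OF \<theta>])
  obtain D where D: "\<And>x. norm (\<theta> x) \<le> D" "\<And>x. norm (grad \<theta> x) \<le> D"
    using test_bounded[OF \<theta>] by metis
  have p0: "p > 0" using p by simp
  note L = test_Lp[OF \<psi> Ul p0]
  have "(\<lambda>k. LINT x|lebesgue_on U. \<psi> k x \<bullet> (grad \<theta> x \<bullet> i)) \<longlonglongrightarrow> (LINT x|lebesgue_on U. u x \<bullet> (grad \<theta> x \<bullet> i))"
  proof (rule Lp_tendsto_pairing[OF U p L(1) u ul])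
    show "(\<lambda>x. grad \<theta> x \<bullet> i) \<in> borel_measurable (lebesgue_on U)"
      by (intro continuous_imp_measurable_on_sets_lebesgue[OF _ Ul] continuous_on_inner grad_continuous[OF sm] continuous_on_const)
    show "norm (grad \<theta> x \<bullet> i) \<le> D" for x
      using order_trans[OF Basis_le_norm[OF i] D(2)] by simp
  qed
  moreover have "(\<lambda>k. LINT x|lebesgue_on U. grad (\<psi> k) x \<bullet> (\<theta> x *\<^sub>R i)) \<longlonglongrightarrow> (LINT x|lebesgue_on U. g x \<bullet> (\<theta> x *\<^sub>R i))"
  proof (rule Lp_tendsto_pairing[OF U p L(2) g gl])
    show "(\<lambda>x. \<theta> x *\<^sub>R i) \<in> borel_measurable (lebesgue_on U)"
      by (intro continuous_imp_measurable_on_sets_lebesgue[OF _ Ul] continuous_on_scaleR smooth_continuous[OF sm] continuous_on_const)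
    show "norm (\<theta> x *\<^sub>R i) \<le> D" for x using D(1)[of x] i by simp
  qed
  moreover have "(LINT x|lebesgue_on U. \<psi> k x \<bullet> (grad \<theta> x \<bullet> i)) = - (LINT x|lebesgue_on U. grad (\<psi> k) x \<bullet> (\<theta> x *\<^sub>R i))" for k
    using test_has_weak_gradient[OF \<psi> Ul, of k] \<theta> i
    by (simp add: has_weak_gradient_def grad_inner_Basis[OF i] mult.commute)
  ultimately have "(\<lambda>k. - (LINT x|lebesgue_on U. grad (\<psi> k) x \<bullet> (\<theta> x *\<^sub>R i))) \<longlonglongrightarrow> (LINT x|lebesgue_on U. u x \<bullet> (grad \<theta> x \<bullet> i))"
    and "(\<lambda>k. - (LINT x|lebesgue_on U. grad (\<psi> k) x \<bullet> (\<theta> x *\<^sub>R i))) \<longlonglongrightarrow> - (LINT x|lebesgue_on U. g x \<bullet> (\<theta> x *\<^sub>R i))"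
    by (simp_all only: tendsto_minus)
  from LIMSEQ_unique[OF this]
  show "(LINT x|lebesgue_on U. u x * frechet_derivative \<theta> (at x) i) = - (LINT x|lebesgue_on U. (g x \<bullet> i) * \<theta> x)"
    by (simp add: grad_inner_Basis[OF i] mult.commute)
qed

context eigenvalue_problem
begin

text \<open>
  Morrey's inequality between \<open>x\<close> and a point outside \<open>\<Omega>\<close>, where test functions vanish.
\<close>

lemma test_uniform_bound:
  assumes p: "p > real DIM('a)"
  obtains D where "\<And>\<phi> x. \<phi> \<in> test_functions \<Omega> \<Longrightarrow> Lp_power p \<Omega> (grad \<phi>) \<le> L \<Longrightarrow> x \<in> closure \<Omega> \<Longrightarrow> norm (\<phi> x) \<le> D"
proof -
  let ?n = "real DIM('a)"
  have p0: "p > 0" using p by (rule le_less_trans[rotated]) simp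
  have "\<Omega> \<noteq> UNIV" using bounded_domain not_bounded_UNIV by auto
  then obtain z where z: "z \<notin> \<Omega>" by auto
  obtain B where B: "\<And>x. x \<in> closure \<Omega> \<Longrightarrow> norm x \<le> B"
    using compact_imp_bounded[OF compact_closure_domain] by (auto simp: bounded_iff)
  show ?thesis
  proof (rule that[of "(B + norm z + 2 * 1 * ?n) * morrey_const ?n p 1 * L powr (1 / p)"])
    fix \<phi> x assume \<phi>: "\<phi> \<in> test_functions \<Omega>" and L: "Lp_power p \<Omega> (grad \<phi>) \<le> L" and x: "x \<in> closure \<Omega>"
    have "\<phi> z = 0" using \<phi> z by (auto simp: test_functions_iff)
    then have "norm (\<phi> x) = \<bar>\<phi> x - \<phi> z\<bar>" by simp
    also have "\<dots> \<le> (norm (x - z) + 2 * 1 * ?n) * morrey_const ?n p 1 * Lp_power p \<Omega> (grad \<phi>) powr (1 / p)"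
      by (rule test_morrey_Lp[OF \<phi> domain_measurable(2) p]) simp
    also have "\<dots> \<le> (B + norm z + 2 * 1 * ?n) * morrey_const ?n p 1 * L powr (1 / p)"
    proof (intro mult_mono)
      have "norm (x - z) \<le> norm x + norm z" by (rule norm_triangle_ineq4)
      then show "norm (x - z) + 2 * 1 * ?n \<le> B + norm z + 2 * 1 * ?n" using B[OF x] by linarith
      show "0 \<le> B + norm z + 2 * 1 * ?n" using order_trans[OF norm_ge_zero B[OF x]] by simp
      show "0 \<le> morrey_const ?n p 1" using morrey_const_pos[OF p] by (simp add: less_imp_le)
      show "Lp_power p \<Omega> (grad \<phi>) powr (1 / p) \<le> L powr (1 / p)"
        using L p0 Lp_power_nonneg by (intro powr_mono2) auto
      then show "0 \<le> (B + norm z + 2 * 1 * ?n) * morrey_const ?n p 1"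
        using \<open>0 \<le> B + norm z + 2 * 1 * ?n\<close> \<open>0 \<le> morrey_const ?n p 1\<close> by simp
    qed auto
    finally show "norm (\<phi> x) \<le> (B + norm z + 2 * 1 * ?n) * morrey_const ?n p 1 * L powr (1 / p)" .
  qed
qed

lemma test_equicontinuous:
  assumes p: "p > real DIM('a)" and e: "e > 0"
  obtains d where "d > 0" "\<And>\<phi> x y. \<phi> \<in> test_functions \<Omega> \<Longrightarrow> Lp_power p \<Omega> (grad \<phi>) \<le> L \<Longrightarrow> norm (x - y) < d \<Longrightarrow> norm (\<phi> x - \<phi> y) < e"
proof -
  let ?n = "real DIM('a)"
  have p0: "p > 0" using p by (rule le_less_trans[rotated]) simp
  have n0: "?n > 0" by simp
  have "eventually (\<lambda>\<rho>. (\<rho> + 2 * \<rho> * ?n) * morrey_const ?n p \<rho> * L powr (1 / p) < e \<and> 0 < \<rho>) (at_right 0)"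
    using order_tendstoD(2)[OF morrey_modulus_tendsto_0[OF p n0, of "L powr (1 / p)"] e] eventually_at_right_less
    by (rule eventually_conj)
  then obtain \<rho> where \<rho>: "(\<rho> + 2 * \<rho> * ?n) * morrey_const ?n p \<rho> * L powr (1 / p) < e" "\<rho> > 0"
    using eventually_happens'[OF trivial_limit_at_right_real] by blast
  show ?thesis
  proof (rule that[OF \<rho>(2)])
    fix \<phi> :: "'a \<Rightarrow> real" and x y :: 'a assume \<phi>: "\<phi> \<in> test_functions \<Omega>" and L: "Lp_power p \<Omega> (grad \<phi>) \<le> L" and xy: "norm (x - y) < \<rho>"
    have "norm (\<phi> x - \<phi> y) \<le> (norm (x - y) + 2 * \<rho> * ?n) * morrey_const ?n p \<rho> * Lp_power p \<Omega> (grad \<phi>) powr (1 / p)"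
      using test_morrey_Lp[OF \<phi> domain_measurable(2) p \<rho>(2)] by simp
    also have "\<dots> \<le> (\<rho> + 2 * \<rho> * ?n) * morrey_const ?n p \<rho> * L powr (1 / p)"
    proof (intro mult_mono)
      show "norm (x - y) + 2 * \<rho> * ?n \<le> \<rho> + 2 * \<rho> * ?n" using xy by simp
      show "0 \<le> morrey_const ?n p \<rho>" using morrey_const_pos[OF p n0 \<rho>(2)] by simp
      show "Lp_power p \<Omega> (grad \<phi>) powr (1 / p) \<le> L powr (1 / p)"
        using L p0 Lp_power_nonneg by (intro powr_mono2) auto
      show "0 \<le> (\<rho> + 2 * \<rho> * ?n) * morrey_const ?n p \<rho>"
        using morrey_const_pos[OF p n0 \<rho>(2)] \<rho>(2) by (intro mult_nonneg_nonneg) auto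
      show "0 \<le> \<rho> + 2 * \<rho> * ?n" using \<rho>(2) by simp
    qed auto
    also note \<rho>(1)
    finally show "norm (\<phi> x - \<phi> y) < e" .
  qed
qed

text \<open>
  Uniform closeness, rather than convergence of a sequence, is needed for midpoints of two members of
  a sequence.
\<close>

lemma mass_uniformly_continuous:
  assumes p: "p > 0" and u: "u \<in> Lp_space p \<Omega>" and e: "e > 0"
  obtains \<eta> where "\<eta> > 0" "\<And>v. v \<in> Lp_space p \<Omega> \<Longrightarrow> (\<And>x. x \<in> \<Omega> \<Longrightarrow> norm (v x - u x) \<le> \<eta>) \<Longrightarrow> \<bar>mass p v - mass p u\<bar> < e"
proof -
  have "\<exists>\<eta>>0. \<forall>v. v \<in> Lp_space p \<Omega> \<longrightarrow> (\<forall>x\<in>\<Omega>. norm (v x - u x) \<le> \<eta>) \<longrightarrow> \<bar>mass p v - mass p u\<bar> < e"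
  proof (rule ccontr)
    assume neg: "\<not> ?thesis"
    have "\<exists>v. v \<in> Lp_space p \<Omega> \<and> (\<forall>x\<in>\<Omega>. norm (v x - u x) \<le> inverse (real (Suc k))) \<and> \<not> \<bar>mass p v - mass p u\<bar> < e" for k
    proof -
      have "inverse (real (Suc k)) > 0" by simp
      with neg show ?thesis by blast
    qed
    then obtain v where v: "\<And>k. v k \<in> Lp_space p \<Omega>" "\<And>k x. x \<in> \<Omega> \<Longrightarrow> norm (v k x - u x) \<le> inverse (real (Suc k))"
      "\<And>k. \<not> \<bar>mass p (v k) - mass p u\<bar> < e" by metis
    have "(\<lambda>k. Lp_power p \<Omega> (\<lambda>x. v k x - u x)) \<longlonglongrightarrow> 0"
    proof (rule uniform_imp_Lp_tendsto[OF domain_measurable(1) p Lp_spaceD(1)[OF v(1)] Lp_spaceD(1)[OF u]])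
      fix d :: real assume "d > 0"
      then obtain N where N: "inverse (real (Suc N)) < d" using reals_Archimedean by blast
      have "norm (v k x - u x) \<le> d" if "k \<ge> N" "x \<in> \<Omega>" for k x
      proof -
        have "inverse (real (Suc k)) \<le> inverse (real (Suc N))" using that(1) by (intro le_imp_inverse_le) auto
        then show ?thesis using v(2)[OF that(2), of k] N by linarith
      qed
      then show "\<exists>N. \<forall>k\<ge>N. \<forall>x\<in>\<Omega>. norm (v k x - u x) \<le> d" by blast
    qed
    from mass_tendsto[OF p u v(1) this] have "eventually (\<lambda>k. dist (mass p (v k)) (mass p u) < e) sequentially"
      using e by (rule tendstoD)
    then obtain k where "dist (mass p (v k)) (mass p u) < e" using eventually_happens'[OF sequentially_bot] by blast
    then show False using v(3)[of k] by (simp add: dist_real_def)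
  qed
  then obtain \<eta> where "\<eta> > 0" and \<eta>: "\<forall>v. v \<in> Lp_space p \<Omega> \<longrightarrow> (\<forall>x\<in>\<Omega>. norm (v x - u x) \<le> \<eta>) \<longrightarrow> \<bar>mass p v - mass p u\<bar> < e"
    by blast
  show ?thesis using that[OF \<open>\<eta> > 0\<close>] \<eta> by simp
qed

text \<open>
  The direct method: compactness for the functions comes from Morrey's inequality and the
  Arzela-Ascoli theorem, strong convergence of the gradients from \<open>Clarkson_energy\<close>.
\<close>

lemma minimiser_exists:
  assumes p: "p > real DIM('a)" "p \<ge> 2" and ex: "\<exists>\<phi>\<in>test_functions \<Omega>. mass p \<phi> > 0"
  shows "\<exists>u\<in>W1p_0 p \<Omega>. mass p u = 1 \<and> energy p u (weak_gradient \<Omega> u) = test_min p"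
proof -
  have p0: "p > 0" and p1: "p \<ge> 1" using p(2) by auto
  let ?\<mu> = "test_min p"
  have \<mu>0: "?\<mu> \<ge> 0" by (rule test_min_greatest[OF p0 ex energy_nonneg])
  have "\<exists>\<phi>. \<phi> \<in> test_functions \<Omega> \<and> mass p \<phi> = 1 \<and> energy p \<phi> (grad \<phi>) \<le> ?\<mu> + inverse (real (Suc k))" for k
  proof (rule ccontr)
    assume "\<not> ?thesis"
    then have "?\<mu> + inverse (real (Suc k)) \<le> ?\<mu>"
      by (intro test_min_greatest[OF p0 ex]) (meson linear)
    then show False by simp
  qed
  then obtain \<phi> where \<phi>: "\<And>k. \<phi> k \<in> test_functions \<Omega>" "\<And>k. mass p (\<phi> k) = 1"
    "\<And>k. energy p (\<phi> k) (grad (\<phi> k)) \<le> ?\<mu> + inverse (real (Suc k))" by metis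
  have L: "Lp_power p \<Omega> (grad (\<phi> k)) \<le> ?\<mu> + 1" for k
  proof -
    have "inverse (real (Suc k)) \<le> 1" by (simp add: inverse_le_1_iff)
    then show ?thesis
      using Lp_power_le_energy[OF test_in_Lp[OF \<phi>(1)[of k] p0]] \<phi>(3)[of k] by linarith
  qed
  obtain D where D: "\<And>\<phi> x. \<phi> \<in> test_functions \<Omega> \<Longrightarrow> Lp_power p \<Omega> (grad \<phi>) \<le> ?\<mu> + 1 \<Longrightarrow> x \<in> closure \<Omega> \<Longrightarrow> norm (\<phi> x) \<le> D"
    by (rule test_uniform_bound[OF p(1), of "?\<mu> + 1"]) (rule that, blast)
  have "\<exists>u r. continuous_on (closure \<Omega>) u \<and> strict_mono (r :: nat \<Rightarrow> nat) \<and>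
    (\<forall>e>0. \<exists>N. \<forall>n x. n \<ge> N \<and> x \<in> closure \<Omega> \<longrightarrow> norm (\<phi> (r n) x - u x) < e)"
  proof (rule Arzela_Ascoli[OF compact_closure_domain, of \<phi> D])
    show "norm (\<phi> n x) \<le> D" if "x \<in> closure \<Omega>" for n x by (rule D[OF \<phi>(1) L that])
    fix x and e :: real assume "0 < e"
    then obtain d where d: "d > 0" "\<And>\<phi> x y. \<phi> \<in> test_functions \<Omega> \<Longrightarrow> Lp_power p \<Omega> (grad \<phi>) \<le> ?\<mu> + 1 \<Longrightarrow> norm (x - y) < d \<Longrightarrow> norm (\<phi> x - \<phi> y) < e"
      using test_equicontinuous[OF p(1)] by metis
    show "\<exists>d>0. \<forall>n y. y \<in> closure \<Omega> \<and> norm (x - y) < d \<longrightarrow> norm (\<phi> n x - \<phi> n y) < e"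
      using d(1) d(2)[OF \<phi>(1) L] by blast
  next
    fix g and k :: "nat \<Rightarrow> nat"
    assume "continuous_on (closure \<Omega>) g" "strict_mono k"
      and "\<And>e. 0 < e \<Longrightarrow> \<exists>N. \<forall>n x. n \<ge> N \<and> x \<in> closure \<Omega> \<longrightarrow> norm (\<phi> (k n) x - g x) < e"
    then show ?thesis by (intro exI[of _ g] exI[of _ k] conjI allI impI)
  qed
  then obtain u r where u: "continuous_on (closure \<Omega>) u" and r: "strict_mono (r :: nat \<Rightarrow> nat)"
    and unif: "\<And>e. 0 < e \<Longrightarrow> \<exists>N. \<forall>n x. n \<ge> N \<and> x \<in> closure \<Omega> \<longrightarrow> norm (\<phi> (r n) x - u x) < e"
    by (elim exE conjE) (rule that, assumption+, blast)
  define \<psi> where "\<psi> k = \<phi> (r k)" for k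
  have \<psi>: "\<psi> k \<in> test_functions \<Omega>" "mass p (\<psi> k) = 1" for k using \<phi> by (auto simp: \<psi>_def)
  have E\<psi>: "energy p (\<psi> k) (grad (\<psi> k)) \<le> ?\<mu> + inverse (real (Suc k))" for k
  proof -
    have "inverse (real (Suc (r k))) \<le> inverse (real (Suc k))"
      using seq_suble[OF r, of k] by (intro le_imp_inverse_le) auto
    then show ?thesis using \<phi>(3)[of "r k"] unfolding \<psi>_def by linarith
  qed
  have unif\<psi>: "\<exists>N. \<forall>k\<ge>N. \<forall>x\<in>\<Omega>. norm (\<psi> k x - u x) \<le> e" if e: "e > 0" for e
  proof -
    obtain N where "\<forall>n x. n \<ge> N \<and> x \<in> closure \<Omega> \<longrightarrow> norm (\<phi> (r n) x - u x) < e" using unif[OF e] by blast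
    then have "\<forall>k\<ge>N. \<forall>x\<in>\<Omega>. norm (\<psi> k x - u x) \<le> e" unfolding \<psi>_def
      using closure_subset[of \<Omega>] less_imp_le by blast
    then show ?thesis by blast
  qed
  have um: "u \<in> borel_measurable (lebesgue_on \<Omega>)"
    using continuous_on_subset[OF u closure_subset] domain_measurable(2) by (rule continuous_imp_measurable_on_sets_lebesgue)
  have "bounded (u ` closure \<Omega>)" using u compact_closure_domain by (intro compact_imp_bounded compact_continuous_image)
  then obtain B where "\<And>x. x \<in> closure \<Omega> \<Longrightarrow> norm (u x) \<le> B" by (auto simp: bounded_iff)
  then have uL: "u \<in> Lp_space p \<Omega>"
    using closure_subset[of \<Omega>] p0 by (intro Lp_space_bounded(1)[OF domain_measurable(1) _ um]) auto
  note \<psi>L = test_in_Lp[OF \<psi>(1) p0]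
  have ul: "(\<lambda>k. Lp_power p \<Omega> (\<lambda>x. \<psi> k x - u x)) \<longlonglongrightarrow> 0"
    by (rule uniform_imp_Lp_tendsto[OF domain_measurable(1) p0 Lp_spaceD(1)[OF \<psi>L(1)] um unif\<psi>])
  have mu: "mass p u = 1"
    using mass_tendsto[OF p0 uL \<psi>L(1) ul] unfolding \<psi>(2) by (simp add: LIMSEQ_const_iff)
  have cauchy: "\<exists>N. \<forall>k\<ge>N. \<forall>l\<ge>N. Lp_power p \<Omega> (\<lambda>x. grad (\<psi> k) x - grad (\<psi> l) x) \<le> e" if e: "e > 0" for e
  proof -
    \<comment> \<open>Energies within \<open>\<delta>\<close> of the infimum and masses within \<open>\<delta>\<close> of 1 leave a defect \<open>\<delta> * (1 + \<mu>)\<close>,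
      where \<open>\<mu>\<close> is the infimum; undoing the factor 1/2 in Clarkson's inequality costs \<open>2 powr p\<close>.\<close>
    define \<delta> where "\<delta> = e / (2 powr p * (1 + ?\<mu>))"
    have \<delta>: "\<delta> > 0" "2 powr p * (\<delta> * (1 + ?\<mu>)) = e" unfolding \<delta>_def using e \<mu>0 by auto
    obtain \<eta> where \<eta>: "\<eta> > 0" "\<And>v. v \<in> Lp_space p \<Omega> \<Longrightarrow> (\<And>x. x \<in> \<Omega> \<Longrightarrow> norm (v x - u x) \<le> \<eta>) \<Longrightarrow> \<bar>mass p v - mass p u\<bar> < \<delta>"
      by (rule mass_uniformly_continuous[OF p0 uL \<delta>(1)]) (rule that, assumption, blast)
    obtain N1 where N1: "\<forall>k\<ge>N1. \<forall>x\<in>\<Omega>. norm (\<psi> k x - u x) \<le> \<eta>" using unif\<psi>[OF \<eta>(1)] by blast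
    obtain N2 where N2: "inverse (real (Suc N2)) < \<delta>" using reals_Archimedean[OF \<delta>(1)] by blast
    have "Lp_power p \<Omega> (\<lambda>x. grad (\<psi> k) x - grad (\<psi> l) x) \<le> e" if k: "k \<ge> max N1 N2" and l: "l \<ge> max N1 N2" for k l
    proof -
      define \<theta> where "\<theta> x = (1 / 2) * (\<psi> k x + \<psi> l x)" for x
      have \<theta>: "\<theta> \<in> test_functions \<Omega>" unfolding \<theta>_def[abs_def] by (intro test_cmult test_add \<psi>(1))
      have "norm (\<theta> x - u x) \<le> \<eta>" if x: "x \<in> \<Omega>" for x
      proof -
        have "\<bar>\<psi> k x - u x\<bar> \<le> \<eta>" "\<bar>\<psi> l x - u x\<bar> \<le> \<eta>" using N1 x k l by auto
        then show ?thesis unfolding \<theta>_def real_norm_def by (simp add: abs_le_iff field_simps)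
      qed
      then have "\<bar>mass p \<theta> - mass p u\<bar> < \<delta>" by (rule \<eta>(2)[OF test_in_Lp(1)[OF \<theta> p0]])
      then have "mass p \<theta> \<ge> 1 - \<delta>" using mu by linarith
      then have "?\<mu> * (1 - \<delta>) \<le> ?\<mu> * mass p \<theta>" using \<mu>0 by (rule mult_left_mono)
      also have "\<dots> \<le> energy p \<theta> (grad \<theta>)" by (rule test_min_mass_le[OF p0 ex \<theta>])
      finally have E\<theta>: "?\<mu> * (1 - \<delta>) \<le> energy p \<theta> (grad \<theta>)" .
      have Ek: "energy p (\<psi> j) (grad (\<psi> j)) \<le> ?\<mu> + \<delta>" if "j \<ge> max N1 N2" for j
      proof -
        have "inverse (real (Suc j)) \<le> inverse (real (Suc N2))" using that by (intro le_imp_inverse_le) auto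
        then show ?thesis using E\<psi>[of j] N2 by linarith
      qed
      have "energy p \<theta> (grad \<theta>) + Lp_power p \<Omega> (\<lambda>x. (1 / 2) *\<^sub>R (grad (\<psi> k) x - grad (\<psi> l) x))
          \<le> (energy p (\<psi> k) (grad (\<psi> k)) + energy p (\<psi> l) (grad (\<psi> l))) / 2"
        using Clarkson_energy[OF p(2) \<psi>(1) \<psi>(1), of k l] unfolding \<theta>_def[abs_def] .
      then have half: "Lp_power p \<Omega> (\<lambda>x. (1 / 2) *\<^sub>R (grad (\<psi> k) x - grad (\<psi> l) x)) \<le> \<delta> * (1 + ?\<mu>)"
        using E\<theta> Ek[OF k] Ek[OF l] by (simp add: algebra_simps)
      have "Lp_power p \<Omega> (\<lambda>x. grad (\<psi> k) x - grad (\<psi> l) x)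
          = Lp_power p \<Omega> (\<lambda>x. 2 *\<^sub>R ((1 / 2) *\<^sub>R (grad (\<psi> k) x - grad (\<psi> l) x)))" by simp
      also have "\<dots> = 2 powr p * Lp_power p \<Omega> (\<lambda>x. (1 / 2) *\<^sub>R (grad (\<psi> k) x - grad (\<psi> l) x))"
        by (subst Lp_power_cmult) simp
      also have "\<dots> \<le> 2 powr p * (\<delta> * (1 + ?\<mu>))" using half by (intro mult_left_mono) auto
      finally show ?thesis unfolding \<delta>(2) .
    qed
    then show ?thesis by blast
  qed
  obtain g where g: "g \<in> Lp_space p \<Omega>" and gl: "(\<lambda>k. Lp_power p \<Omega> (\<lambda>x. grad (\<psi> k) x - g x)) \<longlonglongrightarrow> 0"
    using Lp_complete[where g="\<lambda>k. grad (\<psi> k)", OF p0 \<psi>L(2) cauchy] .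
  have wg: "has_weak_gradient \<Omega> u g"
    by (rule weak_gradient_limit[OF domain_measurable(1) p1 \<psi>(1) uL g ul gl])
  have "energy p u g = ?\<mu>"
  proof (rule antisym)
    have lim: "(\<lambda>k. energy p (\<psi> k) (grad (\<psi> k))) \<longlonglongrightarrow> energy p u g"
      by (rule energy_tendsto[OF p0 uL \<psi>L(1) ul g \<psi>L(2) gl])
    have "(\<lambda>k. ?\<mu> + inverse (real (Suc k))) \<longlonglongrightarrow> ?\<mu> + 0"
      by (rule tendsto_add[OF tendsto_const LIMSEQ_inverse_real_of_nat])
    from LIMSEQ_le[OF lim this] E\<psi> show "energy p u g \<le> ?\<mu>" by auto
    have "?\<mu> \<le> energy p (\<psi> k) (grad (\<psi> k))" for k
      using test_min_mass_le[OF p0 ex \<psi>(1), of k] \<psi>(2)[of k] by simp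
    then show "?\<mu> \<le> energy p u g" using LIMSEQ_le_const[OF lim] by blast
  qed
  moreover have "energy p u (weak_gradient \<Omega> u) = energy p u g"
    unfolding energy_def
    by (rule weak_gradient_integral(1)[OF open_domain wg g borel_measurable_integrable[OF weighted_integrable(2)[OF uL]]])
  moreover have "u \<in> W1p_0 p \<Omega>"
    by (rule W1p_0_I[OF open_domain p0 wg uL g \<psi>(1) ul gl])
  ultimately show ?thesis using mu by auto
qed

text \<open>
  \<open>LEAST\<close> has a determined value here only because the infimum is attained.
\<close>

lemma lambda_1p_eq_test_min:
  assumes p: "p > real DIM('a)" "p \<ge> 2" and ex: "\<exists>\<phi>\<in>test_functions \<Omega>. mass p \<phi> > 0"
  shows "lambda_1p p \<Omega> C m = test_min p"
proof -
  obtain u where u: "u \<in> W1p_0 p \<Omega>" "mass p u = 1" "energy p u (weak_gradient \<Omega> u) = test_min p"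
    using minimiser_exists[OF assms] by blast
  have p0: "p > 0" using p(2) by simp
  have eq: "{LINT x|lebesgue_on \<Omega>. norm (weak_gradient \<Omega> u x) powr p + C x * \<bar>u x\<bar> powr p | u.
        u \<in> W1p_0 p \<Omega> \<and> (LINT x|lebesgue_on \<Omega>. m x * \<bar>u x\<bar> powr p) = 1}
    = {energy p u (weak_gradient \<Omega> u) | u. u \<in> W1p_0 p \<Omega> \<and> mass p u = 1}"
    by (simp add: energy_def mass_def)
  show ?thesis
    unfolding lambda_1p_def eq
  proof (rule Least_equality)
    show "test_min p \<in> {energy p u (weak_gradient \<Omega> u) | u. u \<in> W1p_0 p \<Omega> \<and> mass p u = 1}"
      using u by (metis (mono_tags, lifting) mem_Collect_eq)
    show "test_min p \<le> s" if "s \<in> {energy p u (weak_gradient \<Omega> u) | u. u \<in> W1p_0 p \<Omega> \<and> mass p u = 1}" for s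
      using that test_min_le_W1p_0[OF p0 ex] by auto
  qed
qed

end

section \<open>The limit of the eigenvalues\<close>

text \<open>
  The positive part of \<open>t\<close> is approximated from below with error at most \<open>e\<close>.
\<close>

lemma flat_1_bounds:
  assumes "e > 0"
  shows "0 \<le> flat e 1 t" "flat e 1 t \<le> max 0 t" "t - e \<le> flat e 1 t"
proof -
  show "0 \<le> flat e 1 t" by (simp add: flat_def)
  show "flat e 1 t \<le> max 0 t" using assms by (auto simp: flat_def mult_le_cancel_left2)
  show "t - e \<le> flat e 1 t"
  proof (cases "t > 0")
    case True
    have "t - e = t * (1 + - (e / t))" using True by (simp add: algebra_simps)
    also have "\<dots> \<le> t * exp (- (e / t))" using True by (intro mult_left_mono exp_ge_add_one_self) auto
    finally show ?thesis using True by (simp add: flat_def)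
  next
    case False
    then show ?thesis using assms by (simp add: flat_def)
  qed
qed

text \<open>
  With \<open>s = e / t\<close> the derivative is \<open>(1 + s) * exp (- s)\<close>.
\<close>

lemma flat_1_deriv_bounds:
  assumes "e > 0"
  shows "0 \<le> 1 * flat e (1 - 1) t + e * flat e (1 - 2) t" "1 * flat e (1 - 1) t + e * flat e (1 - 2) t \<le> 1"
proof -
  show "0 \<le> 1 * flat e (1 - 1) t + e * flat e (1 - 2) t"
    using assms by (simp add: flat_def)
  show "1 * flat e (1 - 1) t + e * flat e (1 - 2) t \<le> 1"
  proof (cases "t > 0")
    case True
    have "1 * flat e (1 - 1) t + e * flat e (1 - 2) t = exp (- (e / t)) * (1 + e / t)"
      using True by (simp add: flat_def powr_minus divide_inverse algebra_simps)
    also have "\<dots> \<le> exp (- (e / t)) * exp (e / t)"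
      by (intro mult_left_mono exp_ge_add_one_self) auto
    also have "\<dots> = 1" by (simp add: exp_minus)
    finally show ?thesis .
  qed (simp add: flat_def)
qed

text \<open>
  A smooth version of the cone \<open>max 0 (a - norm (x - y))\<close>: the norm is replaced by the square root of
  \<open>(norm (x - y))\<^sup>2 + \<epsilon>\<^sup>2\<close> and the positive part by \<open>flat \<epsilon> 1\<close>. Neither change makes the slope exceed 1,
  and each of them lowers the function by at most \<open>\<epsilon>\<close>.
\<close>

lemma cone_bump:
  fixes y :: "'a::euclidean_space"
  assumes \<epsilon>: "\<epsilon> > 0" and a: "cball y a \<subseteq> \<Omega>"
  shows "\<exists>\<phi>\<in>test_functions \<Omega>. (\<forall>x. norm (grad \<phi> x) \<le> 1) \<and>
    (\<forall>x. 0 \<le> \<phi> x \<and> \<phi> x \<le> max 0 (a - norm (x - y)) \<and> a - norm (x - y) - 2 * \<epsilon> \<le> \<phi> x)"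
proof -
  define Q where "Q x = (norm (x - y))\<^sup>2 + \<epsilon>\<^sup>2" for x
  define q where "q x = Q x powr (1 / 2)" for x
  define \<phi> where "\<phi> x = flat \<epsilon> 1 (a + (-1) * q x)" for x
  have Q: "Q x > 0" for x using \<epsilon> by (simp add: Q_def add_nonneg_pos)
  have q_sqrt: "q x = sqrt (Q x)" for x unfolding q_def using Q[of x] by (simp add: powr_half_sqrt)
  have q_ge: "norm (x - y) \<le> q x" for x
    unfolding q_sqrt Q_def by (rule real_le_rsqrt) simp
  have q_le: "q x \<le> norm (x - y) + \<epsilon>" for x
    unfolding q_sqrt Q_def using \<epsilon> by (intro real_le_lsqrt) (auto simp: power2_sum)
  have q0: "q x > 0" for x using Q[of x] by (simp add: q_def)
  have sm: "smooth \<phi>"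
    unfolding smooth_def
  proof
    fix k
    have "C_k k q" using C_k_quadratic_powr[of "\<epsilon>\<^sup>2" k y "1 / 2"] \<epsilon> unfolding q_def[abs_def] Q_def by simp
    then have "C_k k (\<lambda>x. a + (-1) * q x)" by (rule C_k_add[OF C_k_const C_k_mult[OF C_k_const]])
    from C_k_compose[OF flat_C_k[OF \<epsilon>] this] show "C_k k \<phi>" unfolding \<phi>_def[abs_def] .
  qed
  have bounds: "0 \<le> \<phi> x" "\<phi> x \<le> max 0 (a - norm (x - y))" "a - norm (x - y) - 2 * \<epsilon> \<le> \<phi> x" for x
    using flat_1_bounds[OF \<epsilon>, of "a + (-1) * q x"] q_ge[of x] q_le[of x] unfolding \<phi>_def by auto
  have "\<phi> x = 0" if "x \<notin> cball y a" for x
  proof -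
    have "norm (x - y) > a" using that by (simp add: dist_norm norm_minus_commute)
    then show ?thesis using bounds(1,2)[of x] by simp
  qed
  then have test: "\<phi> \<in> test_functions \<Omega>"
    unfolding test_functions_iff using sm a by (intro conjI exI[of _ "cball y a"]) auto
  have "norm (grad \<phi> x) \<le> 1" for x
  proof -
    define h' where "h' = 1 * flat \<epsilon> (1 - 1) (a + (-1) * q x) + \<epsilon> * flat \<epsilon> (1 - 2) (a + (-1) * q x)"
    have h': "0 \<le> h'" "h' \<le> 1" unfolding h'_def by (rule flat_1_deriv_bounds[OF \<epsilon>])+
    have "((\<lambda>t. t powr (1 / 2)) has_derivative (*) (1 / 2 * Q x powr (1 / 2 - 1))) (at (Q x))"
      using has_real_derivative_powr[OF Q] by (rule has_field_derivative_imp_has_derivative)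
    from has_derivative_compose[OF has_derivative_quadratic[of y "\<epsilon>\<^sup>2" x, folded Q_def] this]
    have dq: "(q has_derivative (\<lambda>i. 1 / 2 * Q x powr (1 / 2 - 1) * (2 * ((x - y) \<bullet> i)))) (at x)"
      unfolding q_def[abs_def] .
    have da: "((\<lambda>x. a + (-1) * q x) has_derivative (\<lambda>i. 0 + (-1) * (1 / 2 * Q x powr (1 / 2 - 1) * (2 * ((x - y) \<bullet> i))))) (at x)"
      by (intro has_derivative_add has_derivative_const has_derivative_mult_right dq)
    have "(flat \<epsilon> 1 has_derivative (*) h') (at (a + (-1) * q x))"
      unfolding h'_def by (rule has_field_derivative_imp_has_derivative[OF flat_has_derivative[OF \<epsilon>]])
    from has_derivative_compose[OF da this]
    have "(\<phi> has_derivative (\<lambda>i. ((- h' * Q x powr (1 / 2 - 1)) *\<^sub>R (x - y)) \<bullet> i)) (at x)"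
      unfolding \<phi>_def[abs_def] by (rule has_derivative_eq_rhs) (simp add: fun_eq_iff)
    then have gr: "grad \<phi> x = (- h' * Q x powr (1 / 2 - 1)) *\<^sub>R (x - y)" by (rule grad_unique)
    have "1 / 2 - 1 = - (1 / 2 :: real)" by simp
    then have "Q x powr (1 / 2 - 1) = 1 / q x"
      unfolding q_def by (simp only: powr_minus_divide)
    then have "norm (grad \<phi> x) = \<bar>- h' * (1 / q x)\<bar> * norm (x - y)"
      unfolding gr norm_scaleR by simp
    also have "\<dots> = h' * (norm (x - y) / q x)"
      using h'(1) q0[of x] by (simp add: abs_mult)
    also have "\<dots> \<le> 1 * 1"
      using h' q0[of x] q_ge[of x] by (intro mult_mono) auto
    finally show ?thesis by simp
  qed
  with test bounds show ?thesis by blast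
qed

lemma powr_inverse_tendsto_1:
  assumes "K > 0" shows "((\<lambda>p::real. K powr (1 / p)) \<longlongrightarrow> 1) at_top"
proof -
  have "((\<lambda>p::real. 1 / p) \<longlongrightarrow> 0) at_top" by (rule tendsto_divide_0[OF tendsto_const filterlim_at_top_imp_at_infinity[OF filterlim_ident]])
  then have "((\<lambda>p::real. K powr (1 / p)) \<longlongrightarrow> K powr 0) at_top"
    using assms by (intro tendsto_powr tendsto_const) auto
  then show ?thesis using assms by simp
qed

lemma powr_at_top_tendsto_0:
  fixes x :: real
  assumes "0 < x" "x < 1" shows "((\<lambda>p. x powr p) \<longlongrightarrow> 0) at_top"
  using assms by real_asymp

lemma morrey_const_tendsto_1:
  assumes "\<rho> > 0" shows "((\<lambda>p. morrey_const n p \<rho>) \<longlongrightarrow> 1) at_top"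
proof -
  have 0: "((\<lambda>p::real. c / p) \<longlongrightarrow> 0) at_top" for c :: real
    by (rule tendsto_divide_0[OF tendsto_const filterlim_at_top_imp_at_infinity[OF filterlim_ident]])
  have "((\<lambda>p. \<rho> powr (- n / p)) \<longlongrightarrow> \<rho> powr 0) at_top"
    by (rule tendsto_powr[OF tendsto_const 0]) (use assms in simp)
  moreover have "((\<lambda>p. 1 - n / p) \<longlongrightarrow> 1 - 0) at_top"
    by (rule tendsto_diff[OF tendsto_const 0])
  ultimately have "((\<lambda>p. \<rho> powr (- n / p) / (1 - n / p)) \<longlongrightarrow> \<rho> powr 0 / (1 - 0)) at_top"
    by (rule tendsto_divide) simp
  then show ?thesis using assms by (simp add: morrey_const_def)
qed

context eigenvalue_problem
begin

lemma frontier_nonempty: "frontier \<Omega> \<noteq> {}"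
  using nonempty_domain bounded_domain not_bounded_UNIV by (auto simp: frontier_eq_empty)

lemma positive_subset_Omega_plus: "{x \<in> \<Omega>. m x > 0} \<subseteq> Omega_plus \<Omega> m"
  unfolding Omega_plus_def by (rule closure_subset)

text \<open>
  The distance is continuous on a nonempty compact set, so \<open>GREATEST\<close> denotes a genuine maximum.
\<close>

lemma R_plus_attained:
  assumes pos: "{x \<in> \<Omega>. m x > 0} \<noteq> {}"
  shows "\<exists>x\<in>Omega_plus \<Omega> m. infdist x (frontier \<Omega>) = R_plus \<Omega> m"
    and "\<And>x. x \<in> Omega_plus \<Omega> m \<Longrightarrow> infdist x (frontier \<Omega>) \<le> R_plus \<Omega> m"
    and "R_plus \<Omega> m > 0"
proof -
  let ?S = "(\<lambda>x. infdist x (frontier \<Omega>)) ` Omega_plus \<Omega> m"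
  have "bounded {x \<in> \<Omega>. m x > 0}" using bounded_domain by (rule bounded_subset) auto
  then have comp: "compact (Omega_plus \<Omega> m)" unfolding Omega_plus_def by (simp add: compact_closure)
  have ne: "Omega_plus \<Omega> m \<noteq> {}" using pos unfolding Omega_plus_def by simp
  have "continuous_on (Omega_plus \<Omega> m) (\<lambda>x. infdist x (frontier \<Omega>))"
    by (intro continuous_on_infdist continuous_on_id)
  from continuous_attains_sup[OF comp ne this] obtain z where z: "z \<in> Omega_plus \<Omega> m"
    "\<And>x. x \<in> Omega_plus \<Omega> m \<Longrightarrow> infdist x (frontier \<Omega>) \<le> infdist z (frontier \<Omega>)"
    by blast
  have R: "R_plus \<Omega> m = infdist z (frontier \<Omega>)"
    unfolding R_plus_def using z by (intro Greatest_equality) auto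
  show "\<exists>x\<in>Omega_plus \<Omega> m. infdist x (frontier \<Omega>) = R_plus \<Omega> m" using z(1) R by auto
  show le: "infdist x (frontier \<Omega>) \<le> R_plus \<Omega> m" if "x \<in> Omega_plus \<Omega> m" for x
    using z(2)[OF that] R by simp
  obtain x where x: "x \<in> \<Omega>" "m x > 0" using pos by auto
  have "x \<notin> frontier \<Omega>" using x(1) open_domain by (simp add: frontier_def interior_open)
  then have "infdist x (frontier \<Omega>) > 0"
    by (rule infdist_pos_not_in_closed[OF frontier_closed frontier_nonempty])
  also have "\<dots> \<le> R_plus \<Omega> m"
    by (rule le) (use x positive_subset_Omega_plus in auto)
  finally show "R_plus \<Omega> m > 0" .
qed

text \<open>
  The competitor is a cone of height \<open>a < R_plus\<close> around a point \<open>y\<close> with \<open>m y > 0\<close>. Its values exceed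
  some \<open>\<alpha>\<close> on a small ball around \<open>y\<close> and are at most some \<open>\<beta> < \<alpha>\<close> away from a larger ball on which
  \<open>m\<close> is still positive, so the mass is at least a constant times \<open>\<alpha> powr p\<close> for large \<open>p\<close>, while the
  energy is at most a constant times \<open>max 1 a powr p\<close>.
\<close>

lemma eventually_test_min_less:
  assumes pos: "{x \<in> \<Omega>. m x > 0} \<noteq> {}" and B: "B > max (1 / R_plus \<Omega> m) 1"
  shows "eventually (\<lambda>p. (\<exists>\<phi>\<in>test_functions \<Omega>. mass p \<phi> > 0) \<and> test_min p powr (1 / p) < B) at_top"
proof -
  let ?R = "R_plus \<Omega> m" and ?V = "measure (lebesgue_on \<Omega>) \<Omega>"
  interpret finite_measure "lebesgue_on \<Omega>" using domain_measurable(1) by (rule finite_measure_lebesgue_on)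
  note R = R_plus_attained[OF pos]
  have B1: "B > 1" "1 / B < ?R" using B R(3) by (auto simp: field_simps)
  \<comment> \<open>Since \<open>B > 1\<close>, a height \<open>a > 1 / B\<close> is exactly what makes \<open>max 1 a / a < B\<close>.\<close>
  obtain a where a: "1 / B < a" "a < ?R" using dense[OF B1(2)] by blast
  have a0: "a > 0" using a(1) B1(1) by (meson divide_pos_pos less_trans zero_less_one)
  have aB: "max 1 a / B < a" using a(1) B1(1) a0 by (auto simp: max_def field_simps)
  obtain z where z: "z \<in> closure {x \<in> \<Omega>. m x > 0}" "infdist z (frontier \<Omega>) = ?R"
    using R(1) unfolding Omega_plus_def by blast
  have "\<exists>y\<in>{x \<in> \<Omega>. m x > 0}. dist y z < ?R - a"
    using z(1) a(2) unfolding closure_approachable by simp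
  then obtain y where y: "y \<in> \<Omega>" "m y > 0" "dist y z < ?R - a" by blast
  have dy: "infdist y (frontier \<Omega>) > a"
    using infdist_triangle[of z "frontier \<Omega>" y] z(2) y(3) by (simp add: dist_commute)
  have sub: "cball y a \<subseteq> \<Omega>"
  proof (rule ccontr)
    assume "\<not> ?thesis"
    then have "cball y a - \<Omega> \<noteq> {}" by blast
    moreover have "y \<in> cball y a \<inter> \<Omega>" using y(1) a0 by simp
    then have "cball y a \<inter> \<Omega> \<noteq> {}" by blast
    ultimately have "cball y a \<inter> frontier \<Omega> \<noteq> {}"
      using connected_Int_frontier[of "cball y a" \<Omega>] by (simp add: convex_connected)
    then obtain w where "w \<in> cball y a" "w \<in> frontier \<Omega>" by blast
    then show False using infdist_le[of w "frontier \<Omega>" y] dy by simp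
  qed
  have mc: "isCont m y"
    using continuous_on_interior[OF m_continuous] y(1) interior_mono[OF closure_subset[of \<Omega>]] open_domain
    by (auto simp: interior_open)
  have "m y / 2 < m y" using y(2) by simp
  then have "eventually (\<lambda>x. m y / 2 < m x) (at y)"
    using mc unfolding isCont_def by (rule order_tendstoD(1)[rotated])
  then obtain d where d: "d > 0" "\<And>x. x \<noteq> y \<Longrightarrow> dist x y < d \<Longrightarrow> m y / 2 < m x"
    unfolding eventually_at by auto
  have d': "m y / 2 \<le> m x" if "dist x y < d" for x using d(2)[of x] that y(2) by (cases "x = y") auto
  \<comment> \<open>\<open>m\<close> is positive within \<open>\<delta>\<close> of \<open>y\<close>, and a loss of height less than \<open>\<delta>\<close> keeps
      \<open>max 1 a\<close> divided by the height below \<open>B\<close>.\<close>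
  define \<delta> where "\<delta> = min (min d (a / 2)) (a - max 1 a / B)"
  have \<delta>: "\<delta> > 0" "\<delta> \<le> d" "\<delta> \<le> a / 2" "\<delta> \<le> a - max 1 a / B"
  proof -
    show "\<delta> > 0" unfolding \<delta>_def using d(1) a0 aB by simp
    show "\<delta> \<le> d" "\<delta> \<le> a / 2" "\<delta> \<le> a - max 1 a / B"
      unfolding \<delta>_def by (auto intro: min.coboundedI1 min.coboundedI2 simp del: le_divide_eq_numeral1)
  qed
  \<comment> \<open>The cone used below is smoothed by \<open>\<delta> / 4\<close>, so it exceeds \<open>a - 3 / 4 * \<delta>\<close> within \<open>\<delta> / 4\<close> of \<open>y\<close>.\<close>
  define \<alpha> \<beta> where "\<alpha> = a - 3 / 4 * \<delta>" and "\<beta> = a - \<delta>"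
  have \<alpha>\<beta>: "0 < \<beta>" "\<beta> < \<alpha>" "max 1 a / \<alpha> < B"
  proof -
    show "0 < \<beta>" "\<beta> < \<alpha>" unfolding \<alpha>_def \<beta>_def using \<delta> a0 by auto
    have "max 1 a / B < \<alpha>" unfolding \<alpha>_def using \<delta>(1,4) by linarith
    moreover have "\<alpha> > 0" unfolding \<alpha>_def using \<delta> a0 by auto
    ultimately show "max 1 a / \<alpha> < B" using B1(1) by (simp add: field_simps)
  qed
  obtain \<phi> where \<phi>: "\<phi> \<in> test_functions \<Omega>" and g1: "\<And>x. norm (grad \<phi> x) \<le> 1"
    and b: "\<And>x. 0 \<le> \<phi> x" "\<And>x. \<phi> x \<le> max 0 (a - norm (x - y))" "\<And>x. a - norm (x - y) - 2 * (\<delta> / 4) \<le> \<phi> x"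
    using cone_bump[of "\<delta> / 4" y a \<Omega>] \<delta>(1) sub by auto
  obtain W where W: "W > 0" "\<And>x. x \<in> \<Omega> \<Longrightarrow> \<bar>m x\<bar> \<le> W" "\<And>x. x \<in> \<Omega> \<Longrightarrow> \<bar>C x\<bar> \<le> W"
    using weights_bounded by metis
  let ?D = "ball y (\<delta> / 4)"
  have Dsub: "?D \<subseteq> \<Omega>" using sub \<delta>(1,3) a0 by (auto simp: subset_iff)
  have Dm: "?D \<in> sets (lebesgue_on \<Omega>)"
    using Dsub domain_measurable(2) by (simp add: sets_restrict_space_iff sets_completionI_sets)
  define v where "v = measure (lebesgue_on \<Omega>) ?D"
  have v: "v > 0"
  proof -
    have "v = measure lebesgue ?D" unfolding v_def using Dsub domain_measurable(2)
      by (intro measure_restrict_space) auto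
    also have "\<dots> > 0" using \<delta>(1) content_ball_pos[of "\<delta> / 4" y] by simp
    finally show ?thesis .
  qed
  \<comment> \<open>One half of the contribution of the small ball; the other half absorbs the region where \<open>m\<close> may be negative.\<close>
  define \<kappa> where "\<kappa> = m y / 2 * v / 2"
  have \<kappa>: "\<kappa> > 0" unfolding \<kappa>_def using y(2) v by simp
  have V0: "?V \<ge> 0" by simp
  have mass_ge: "m y / 2 * \<alpha> powr p * v - W * \<beta> powr p * ?V \<le> mass p \<phi>" if p: "p > 0" for p
  proof -
    have "(LINT x|lebesgue_on \<Omega>. m y / 2 * \<alpha> powr p * indicator ?D x - W * \<beta> powr p) \<le> mass p \<phi>"
      unfolding mass_def
    proof (rule integral_mono[OF _ weighted_integrable(1)[OF test_in_Lp(1)[OF \<phi> p]]])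
      show "integrable (lebesgue_on \<Omega>) (\<lambda>x. m y / 2 * \<alpha> powr p * indicator ?D x - W * \<beta> powr p)"
        using Dm by (intro Bochner_Integration.integrable_diff integrable_mult_right integrable_const) (simp add: less_top[symmetric])
      fix x assume "x \<in> space (lebesgue_on \<Omega>)"
      then have x: "x \<in> \<Omega>" by simp
      show "m y / 2 * \<alpha> powr p * indicator ?D x - W * \<beta> powr p \<le> m x * \<bar>\<phi> x\<bar> powr p"
      proof (cases "dist x y < \<delta>")
        case True
        then have mx: "m y / 2 \<le> m x" using d' \<delta>(2) by simp
        have W0: "0 \<le> W * \<beta> powr p" using W(1) by simp
        show ?thesis
        proof (cases "x \<in> ?D")
          case True
          then have "\<alpha> \<le> \<bar>\<phi> x\<bar>"
            using b(3)[of x] \<delta>(1) unfolding \<alpha>_def by (simp add: dist_norm norm_minus_commute)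
          then have "m y / 2 * \<alpha> powr p \<le> m x * \<bar>\<phi> x\<bar> powr p"
            using mx y(2) \<alpha>\<beta> p by (intro mult_mono powr_mono2) auto
          then show ?thesis using True W0 by simp
        next
          case False
          have "0 \<le> m x * \<bar>\<phi> x\<bar> powr p" using mx y(2) by simp
          with False W0 show ?thesis by simp
        qed
      next
        case False
        then have nD: "x \<notin> ?D" using \<delta>(1) by (simp add: dist_commute)
        have "\<bar>\<phi> x\<bar> \<le> \<beta>" using b(1,2)[of x] False \<alpha>\<beta>(1) unfolding \<beta>_def by (simp add: dist_norm max_def split: if_splits)
        then have "\<bar>m x\<bar> * \<bar>\<phi> x\<bar> powr p \<le> W * \<beta> powr p"
          using W(1) W(2)[OF x] p by (intro mult_mono powr_mono2) auto
        moreover have "(- m x) * \<bar>\<phi> x\<bar> powr p \<le> \<bar>m x\<bar> * \<bar>\<phi> x\<bar> powr p"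
          by (intro mult_right_mono) auto
        ultimately show ?thesis using nD by simp
      qed
    qed
    also have "(LINT x|lebesgue_on \<Omega>. m y / 2 * \<alpha> powr p * indicator ?D x - W * \<beta> powr p) = m y / 2 * \<alpha> powr p * v - W * \<beta> powr p * ?V"
      using Dm by (subst Bochner_Integration.integral_diff) (auto simp: v_def less_top[symmetric] mult.commute Int_absorb2 Dsub)
    finally show ?thesis .
  qed
  have energy_le: "energy p \<phi> (grad \<phi>) \<le> ?V * ((1 + W) * max 1 a powr p)" if p: "p > 0" for p
  proof -
    note I = test_in_Lp[OF \<phi> p]
    have "energy p \<phi> (grad \<phi>) \<le> (LINT x|lebesgue_on \<Omega>. (1 + W) * max 1 a powr p)"
      unfolding energy_def
    proof (rule integral_mono)
      show "integrable (lebesgue_on \<Omega>) (\<lambda>x. norm (grad \<phi> x) powr p + C x * \<bar>\<phi> x\<bar> powr p)"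
        using Lp_spaceD(2)[OF I(2)] weighted_integrable(2)[OF I(1)] by simp
      show "integrable (lebesgue_on \<Omega>) (\<lambda>x. (1 + W) * max 1 a powr p)" by (rule integrable_const)
      fix x assume "x \<in> space (lebesgue_on \<Omega>)"
      then have x: "x \<in> \<Omega>" by simp
      have "norm (grad \<phi> x) powr p \<le> max 1 a powr p"
        using g1[of x] p by (intro powr_mono2) auto
      moreover have "\<bar>\<phi> x\<bar> \<le> max 1 a"
        using b(1,2)[of x] a0 norm_ge_zero[of "x - y"] by linarith
      then have "C x * \<bar>\<phi> x\<bar> powr p \<le> W * max 1 a powr p"
        using W(3)[OF x] W(1) C_nonneg[OF x] p by (intro mult_mono powr_mono2) auto
      ultimately show "norm (grad \<phi> x) powr p + C x * \<bar>\<phi> x\<bar> powr p \<le> (1 + W) * max 1 a powr p"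
        by (simp add: distrib_right)
    qed
    then show ?thesis by simp
  qed
  have "((\<lambda>p. (\<beta> / \<alpha>) powr p) \<longlongrightarrow> 0) at_top"
    by (rule powr_at_top_tendsto_0) (use \<alpha>\<beta> in auto)
  then have "((\<lambda>p. W * ?V * (\<beta> / \<alpha>) powr p) \<longlongrightarrow> W * ?V * 0) at_top"
    by (rule tendsto_mult[OF tendsto_const])
  then have ev1: "eventually (\<lambda>p. W * ?V * (\<beta> / \<alpha>) powr p < \<kappa>) at_top"
    using \<kappa> by (intro order_tendstoD(2)) auto
  define K where "K = (?V + 1) * (1 + W) / \<kappa>"
  have K: "K > 0" unfolding K_def using W(1) \<kappa> V0 by (intro divide_pos_pos mult_pos_pos add_nonneg_pos) auto
  have "((\<lambda>p. K powr (1 / p) * (max 1 a / \<alpha>)) \<longlongrightarrow> 1 * (max 1 a / \<alpha>)) at_top"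
    by (rule tendsto_mult[OF powr_inverse_tendsto_1[OF K] tendsto_const])
  then have ev2: "eventually (\<lambda>p. K powr (1 / p) * (max 1 a / \<alpha>) < B) at_top"
    using \<alpha>\<beta>(3) by (intro order_tendstoD(2)) auto
  show ?thesis
    using ev1 ev2 eventually_gt_at_top[of 0]
  proof eventually_elim
    case (elim p)
    have p: "p > 0" by fact
    have \<alpha>0: "\<alpha> > 0" using \<alpha>\<beta> by simp
    have "\<beta> powr p = (\<beta> / \<alpha>) powr p * \<alpha> powr p" using \<alpha>0 \<alpha>\<beta>(1) by (simp add: powr_divide)
    then have "W * \<beta> powr p * ?V = (W * ?V * (\<beta> / \<alpha>) powr p) * \<alpha> powr p" by simp
    also have "\<dots> \<le> \<kappa> * \<alpha> powr p" using elim(1) by (intro mult_right_mono) auto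
    finally have "\<kappa> * \<alpha> powr p \<le> m y / 2 * \<alpha> powr p * v - W * \<beta> powr p * ?V"
      unfolding \<kappa>_def by (simp add: algebra_simps)
    then have mass: "\<kappa> * \<alpha> powr p \<le> mass p \<phi>" using mass_ge[OF p] by linarith
    have m0: "\<kappa> * \<alpha> powr p > 0" using \<kappa> \<alpha>0 by simp
    then have mpos: "mass p \<phi> > 0" using mass by linarith
    have t0: "0 \<le> test_min p"
      using test_min_greatest[OF p _ energy_nonneg] \<phi> mpos by blast
    have "test_min p \<le> energy p \<phi> (grad \<phi>) / mass p \<phi>" by (rule test_min_le[OF p \<phi> mpos])
    also have "\<dots> \<le> ((?V + 1) * ((1 + W) * max 1 a powr p)) / (\<kappa> * \<alpha> powr p)"
    proof (rule frac_le[OF _ _ m0 mass])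
      have "?V * ((1 + W) * max 1 a powr p) \<le> (?V + 1) * ((1 + W) * max 1 a powr p)"
        using W(1) by (intro mult_right_mono) auto
      then show "energy p \<phi> (grad \<phi>) \<le> (?V + 1) * ((1 + W) * max 1 a powr p)"
        using energy_le[OF p] by linarith
      show "0 \<le> (?V + 1) * ((1 + W) * max 1 a powr p)" using W(1) by simp
    qed
    also have "\<dots> = K * (max 1 a / \<alpha>) powr p"
      unfolding K_def using \<alpha>0 by (simp add: powr_divide)
    finally have "test_min p powr (1 / p) \<le> (K * (max 1 a / \<alpha>) powr p) powr (1 / p)"
      using t0 p by (intro powr_mono2) auto
    also have "\<dots> = K powr (1 / p) * (max 1 a / \<alpha>)"
      using K \<alpha>0 p by (simp add: powr_mult powr_powr)
    also have "\<dots> < B" by (rule elim(2))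
    finally show ?case using \<phi> mpos by blast
  qed
qed

text \<open>
  The mass is at most \<open>W / c\<close> times the part of the energy that contains \<open>C\<close>.
\<close>

lemma eventually_test_min_greater_if_less_1:
  assumes ex: "eventually (\<lambda>p. \<exists>\<phi>\<in>test_functions \<Omega>. mass p \<phi> > 0) at_top" and B: "B < 1"
  shows "eventually (\<lambda>p. B < test_min p powr (1 / p)) at_top"
proof -
  obtain W where W: "W > 0" "\<And>x. x \<in> \<Omega> \<Longrightarrow> \<bar>m x\<bar> \<le> W" using weights_bounded by metis
  obtain c where c: "c > 0" "\<And>x. x \<in> \<Omega> \<Longrightarrow> c \<le> C x" using C_lower_bound by metis
  have cW: "c / W > 0" using c W by simp
  have "eventually (\<lambda>p. B < (c / W) powr (1 / p)) at_top"
    using powr_inverse_tendsto_1[OF cW] B by (rule order_tendstoD(1))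
  then show ?thesis
    using ex eventually_gt_at_top[of 0]
  proof eventually_elim
    case (elim p)
    have p: "p > 0" by fact
    have "c / W \<le> test_min p"
    proof (rule test_min_greatest[OF p elim(2)])
      fix \<phi> assume \<phi>: "\<phi> \<in> test_functions \<Omega>" and 1: "mass p \<phi> = 1"
      note I = test_in_Lp[OF \<phi> p]
      have "mass p \<phi> \<le> (LINT x|lebesgue_on \<Omega>. W / c * (C x * \<bar>\<phi> x\<bar> powr p))"
        unfolding mass_def
      proof (rule integral_mono[OF weighted_integrable(1)[OF I(1)]])
        show "integrable (lebesgue_on \<Omega>) (\<lambda>x. W / c * (C x * \<bar>\<phi> x\<bar> powr p))"
          using weighted_integrable(2)[OF I(1)] by (rule integrable_mult_right)
        fix x assume "x \<in> space (lebesgue_on \<Omega>)"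
        then have x: "x \<in> \<Omega>" by simp
        have "m x \<le> W / c * C x"
        proof -
          have "m x \<le> W" using W(2)[OF x] by simp
          also have "\<dots> = W / c * c" using c(1) by simp
          also have "\<dots> \<le> W / c * C x" using c W(1) x by (intro mult_left_mono) auto
          finally show ?thesis .
        qed
        then have "m x * \<bar>\<phi> x\<bar> powr p \<le> W / c * C x * \<bar>\<phi> x\<bar> powr p" by (rule mult_right_mono) simp
        then show "m x * \<bar>\<phi> x\<bar> powr p \<le> W / c * (C x * \<bar>\<phi> x\<bar> powr p)" by (simp add: mult.assoc)
      qed
      also have "\<dots> = W / c * (LINT x|lebesgue_on \<Omega>. C x * \<bar>\<phi> x\<bar> powr p)" by simp
      also have "\<dots> \<le> W / c * energy p \<phi> (grad \<phi>)"
        using W(1) c(1) Lp_power_nonneg[of p \<Omega> "grad \<phi>"] by (intro mult_left_mono) (auto simp: energy_eq[OF I])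
      finally show "c / W \<le> energy p \<phi> (grad \<phi>)" using 1 W(1) c(1) by (simp add: field_simps)
    qed
    then have "(c / W) powr (1 / p) \<le> test_min p powr (1 / p)" using cW p by (intro powr_mono2) auto
    then show ?case using elim(1) by linarith
  qed
qed

text \<open>
  Where \<open>m > 0\<close>, a test function is compared with its value 0 at a nearest boundary point, which is at
  distance at most \<open>R_plus\<close>. The small scale \<open>\<rho>\<close> is fixed first, and then \<open>p\<close> tends to infinity.
\<close>

lemma eventually_test_min_greater_if_less_R:
  assumes pos: "{x \<in> \<Omega>. m x > 0} \<noteq> {}"
    and ex: "eventually (\<lambda>p. \<exists>\<phi>\<in>test_functions \<Omega>. mass p \<phi> > 0) at_top" and B: "B < 1 / R_plus \<Omega> m"
  shows "eventually (\<lambda>p. B < test_min p powr (1 / p)) at_top"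
proof -
  let ?R = "R_plus \<Omega> m" and ?V = "measure (lebesgue_on \<Omega>) \<Omega>" and ?n = "real DIM('a)"
  interpret finite_measure "lebesgue_on \<Omega>" using domain_measurable(1) by (rule finite_measure_lebesgue_on)
  note R = R_plus_attained[OF pos]
  obtain W where W: "W > 0" "\<And>x. x \<in> \<Omega> \<Longrightarrow> \<bar>m x\<bar> \<le> W" using weights_bounded by metis
  have "((\<lambda>\<rho>. 1 / (?R + 2 * \<rho> * ?n)) \<longlongrightarrow> 1 / (?R + 2 * 0 * ?n)) (at_right 0)"
    using R(3) by (intro tendsto_divide tendsto_add tendsto_mult tendsto_const tendsto_ident_at) auto
  then have "eventually (\<lambda>\<rho>. B < 1 / (?R + 2 * \<rho> * ?n) \<and> 0 < \<rho>) (at_right 0)"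
    using B by (intro eventually_conj order_tendstoD(1) eventually_at_right_less) auto
  then obtain \<rho> where \<rho>: "B < 1 / (?R + 2 * \<rho> * ?n)" "\<rho> > 0"
    using eventually_happens'[OF trivial_limit_at_right_real] by blast
  define S where "S = ?R + 2 * \<rho> * ?n"
  have S: "S > 0" unfolding S_def using R(3) \<rho>(2) by (intro add_pos_nonneg) auto
  define K where "K = (?V + 1) * W"
  have K: "K > 0" unfolding K_def using W(1) by (intro mult_pos_pos) (auto simp: add_nonneg_pos)
  have "((\<lambda>p. 1 / (K powr (1 / p) * (S * morrey_const ?n p \<rho>))) \<longlongrightarrow> 1 / (1 * (S * 1))) at_top"
    using S by (intro tendsto_divide tendsto_mult tendsto_const powr_inverse_tendsto_1[OF K] morrey_const_tendsto_1[OF \<rho>(2)]) auto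
  then have "eventually (\<lambda>p. B < 1 / (K powr (1 / p) * (S * morrey_const ?n p \<rho>))) at_top"
    using \<rho>(1) unfolding S_def by (intro order_tendstoD(1)) auto
  then show ?thesis
    using ex eventually_gt_at_top[of ?n]
  proof eventually_elim
    case (elim p)
    have pn: "p > ?n" by fact
    have p: "p > 0" using pn by (rule le_less_trans[rotated]) simp
    define T where "T = S * morrey_const ?n p \<rho>"
    have T: "T > 0" unfolding T_def using S morrey_const_pos[OF pn _ \<rho>(2)] by simp
    have "1 / (K * T powr p) \<le> test_min p"
    proof (rule test_min_greatest[OF p elim(2)])
      fix \<phi> assume \<phi>: "\<phi> \<in> test_functions \<Omega>" and 1: "mass p \<phi> = 1"
      note I = test_in_Lp[OF \<phi> p]
      let ?L = "Lp_power p \<Omega> (grad \<phi>)"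
      have L0: "0 \<le> ?L" by (rule Lp_power_nonneg)
      have pointwise: "m x * \<bar>\<phi> x\<bar> powr p \<le> W * (T powr p * ?L)" if x: "x \<in> \<Omega>" for x
      proof (cases "m x > 0")
        case True
        then have "x \<in> Omega_plus \<Omega> m" using x positive_subset_Omega_plus by auto
        then have dR: "infdist x (frontier \<Omega>) \<le> ?R" by (rule R(2))
        obtain z where z: "z \<in> frontier \<Omega>" "infdist x (frontier \<Omega>) = dist x z"
          using infdist_attains_inf[OF frontier_closed frontier_nonempty] by blast
        have "z \<notin> \<Omega>" using z(1) open_domain by (simp add: frontier_def interior_open)
        then have "\<phi> z = 0" using \<phi> by (auto simp: test_functions_iff)
        then have "\<bar>\<phi> x\<bar> = \<bar>\<phi> x - \<phi> z\<bar>" by simp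
        also have "\<dots> \<le> (norm (x - z) + 2 * \<rho> * ?n) * morrey_const ?n p \<rho> * ?L powr (1 / p)"
          by (rule test_morrey_Lp[OF \<phi> domain_measurable(2) pn \<rho>(2)])
        also have "\<dots> \<le> T * ?L powr (1 / p)"
          unfolding T_def S_def using dR z(2) morrey_const_pos[OF pn _ \<rho>(2)]
          by (intro mult_right_mono) (auto simp: dist_norm)
        finally have "\<bar>\<phi> x\<bar> powr p \<le> (T * ?L powr (1 / p)) powr p" using p by (intro powr_mono2) auto
        also have "\<dots> = T powr p * ?L" using T L0 p by (simp add: powr_mult powr_powr)
        finally show ?thesis using True W(2)[OF x] W(1) by (intro mult_mono) auto
      next
        case False
        then have "m x * \<bar>\<phi> x\<bar> powr p \<le> 0" by (simp add: mult_nonpos_nonneg)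
        also have "0 \<le> W * (T powr p * ?L)" using W(1) L0 by simp
        finally show ?thesis .
      qed
      have "mass p \<phi> \<le> (LINT x|lebesgue_on \<Omega>. W * (T powr p * ?L))"
        unfolding mass_def using pointwise
        by (intro integral_mono[OF weighted_integrable(1)[OF I(1)] integrable_const]) auto
      also have "\<dots> = ?V * (W * (T powr p * ?L))" by simp
      also have "\<dots> \<le> (?V + 1) * (W * (T powr p * ?L))" using W(1) L0 by (intro mult_right_mono) auto
      also have "\<dots> = K * T powr p * ?L" unfolding K_def by simp
      also have "\<dots> \<le> K * T powr p * energy p \<phi> (grad \<phi>)"
        using K Lp_power_le_energy[OF I] by (intro mult_left_mono) auto
      finally show "1 / (K * T powr p) \<le> energy p \<phi> (grad \<phi>)" using 1 K T by (simp add: field_simps)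
    qed
    then have "(1 / (K * T powr p)) powr (1 / p) \<le> test_min p powr (1 / p)" using K T p by (intro powr_mono2) auto
    moreover have "(1 / (K * T powr p)) powr (1 / p) = 1 / (K powr (1 / p) * T)"
      using K T p by (simp add: powr_divide powr_mult powr_powr)
    ultimately show ?case using elim(1) unfolding T_def by linarith
  qed
qed

end

theorem theorem1p5:
  fixes \<Omega> :: "'a::euclidean_space set" and m C :: "'a \<Rightarrow> real"
  assumes "smooth_bounded_domain \<Omega>"
    and "continuous_on (closure \<Omega>) m" and "changes_sign \<Omega> m"
    and "continuous_on (closure \<Omega>) C" and "\<forall>x\<in>closure \<Omega>. C x > 0"
  shows "((\<lambda>p. lambda_1p p \<Omega> C m powr (1 / p)) \<longlongrightarrow> max (1 / R_plus \<Omega> m) 1) at_top"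
proof -
  interpret eigenvalue_problem \<Omega> m C
    using assms by unfold_locales (auto simp: smooth_bounded_domain_def)
  have pos: "{x \<in> \<Omega>. m x > 0} \<noteq> {}" using assms(3) by (simp add: changes_sign_def)
  let ?l = "max (1 / R_plus \<Omega> m) 1"
  have ex: "eventually (\<lambda>p. \<exists>\<phi>\<in>test_functions \<Omega>. mass p \<phi> > 0) at_top"
    using eventually_test_min_less[OF pos, of "?l + 1"] by (auto elim: eventually_mono)
  have "((\<lambda>p. test_min p powr (1 / p)) \<longlongrightarrow> ?l) at_top"
  proof (rule order_tendstoI)
    fix B assume "B < ?l"
    then consider "B < 1" | "B < 1 / R_plus \<Omega> m" by linarith
    then show "eventually (\<lambda>p. B < test_min p powr (1 / p)) at_top"
      using eventually_test_min_greater_if_less_1[OF ex] eventually_test_min_greater_if_less_R[OF pos ex]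
      by cases auto
  next
    fix B assume "?l < B"
    then show "eventually (\<lambda>p. test_min p powr (1 / p) < B) at_top"
      using eventually_test_min_less[OF pos, of B] by (auto elim: eventually_mono)
  qed
  moreover have "eventually (\<lambda>p. test_min p powr (1 / p) = lambda_1p p \<Omega> C m powr (1 / p)) at_top"
    using ex eventually_gt_at_top[of "real DIM('a)"] eventually_ge_at_top[of 2]
    by eventually_elim (simp add: lambda_1p_eq_test_min)
  ultimately show ?thesis by (rule Lim_transform_eventually)
qed

end
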